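(* (i) If the optimal continuous system state and adjoint system state have the regularity $u_{\alpha q_{\alpha_{op}}},p_{\alpha q_{\alpha_{op}}}\in H^r(\Omega)$ ($1<r\le2$) and $\dfrac{M\lambda_1^2}{\|\gamma_0\|^2}>1$, then for all $\alpha>1$ $$\|q_{h\alpha_{op}}-q_{\alpha_{op}}\|_Q\le ch^{r-1},\qquad \|u_{h\alpha q_{h\alpha_{op}}}-u_{\alpha q_{\alpha_{op}}}\|_V\le ch^{r-1},\qquad \|p_{h\alpha q_{h\alpha_{op}}}-p_{\alpha q_{\alpha_{op}}}\|_V\le ch^{r-1},$$ where the constants $c$ are independent of $h$. (ii) For all $\alpha>1$, $$\lim_{h\to0^+}\|q_{h\alpha_{op}}-q_{\alpha_{op}}\|_Q=0,\qquad \lim_{h\to0^+}\|u_{h\alpha q_{h\alpha_{op}}}-u_{\alpha q_{\alpha_{op}}}\|_V=0,\qquad \lim_{h\to0^+}\|p_{h\alpha q_{h\alpha_{op}}}-p_{\alpha q_{\alpha_{op}}}\|_V=0 .$$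
   Context: Setting. $\Omega\subset\mathbb{R}^n$ is a bounded polygonal domain with regular boundary $\Gamma=\partial\Omega=\Gamma_1\cup\Gamma_2$, a union of two disjoint portions of positive measure. $H=L^2(\Omega)$, $V=H^1(\Omega)$, $Q=L^2(\Gamma_2)$. $b>0$ is a constant, $g,z_d\in H$ and $M>0$ are given. $(u,v)_H=\int_\Omega uv\,dx$, $(q,v)_Q=\int_{\Gamma_2}qv\,d\gamma$ (with the trace of $v$), $a(u,v)=\int_\Omega\nabla u\cdot\nabla v\,dx$ and, for $\alpha>0$, $a_\alpha(u,v)=a(u,v)+\alpha\int_{\Gamma_1}uv\,d\gamma$. $\gamma_0:V\to Q$ is the trace operator, with operator norm $\|\gamma_0\|$. $\lambda_1>0$ is the coercivity constant of $a_1$ ($a_\alpha$ with $\alpha=1$) on $V$: $\lambda_1\|v\|_V^2\le a_1(v,v)$ for all $v\in V$; then $\lambda_\alpha=\lambda_1\min(1,\alpha)$ is a coercivity constant of $a_\alpha$ on $V$. Continuous problem. For $\alpha>0$, $q\in Q$: $u_{\alpha q}\in V$ solves $a_\alpha(u_{\alpha q},v)=(g,v)_H-(q,v)_Q+\alpha\int_{\Gamma_1}bv\,d\gamma$ for all $v\in V$; $p_{\alpha q}\in V$ solves $a_\alpha(p_{\alpha q},v)=(u_{\alpha q}-z_d,v)_H$ for all $v\in V$. $J_\alpha(q)=\frac12\|u_{\alpha q}-z_d\|_H^2+\frac M2\|q\|_Q^2$, and $q_{\alpha_{op}}$ is the unique minimizer of $J_\alpha$ over $Q$. Discrete problem. For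 $h>0$, $\tau_h$ is a regular triangulation of $\Omega$ by Lagrange triangles of type 1 (affine-equivalent finite elements of class $C^0$), $h$ being the longest side of the triangles; $h$ is the approximation parameter, which goes to zero. $V_h=\{v_h\in C^0(\overline\Omega): v_h|_T\in P_1(T)\ \forall T\in\tau_h\}$ ($P_1$: polynomials of degree $\le1$). The linear interpolation operator $\pi_h$ into $V_h$ satisfies, with $c_0>0$ independent of $h$, $\|v-\pi_h(v)\|_H\le c_0h^r\|v\|_r$ and $\|v-\pi_h(v)\|_V\le c_0h^{r-1}\|v\|_r$ for $v\in H^r(\Omega)$, $1<r\le2$, where $\|\cdot\|_r$ is the $H^r(\Omega)$ norm. For $q\in Q$: $u_{h\alpha q}\in V_h$ solves $a_\alpha(u_{h\alpha q},v_h)=(g,v_h)_H-(q,v_h)_Q+\alpha\int_{\Gamma_1}bv_h\,d\gamma$ for all $v_h\in V_h$; $p_{h\alpha q}\in V_h$ solves $a_\alpha(p_{h\alpha q},v_h)=(u_{h\alpha q}-z_d,v_h)_H$ for all $v_h\in V_h$. $J_{h\alpha}(q)=\frac12\|u_{h\alpha q}-z_d\|_H^2+\frac M2\|q\|_Q^2$, and $q_{h\alpha_{op}}$ is the unique minimizer of $J_{h\alpha}$ over $Q$. *)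

theory Defs
  imports "HOL-Analysis.Analysis"
begin

section \<open>Function spaces\<close>

text \<open>Elements of the function spaces below are representatives (total functions); equality in the
  spaces is equality almost everywhere, and only values on the underlying set matter.\<close>

definition L2 :: "'a measure \<Rightarrow> ('a \<Rightarrow> real) set" where
  "L2 N = {f \<in> borel_measurable N. integrable N (\<lambda>x. (f x)\<^sup>2)}"

definition L2_inner :: "'a measure \<Rightarrow> ('a \<Rightarrow> real) \<Rightarrow> ('a \<Rightarrow> real) \<Rightarrow> real" where
  "L2_inner N f g = (\<integral>x. f x * g x \<partial>N)"

definition L2_norm :: "'a measure \<Rightarrow> ('a \<Rightarrow> real) \<Rightarrow> real" where
  "L2_norm N f = sqrt (L2_inner N f f)"

primrec C_k :: "nat \<Rightarrow> ('a::euclidean_space \<Rightarrow> real) \<Rightarrow> bool" where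
  "C_k 0 f \<longleftrightarrow> continuous_on UNIV f"
| "C_k (Suc k) f \<longleftrightarrow> (\<forall>x. f differentiable (at x)) \<and>
     (\<forall>i\<in>Basis. C_k k (\<lambda>x. frechet_derivative f (at x) i))"

definition smooth :: "('a::euclidean_space \<Rightarrow> real) \<Rightarrow> bool" where
  "smooth f \<longleftrightarrow> (\<forall>k. C_k k f)"

definition test_functions :: "'a::euclidean_space set \<Rightarrow> ('a \<Rightarrow> real) set" where
  "test_functions \<Omega> = {\<phi>. smooth \<phi> \<and> compact (closure {x. \<phi> x \<noteq> 0}) \<and> closure {x. \<phi> x \<noteq> 0} \<subseteq> \<Omega>}"

definition weak_gradient ::
  "'a::euclidean_space set \<Rightarrow> ('a \<Rightarrow> real) \<Rightarrow> ('a \<Rightarrow> 'a) \<Rightarrow> bool" where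
  "weak_gradient \<Omega> v G \<longleftrightarrow> (\<forall>i\<in>Basis. (\<lambda>x. G x \<bullet> i) \<in> L2 (lebesgue_on \<Omega>) \<and>
     (\<forall>\<phi>\<in>test_functions \<Omega>.
        (\<integral>x. v x * frechet_derivative \<phi> (at x) i \<partial>lebesgue_on \<Omega>) =
        - (\<integral>x. (G x \<bullet> i) * \<phi> x \<partial>lebesgue_on \<Omega>)))"

definition H1 :: "'a::euclidean_space set \<Rightarrow> ('a \<Rightarrow> real) set" where
  "H1 \<Omega> = {v \<in> L2 (lebesgue_on \<Omega>). \<exists>G. weak_gradient \<Omega> v G}"

text \<open>The weak gradient is unique up to a null set, so the choice is immaterial under integrals.\<close>

definition wgrad :: "'a::euclidean_space set \<Rightarrow> ('a \<Rightarrow> real) \<Rightarrow> 'a \<Rightarrow> 'a" where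
  "wgrad \<Omega> v = (SOME G. weak_gradient \<Omega> v G)"

definition dirichlet_form ::
  "'a::euclidean_space set \<Rightarrow> ('a \<Rightarrow> real) \<Rightarrow> ('a \<Rightarrow> real) \<Rightarrow> real" where
  "dirichlet_form \<Omega> u v = (\<integral>x. wgrad \<Omega> u x \<bullet> wgrad \<Omega> v x \<partial>lebesgue_on \<Omega>)"

definition H1_norm :: "'a::euclidean_space set \<Rightarrow> ('a \<Rightarrow> real) \<Rightarrow> real" where
  "H1_norm \<Omega> v = sqrt ((L2_norm (lebesgue_on \<Omega>) v)\<^sup>2 + dirichlet_form \<Omega> v v)"

text \<open>The space of order \<open>r\<close> for \<open>1 < r \<le> 2\<close>: the Sobolev--Slobodeckij space when \<open>r < 2\<close>, and the
  usual second order Sobolev space when \<open>r = 2\<close>.\<close>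

definition slobodeckij_quotient ::
  "real \<Rightarrow> ('a::euclidean_space \<Rightarrow> real) \<Rightarrow> 'a \<times> 'a \<Rightarrow> real" where
  "slobodeckij_quotient s f = (\<lambda>(x, y). (f x - f y)\<^sup>2 / dist x y powr (real DIM('a) + 2 * s))"

definition Hr :: "'a::euclidean_space set \<Rightarrow> real \<Rightarrow> ('a \<Rightarrow> real) set" where
  "Hr \<Omega> r = {v \<in> H1 \<Omega>. \<forall>i\<in>Basis.
     if r < 2 then integrable (lebesgue_on \<Omega> \<Otimes>\<^sub>M lebesgue_on \<Omega>)
                     (slobodeckij_quotient (r - 1) (\<lambda>x. wgrad \<Omega> v x \<bullet> i))
     else (\<lambda>x. wgrad \<Omega> v x \<bullet> i) \<in> H1 \<Omega>}"

definition Hr_norm :: "'a::euclidean_space set \<Rightarrow> real \<Rightarrow> ('a \<Rightarrow> real) \<Rightarrow> real" where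
  "Hr_norm \<Omega> r v = sqrt ((H1_norm \<Omega> v)\<^sup>2 + (\<Sum>i\<in>Basis.
     let f = (\<lambda>x. wgrad \<Omega> v x \<bullet> i) in
     if r < 2 then integral\<^sup>L (lebesgue_on \<Omega> \<Otimes>\<^sub>M lebesgue_on \<Omega>) (slobodeckij_quotient (r - 1) f)
     else dirichlet_form \<Omega> f f))"


section \<open>Domains and surface measure\<close>

definition polygonal_domain :: "'a::euclidean_space set \<Rightarrow> bool" where
  "polygonal_domain \<Omega> \<longleftrightarrow> open \<Omega> \<and> connected \<Omega> \<and> \<Omega> \<noteq> {} \<and> bounded \<Omega> \<and>
     (\<exists>P. finite P \<and> (\<forall>K\<in>P. polytope K) \<and> closure \<Omega> = \<Union>P)"

text \<open>Near every boundary point the domain is the strict subgraph, in some direction \<open>e\<close>, of a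
  Lipschitz function \<open>\<psi>\<close> of the component orthogonal to \<open>e\<close>.\<close>

definition lipschitz_boundary :: "'a::euclidean_space set \<Rightarrow> bool" where
  "lipschitz_boundary \<Omega> \<longleftrightarrow> (\<forall>x\<in>frontier \<Omega>. \<exists>e \<epsilon> L. \<exists>\<psi>::'a \<Rightarrow> real.
     norm e = 1 \<and> \<epsilon> > 0 \<and> L-lipschitz_on UNIV \<psi> \<and>
     \<Omega> \<inter> ball x \<epsilon> = {y \<in> ball x \<epsilon>. y \<bullet> e < \<psi> (y - (y \<bullet> e) *\<^sub>R e)})"

text \<open>The Hausdorff measure of codimension one, normalised to agree with Lebesgue measure on
  hyperplanes. Its restriction to the Borel sets is a measure, so \<^const>\<open>measure_of\<close> preserves its
  values there. The empty set is singled out only because of \<open>0 ^ 0 = 1\<close> in dimension one.\<close>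

definition hausdorff_content :: "real \<Rightarrow> 'a::euclidean_space set \<Rightarrow> ennreal" where
  "hausdorff_content \<delta> A =
     (INF C\<in>{C::nat \<Rightarrow> 'a set. A \<subseteq> (\<Union>k. C k) \<and> (\<forall>k. bounded (C k) \<and> diameter (C k) \<le> \<delta>)}.
        \<Sum>k. if C k = {} then 0
             else ennreal (unit_ball_vol (real (DIM('a) - 1)) * (diameter (C k) / 2) ^ (DIM('a) - 1)))"

definition surface_measure :: "'a::euclidean_space measure" where
  "surface_measure = measure_of UNIV (sets borel) (\<lambda>A. SUP \<delta>\<in>{0<..}. hausdorff_content \<delta> A)"

definition surface_on :: "'a::euclidean_space set \<Rightarrow> 'a measure" where
  "surface_on S = restrict_space surface_measure S"

text \<open>The trace operator: the continuous linear extension to the whole of \<open>H1\<close> of the restriction to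
  the boundary of functions that are smooth up to the boundary. The last clause is the extension by
  density, which determines the operator.\<close>

definition trace_operator ::
  "'a::euclidean_space set \<Rightarrow> (('a \<Rightarrow> real) \<Rightarrow> 'a \<Rightarrow> real) \<Rightarrow> bool" where
  "trace_operator \<Omega> tr \<longleftrightarrow> (let N = surface_on (frontier \<Omega>) in
     (\<forall>v\<in>H1 \<Omega>. tr v \<in> L2 N) \<and>
     (\<forall>v\<in>H1 \<Omega>. \<forall>w\<in>H1 \<Omega>. \<forall>c. AE x in N. tr (\<lambda>x. v x + c * w x) x = tr v x + c * tr w x) \<and>
     (\<exists>C. \<forall>v\<in>H1 \<Omega>. L2_norm N (tr v) \<le> C * H1_norm \<Omega> v) \<and>
     (\<forall>\<phi>. smooth \<phi> \<longrightarrow> (AE x in N. tr \<phi> x = \<phi> x)) \<and>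
     (\<forall>v\<in>H1 \<Omega>. \<exists>\<phi>. (\<forall>k::nat. smooth (\<phi> k) \<and> \<phi> k \<in> L2 N) \<and>
        (\<lambda>k. H1_norm \<Omega> (\<lambda>x. \<phi> k x - v x)) \<longlonglongrightarrow> 0 \<and>
        (\<lambda>k. L2_norm N (\<lambda>x. \<phi> k x - tr v x)) \<longlonglongrightarrow> 0))"

text \<open>Operator norm of the trace as a map from \<open>H1\<close> to the square integrable functions on \<open>S\<close>,
  written as in \<^const>\<open>onorm\<close>.\<close>

definition trace_norm ::
  "'a::euclidean_space set \<Rightarrow> 'a set \<Rightarrow> (('a \<Rightarrow> real) \<Rightarrow> 'a \<Rightarrow> real) \<Rightarrow> real" where
  "trace_norm \<Omega> S tr = (SUP v\<in>H1 \<Omega>. L2_norm (surface_on S) (tr v) / H1_norm \<Omega> v)"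


section \<open>Finite elements\<close>

definition fe_mesh :: "'a::euclidean_space set \<Rightarrow> 'a set set \<Rightarrow> bool" where
  "fe_mesh \<Omega> \<T> \<longleftrightarrow>
     triangulation \<T> \<and> (\<forall>T\<in>\<T>. int DIM('a) simplex T) \<and> \<Union>\<T> = closure \<Omega>"

text \<open>The diameter of a simplex is the length of its longest side.\<close>

definition mesh_size :: "'a::euclidean_space set set \<Rightarrow> real" where
  "mesh_size \<T> = Max (diameter ` \<T>)"

text \<open>Shape regularity with constant \<open>\<sigma>\<close>: each element contains a ball whose diameter is at least
  \<open>1/\<sigma>\<close> times that of the element.\<close>

definition shape_regular :: "real \<Rightarrow> 'a::euclidean_space set set \<Rightarrow> bool" where
  "shape_regular \<sigma> \<T> \<longleftrightarrow> (\<forall>T\<in>\<T>. \<exists>x \<rho>. \<rho> > 0 \<and> cball x \<rho> \<subseteq> T \<and> diameter T \<le> \<sigma> * (2 * \<rho>))"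

definition fe_space :: "'a::euclidean_space set \<Rightarrow> 'a set set \<Rightarrow> ('a \<Rightarrow> real) set" where
  "fe_space \<Omega> \<T> = {v. continuous_on (closure \<Omega>) v \<and>
     (\<forall>T\<in>\<T>. \<exists>d c. \<forall>x\<in>T. v x = d \<bullet> x + c)}"

text \<open>\<open>\<pi>\<close> maps each function having a representative \<open>w\<close> continuous up to the boundary to the
  finite element function with the same values as \<open>w\<close> at the vertices of the mesh.\<close>

definition interpolation_operator ::
  "'a::euclidean_space set \<Rightarrow> 'a set set \<Rightarrow> (('a \<Rightarrow> real) \<Rightarrow> 'a \<Rightarrow> real) \<Rightarrow> bool" where
  "interpolation_operator \<Omega> \<T> \<pi> \<longleftrightarrow>
     (\<forall>v w. continuous_on (closure \<Omega>) w \<and> (AE x in lebesgue_on \<Omega>. v x = w x) \<longrightarrow>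
        \<pi> v \<in> fe_space \<Omega> \<T> \<and> (\<forall>T\<in>\<T>. \<forall>x. x extreme_point_of T \<longrightarrow> \<pi> v x = w x))"


section \<open>The control problems\<close>

definition robin_form ::
  "'a::euclidean_space set \<Rightarrow> 'a set \<Rightarrow> (('a \<Rightarrow> real) \<Rightarrow> 'a \<Rightarrow> real) \<Rightarrow> real
     \<Rightarrow> ('a \<Rightarrow> real) \<Rightarrow> ('a \<Rightarrow> real) \<Rightarrow> real" where
  "robin_form \<Omega> \<Gamma>\<^sub>1 tr \<alpha> u v = dirichlet_form \<Omega> u v + \<alpha> * L2_inner (surface_on \<Gamma>\<^sub>1) (tr u) (tr v)"

text \<open>The space \<open>W\<close> is \<^term>\<open>H1 \<Omega>\<close> for the continuous problem and the finite element space for the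
  discrete one.\<close>

definition is_state ::
  "'a::euclidean_space set \<Rightarrow> 'a set \<Rightarrow> 'a set \<Rightarrow> (('a \<Rightarrow> real) \<Rightarrow> 'a \<Rightarrow> real)
     \<Rightarrow> real \<Rightarrow> ('a \<Rightarrow> real) \<Rightarrow> ('a \<Rightarrow> real) set \<Rightarrow> real \<Rightarrow> ('a \<Rightarrow> real) \<Rightarrow> ('a \<Rightarrow> real) \<Rightarrow> bool" where
  "is_state \<Omega> \<Gamma>\<^sub>1 \<Gamma>\<^sub>2 tr b g W \<alpha> q u \<longleftrightarrow> u \<in> W \<and>
     (\<forall>v\<in>W. robin_form \<Omega> \<Gamma>\<^sub>1 tr \<alpha> u v =
        L2_inner (lebesgue_on \<Omega>) g v - L2_inner (surface_on \<Gamma>\<^sub>2) q (tr v)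
        + \<alpha> * (\<integral>x. b * tr v x \<partial>surface_on \<Gamma>\<^sub>1))"

definition is_adjoint_state ::
  "'a::euclidean_space set \<Rightarrow> 'a set \<Rightarrow> (('a \<Rightarrow> real) \<Rightarrow> 'a \<Rightarrow> real)
     \<Rightarrow> ('a \<Rightarrow> real) \<Rightarrow> ('a \<Rightarrow> real) set \<Rightarrow> real \<Rightarrow> ('a \<Rightarrow> real) \<Rightarrow> ('a \<Rightarrow> real) \<Rightarrow> bool" where
  "is_adjoint_state \<Omega> \<Gamma>\<^sub>1 tr z W \<alpha> u p \<longleftrightarrow> p \<in> W \<and>
     (\<forall>v\<in>W. robin_form \<Omega> \<Gamma>\<^sub>1 tr \<alpha> p v = L2_inner (lebesgue_on \<Omega>) (\<lambda>x. u x - z x) v)"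

definition cost ::
  "'a::euclidean_space set \<Rightarrow> 'a set \<Rightarrow> real \<Rightarrow> ('a \<Rightarrow> real)
     \<Rightarrow> (('a \<Rightarrow> real) \<Rightarrow> 'a \<Rightarrow> real) \<Rightarrow> ('a \<Rightarrow> real) \<Rightarrow> real" where
  "cost \<Omega> \<Gamma>\<^sub>2 M z S q =
     (L2_norm (lebesgue_on \<Omega>) (\<lambda>x. S q x - z x))\<^sup>2 / 2 + M / 2 * (L2_norm (surface_on \<Gamma>\<^sub>2) q)\<^sup>2"

definition optimal_control ::
  "'a::euclidean_space set \<Rightarrow> 'a set \<Rightarrow> real \<Rightarrow> ('a \<Rightarrow> real)
     \<Rightarrow> (('a \<Rightarrow> real) \<Rightarrow> 'a \<Rightarrow> real) \<Rightarrow> ('a \<Rightarrow> real) \<Rightarrow> bool" where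
  "optimal_control \<Omega> \<Gamma>\<^sub>2 M z S q \<longleftrightarrow>
     is_arg_min (cost \<Omega> \<Gamma>\<^sub>2 M z S) (\<lambda>q. q \<in> L2 (surface_on \<Gamma>\<^sub>2)) q"

end

theory Submission
  imports Defs
begin

text \<open>
  Write \<open>q\<close>, \<open>qh\<close> for the two optimal controls. The optimality conditions read \<open>M q = tr p(q)\<close> and
  \<open>M qh = tr ph(qh)\<close> on \<open>\<Gamma>\<^sub>2\<close>, so \<open>M\<close> times the square of the norm of \<open>qh - q\<close> is the pairing of
  \<open>qh - q\<close> with the trace of \<open>(ph(qh) - ph(q)) + (ph(q) - p(q))\<close>. The first summand contributes
  minus the square of the norm of \<open>uh(qh) - uh(q)\<close>. Hence the control error is bounded by the
  Galerkin error of the adjoint state at the fixed control \<open>q\<close>, without any smallness condition, and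
  by Cea's lemma all errors are bounded by the distances of \<open>u(q)\<close> and \<open>p(q)\<close> from the finite element
  space. Under regularity these distances are estimated by interpolation. In general they tend to
  zero because smooth functions are dense and have every regularity \<open>Hr\<close> with \<open>r \<le> 2\<close>.

  The comparison needs the finite element space to lie in \<open>H1\<close> and the weak gradient to be linear,
  that is, unique almost everywhere.
\<close>

section \<open>Galerkin approximation of an abstract control problem\<close>

text \<open>Functions are representatives, so every form is only semidefinite: two solutions of the
  same equation may differ by a null function, traces are linear only almost everywhere, and the
  given state maps need not be affine. Hence the abstract part uses neither definiteness nor
  linearity of solution maps; it rests on Cauchy-Schwarz for semi-inner products and tests every
  identity against elements of the trial space. Its constant is built from bounds that hold on all
  of V and is fixed before the trial space is chosen. The finite element space has to lie in
  \<open>H1\<close> because coercivity and the trace bounds are stated there. Since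
  \<open>wgrad\<close> is an arbitrary choice, its linearity is settled by the fundamental lemma of
  the calculus of variations, with bump functions made for boxes. Interpolation errors are
  controlled on \<open>Hr\<close> only, so for the limits smooth approximants are fixed at a given
  tolerance before h tends to 0; their density is read off the extension clause of
  \<open>trace_operator\<close>.\<close>

locale semi_inner =
  fixes S :: "('a \<Rightarrow> real) set" and ip :: "('a \<Rightarrow> real) \<Rightarrow> ('a \<Rightarrow> real) \<Rightarrow> real"
  assumes closed: "v \<in> S \<Longrightarrow> w \<in> S \<Longrightarrow> (\<lambda>x. v x + c * w x) \<in> S"
    and sym: "v \<in> S \<Longrightarrow> w \<in> S \<Longrightarrow> ip v w = ip w v"
    and linear: "v \<in> S \<Longrightarrow> w \<in> S \<Longrightarrow> y \<in> S \<Longrightarrow> ip (\<lambda>x. v x + c * w x) y = ip v y + c * ip w y"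
    and nonneg: "v \<in> S \<Longrightarrow> 0 \<le> ip v v"
begin

definition nrm :: "('a \<Rightarrow> real) \<Rightarrow> real" where "nrm v = sqrt (ip v v)"

lemma nrm_ge_0: "v \<in> S \<Longrightarrow> 0 \<le> nrm v"
  by (simp add: nrm_def nonneg)

lemma nrm_sq: "v \<in> S \<Longrightarrow> (nrm v)\<^sup>2 = ip v v"
  by (simp add: nrm_def nonneg)

lemma diff_closed: "v \<in> S \<Longrightarrow> w \<in> S \<Longrightarrow> (\<lambda>x. v x - w x) \<in> S"
  using closed[of v w "-1"] by simp

lemma add_closed: "v \<in> S \<Longrightarrow> w \<in> S \<Longrightarrow> (\<lambda>x. v x + w x) \<in> S"
  using closed[of v w 1] by simp

lemma diff_left:
  "v \<in> S \<Longrightarrow> w \<in> S \<Longrightarrow> y \<in> S \<Longrightarrow> ip (\<lambda>x. v x - w x) y = ip v y - ip w y"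
  using linear[of v w y "-1"] by simp

lemma diff_right:
  "v \<in> S \<Longrightarrow> w \<in> S \<Longrightarrow> y \<in> S \<Longrightarrow> ip y (\<lambda>x. v x - w x) = ip y v - ip y w"
  by (simp add: sym[of y] diff_closed diff_left)

lemma linear_right:
  "v \<in> S \<Longrightarrow> w \<in> S \<Longrightarrow> y \<in> S \<Longrightarrow> ip y (\<lambda>x. v x + c * w x) = ip y v + c * ip y w"
  by (simp add: sym[of y] closed linear)

lemma square_expand:
  assumes "v \<in> S" "w \<in> S"
  shows "ip (\<lambda>x. v x + t * w x) (\<lambda>x. v x + t * w x) = ip v v + 2 * t * ip v w + t\<^sup>2 * ip w w"
  using assms by (simp add: linear linear_right closed sym[of w v] power2_eq_square algebra_simps)

text \<open>A nonnegative quadratic in t has nonpositive discriminant. As the form is only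
  semidefinite, the case \<open>ip w w = 0\<close> needs its own argument: a nonnegative affine
  function of t has slope 0.\<close>

lemma cauchy_schwarz:
  assumes "v \<in> S" "w \<in> S"
  shows "\<bar>ip v w\<bar> \<le> nrm v * nrm w"
proof -
  have q: "0 \<le> ip v v + 2 * t * ip v w + t\<^sup>2 * ip w w" for t
    using nonneg[OF closed[OF assms]] square_expand[OF assms] by metis
  have "(ip v w)\<^sup>2 \<le> ip v v * ip w w"
  proof (cases "ip w w = 0")
    case True
    have "ip v w = 0"
    proof (rule ccontr)
      assume n: "ip v w \<noteq> 0"
      \<comment> \<open>This t is chosen so that the affine function takes the value -1.\<close>
      have "0 \<le> ip v v + 2 * (- (ip v v + 1) / (2 * ip v w)) * ip v w"
        using q[of "- (ip v v + 1) / (2 * ip v w)"] True by simp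
      also have "\<dots> = -1" using n by (simp add: field_simps)
      finally show False by simp
    qed
    then show ?thesis using True by simp
  next
    case False
    then have p: "ip w w > 0" using nonneg[OF assms(2)] by linarith
    \<comment> \<open>Here t is the minimiser of the quadratic.\<close>
    have "0 \<le> ip v v + 2 * (- ip v w / ip w w) * ip v w + (- ip v w / ip w w)\<^sup>2 * ip w w"
      by (rule q)
    also have "\<dots> = ip v v - (ip v w)\<^sup>2 / ip w w"
      using p by (simp add: field_simps power2_eq_square)
    finally show ?thesis using p by (simp add: field_simps)
  qed
  then have "\<bar>ip v w\<bar> \<le> sqrt (ip v v * ip w w)"
    by (metis real_sqrt_abs real_sqrt_le_mono)
  then show ?thesis by (simp add: nrm_def real_sqrt_mult)
qed

lemma nrm_add_le:
  assumes "v \<in> S" "w \<in> S"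
  shows "nrm (\<lambda>x. v x + w x) \<le> nrm v + nrm w"
proof (rule power2_le_imp_le)
  have "(nrm (\<lambda>x. v x + w x))\<^sup>2 = ip v v + 2 * ip v w + ip w w"
    using square_expand[OF assms, of 1] nrm_sq[OF add_closed[OF assms]] by simp
  also have "\<dots> \<le> (nrm v + nrm w)\<^sup>2"
    using cauchy_schwarz[OF assms] assms by (simp add: power2_sum nrm_sq abs_le_iff)
  finally show "(nrm (\<lambda>x. v x + w x))\<^sup>2 \<le> (nrm v + nrm w)\<^sup>2" .
  show "0 \<le> nrm v + nrm w" using assms by (simp add: nrm_ge_0)
qed

lemma nrm_diff_swap:
  assumes "v \<in> S" "w \<in> S"
  shows "nrm (\<lambda>x. v x - w x) = nrm (\<lambda>x. w x - v x)"
  using assms by (simp add: nrm_def diff_left diff_right diff_closed sym[of v w])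

lemma nrm_triangle:
  assumes "v \<in> S" "w \<in> S" "y \<in> S"
  shows "nrm (\<lambda>x. v x - y x) \<le> nrm (\<lambda>x. v x - w x) + nrm (\<lambda>x. w x - y x)"
  using nrm_add_le[OF diff_closed[OF assms(1,2)] diff_closed[OF assms(2,3)]] by simp

text \<open>Stands in for definiteness: a null vector need not vanish, but the form cannot see
  it.\<close>

lemma nrm_0_orthogonal:
  assumes "v \<in> S" "w \<in> S" "ip v v = 0"
  shows "ip v w = 0"
  using cauchy_schwarz[OF assms(1,2)] assms(3) by (simp add: nrm_def)

end

text \<open>\<open>state\<close> and \<open>adj\<close> are relative to a trial space \<open>W\<close>, so that the continuous problem
  (\<open>W = V\<close>) and the Galerkin problems are treated at once. The load \<open>F\<close> always cancels.\<close>

locale control_problem =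
  H: semi_inner HH iH + V: semi_inner V iV + A: semi_inner V a + Q: semi_inner QQ iQ
  for HH V QQ :: "('a \<Rightarrow> real) set" and iH iV a iQ +
  fixes \<gamma> :: "('a \<Rightarrow> real) \<Rightarrow> 'a \<Rightarrow> real" and F :: "('a \<Rightarrow> real) \<Rightarrow> real"
    and z :: "'a \<Rightarrow> real" and M \<kappa> C\<^sub>a C\<^sub>\<gamma> :: real
  assumes V_H: "V \<subseteq> HH" and H_le_V: "v \<in> V \<Longrightarrow> iH v v \<le> iV v v"
    and \<kappa>: "\<kappa> > 0" "v \<in> V \<Longrightarrow> \<kappa> * iV v v \<le> a v v"
    and C\<^sub>a: "C\<^sub>a \<ge> 0" "v \<in> V \<Longrightarrow> a v v \<le> C\<^sub>a * iV v v"
    and \<gamma>_in: "v \<in> V \<Longrightarrow> \<gamma> v \<in> QQ"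
    and \<gamma>_linear: "v \<in> V \<Longrightarrow> w \<in> V \<Longrightarrow> q \<in> QQ \<Longrightarrow>
        iQ q (\<gamma> (\<lambda>x. v x + c * w x)) = iQ q (\<gamma> v) + c * iQ q (\<gamma> w)"
    and C\<^sub>\<gamma>: "C\<^sub>\<gamma> \<ge> 0" "v \<in> V \<Longrightarrow> Q.nrm (\<gamma> v) \<le> C\<^sub>\<gamma> * V.nrm v"
    and z: "z \<in> HH" and M: "M > 0"
begin

definition state where
  "state W q u \<longleftrightarrow> u \<in> W \<and> (\<forall>v\<in>W. a u v = F v - iQ q (\<gamma> v))"

definition adj where
  "adj W u p \<longleftrightarrow> p \<in> W \<and> (\<forall>v\<in>W. a p v = iH (\<lambda>x. u x - z x) v)"

definition subsp where
  "subsp W \<longleftrightarrow> W \<subseteq> V \<and> (\<forall>v\<in>W. \<forall>w\<in>W. \<forall>c. (\<lambda>x. v x + c * w x) \<in> W)"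

lemma subsp_V: "subsp V"
  by (simp add: subsp_def V.closed)

lemma subsp_comb: "subsp W \<Longrightarrow> v \<in> W \<Longrightarrow> w \<in> W \<Longrightarrow> (\<lambda>x. v x + c * w x) \<in> W"
  by (simp add: subsp_def)

lemma subsp_diff: "subsp W \<Longrightarrow> v \<in> W \<Longrightarrow> w \<in> W \<Longrightarrow> (\<lambda>x. v x - w x) \<in> W"
  using subsp_comb[of W v w "-1"] by simp

text \<open>Continuity is assumed only on the diagonal; Cauchy-Schwarz for \<open>a\<close> itself
  extends it to pairs with the same constant.\<close>

lemma a_bound: "v \<in> V \<Longrightarrow> w \<in> V \<Longrightarrow> \<bar>a v w\<bar> \<le> C\<^sub>a * V.nrm v * V.nrm w"
proof -
  assume v: "v \<in> V" and w: "w \<in> V"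
  have s: "A.nrm y \<le> sqrt C\<^sub>a * V.nrm y" if "y \<in> V" for y
    unfolding A.nrm_def V.nrm_def using C\<^sub>a(2)[OF that]
    by (metis real_sqrt_le_mono real_sqrt_mult)
  have "\<bar>a v w\<bar> \<le> A.nrm v * A.nrm w" by (rule A.cauchy_schwarz[OF v w])
  also have "\<dots> \<le> (sqrt C\<^sub>a * V.nrm v) * (sqrt C\<^sub>a * V.nrm w)"
    by (intro mult_mono s v w mult_nonneg_nonneg V.nrm_ge_0 A.nrm_ge_0) (simp_all add: C\<^sub>a)
  also have "\<dots> = (sqrt C\<^sub>a * sqrt C\<^sub>a) * V.nrm v * V.nrm w" by (simp only: mult_ac)
  also have "\<dots> = C\<^sub>a * V.nrm v * V.nrm w" using C\<^sub>a(1) by simp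
  finally show ?thesis .
qed

lemma H_nrm_le: "v \<in> V \<Longrightarrow> H.nrm v \<le> V.nrm v"
  by (simp add: H.nrm_def V.nrm_def H_le_V)

lemma \<gamma>_diff:
  "v \<in> V \<Longrightarrow> w \<in> V \<Longrightarrow> q \<in> QQ \<Longrightarrow> iQ q (\<gamma> (\<lambda>x. v x - w x)) = iQ q (\<gamma> v) - iQ q (\<gamma> w)"
  using \<gamma>_linear[of v w q "-1"] by simp

section \<open>A priori bounds and Galerkin errors at a fixed control\<close>

text \<open>Common last step of the energy estimates: once an equation has been tested with the
  error itself, coercivity lets one factor of the norm cancel.\<close>

lemma coercive_bound:
  assumes "v \<in> V" "B \<ge> 0" "a v v \<le> B * V.nrm v"
  shows "V.nrm v \<le> B / \<kappa>"
proof (cases "V.nrm v = 0")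
  case False
  then have p: "V.nrm v > 0" using V.nrm_ge_0[OF assms(1)] by linarith
  have "\<kappa> * (V.nrm v * V.nrm v) \<le> B * V.nrm v"
    using \<kappa>(2)[OF assms(1)] assms(3) V.nrm_sq[OF assms(1)] by (simp add: power2_eq_square)
  then have "\<kappa> * V.nrm v \<le> B" using p by (simp add: mult.assoc[symmetric])
  then show ?thesis using \<kappa>(1) by (simp add: field_simps)
qed (use assms \<kappa> in simp)

text \<open>Cea's lemma: \<open>uh\<close> and \<open>u\<close> satisfy the same equation against W,
  so in the energy of \<open>uh - w\<close> the discrete state may be replaced by \<open>u\<close>.
  The quotient \<open>C\<^sub>a / \<kappa>\<close> bounds \<open>uh - w\<close>; the summand 1 pays
  for the return from \<open>w\<close> to \<open>u\<close>.\<close>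

lemma cea_state:
  assumes W: "subsp W" and u: "state V q u" and uh: "state W q uh" and w: "w \<in> W"
  shows "V.nrm (\<lambda>x. uh x - u x) \<le> (C\<^sub>a / \<kappa> + 1) * V.nrm (\<lambda>x. u x - w x)"
proof -
  have V: "u \<in> V" "uh \<in> V" "w \<in> V" "uh \<in> W" and WV: "W \<subseteq> V"
    using assms by (auto simp: subsp_def state_def)
  let ?d = "\<lambda>x. uh x - w x"
  have d: "?d \<in> W" "?d \<in> V" using subsp_diff[OF W V(4) w] WV by auto
  have "a uh ?d = a u ?d" using u uh d by (simp add: state_def)
  then have "a ?d ?d = a (\<lambda>x. u x - w x) ?d"
    using V d by (simp add: A.diff_left)
  also have "\<dots> \<le> C\<^sub>a * V.nrm (\<lambda>x. u x - w x) * V.nrm ?d"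
    using a_bound[OF V.diff_closed[OF V(1,3)] d(2)] by linarith
  finally have "V.nrm ?d \<le> C\<^sub>a * V.nrm (\<lambda>x. u x - w x) / \<kappa>"
    using V C\<^sub>a by (intro coercive_bound d) (simp_all add: V.nrm_ge_0 V.diff_closed)
  moreover have "V.nrm (\<lambda>x. uh x - u x) \<le> V.nrm ?d + V.nrm (\<lambda>x. u x - w x)"
    using V.nrm_triangle[OF V(2,3,1)] V.nrm_diff_swap[OF V(1,3)] by simp
  ultimately show ?thesis by (simp add: algebra_simps)
qed

text \<open>The two adjoint equations are driven by different states, so Galerkin orthogonality
  fails by the H-pairing of \<open>uh - u\<close> with the test function. That defect is the source
  of the last term.\<close>

lemma cea_adjoint:
  assumes W: "subsp W" and u: "u \<in> V" "uh \<in> V" and p: "adj V u p" and ph: "adj W uh ph"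
    and w: "w \<in> W"
  shows "V.nrm (\<lambda>x. ph x - p x)
    \<le> (C\<^sub>a / \<kappa> + 1) * V.nrm (\<lambda>x. p x - w x) + V.nrm (\<lambda>x. uh x - u x) / \<kappa>"
proof -
  have V: "p \<in> V" "ph \<in> V" "w \<in> V" "ph \<in> W" and WV: "W \<subseteq> V"
    using assms by (auto simp: subsp_def adj_def)
  have H: "u \<in> HH" "uh \<in> HH" using u V_H by auto
  let ?d = "\<lambda>x. ph x - w x" and ?u = "\<lambda>x. uh x - u x"
  have d: "?d \<in> W" "?d \<in> V" "?d \<in> HH" using subsp_diff[OF W V(4) w] WV V_H by auto
  have uu: "?u \<in> V" "?u \<in> HH" using u V.diff_closed V_H by auto
  have "a ph ?d - a p ?d = iH (\<lambda>x. uh x - z x) ?d - iH (\<lambda>x. u x - z x) ?d"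
    using p ph d by (simp add: adj_def)
  also have "\<dots> = iH ?u ?d"
    using H z d by (simp add: H.diff_left)
  finally have e: "a ?d ?d = a (\<lambda>x. p x - w x) ?d + iH ?u ?d"
    using V d by (simp add: A.diff_left)
  have "iH ?u ?d \<le> H.nrm ?u * H.nrm ?d"
    using H.cauchy_schwarz[OF uu(2) d(3)] by linarith
  also have "\<dots> \<le> V.nrm ?u * V.nrm ?d"
    by (intro mult_mono H_nrm_le uu d V.nrm_ge_0 H.nrm_ge_0)
  finally have "a ?d ?d \<le> C\<^sub>a * V.nrm (\<lambda>x. p x - w x) * V.nrm ?d + V.nrm ?u * V.nrm ?d"
    unfolding e using a_bound[OF V.diff_closed[OF V(1,3)] d(2)] by linarith
  then have "a ?d ?d \<le> (C\<^sub>a * V.nrm (\<lambda>x. p x - w x) + V.nrm ?u) * V.nrm ?d"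
    by (simp add: algebra_simps)
  then have "V.nrm ?d \<le> (C\<^sub>a * V.nrm (\<lambda>x. p x - w x) + V.nrm ?u) / \<kappa>"
    using V C\<^sub>a uu by (intro coercive_bound d) (simp_all add: V.nrm_ge_0 V.diff_closed)
  moreover have "V.nrm (\<lambda>x. ph x - p x) \<le> V.nrm ?d + V.nrm (\<lambda>x. p x - w x)"
    using V.nrm_triangle[OF V(2,3,1)] V.nrm_diff_swap[OF V(1,3)] by simp
  ultimately show ?thesis by (simp add: add_divide_distrib algebra_simps)
qed

text \<open>Replaces linearity of the control-to-state map: subtraction removes the load, and the
  tested identity holds whichever solutions were chosen.\<close>

lemma state_diff:
  assumes W: "subsp W" and u: "state W q u" "state W q' u'" and q: "q \<in> QQ" "q' \<in> QQ"
    and v: "v \<in> W"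
  shows "a (\<lambda>x. u x - u' x) v = - iQ (\<lambda>x. q x - q' x) (\<gamma> v)"
proof -
  have "u \<in> V" "u' \<in> V" "v \<in> V" using assms by (auto simp: subsp_def state_def)
  then show ?thesis using u v q by (simp add: A.diff_left state_def Q.diff_left \<gamma>_in)
qed

lemma state_stable:
  assumes W: "subsp W" and u: "state W q u" "state W q' u'" and q: "q \<in> QQ" "q' \<in> QQ"
  shows "V.nrm (\<lambda>x. u x - u' x) \<le> C\<^sub>\<gamma> / \<kappa> * Q.nrm (\<lambda>x. q x - q' x)"
proof -
  let ?d = "\<lambda>x. u x - u' x" and ?q = "\<lambda>x. q x - q' x"
  have d: "?d \<in> W" "?d \<in> V" using subsp_diff[OF W] u W by (auto simp: state_def subsp_def)
  have qq: "?q \<in> QQ" by (rule Q.diff_closed[OF q])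
  have "a ?d ?d \<le> Q.nrm ?q * Q.nrm (\<gamma> ?d)"
    using state_diff[OF W u q d(1)] Q.cauchy_schwarz[OF qq \<gamma>_in[OF d(2)]] by linarith
  also have "\<dots> \<le> Q.nrm ?q * (C\<^sub>\<gamma> * V.nrm ?d)"
    by (intro mult_left_mono C\<^sub>\<gamma> d Q.nrm_ge_0 qq)
  finally have "V.nrm ?d \<le> C\<^sub>\<gamma> * Q.nrm ?q / \<kappa>"
    using C\<^sub>\<gamma> qq by (intro coercive_bound d) (simp_all add: Q.nrm_ge_0 mult_ac)
  then show ?thesis by simp
qed

lemma adjoint_stable:
  assumes W: "subsp W" and u: "u \<in> W" "u' \<in> W" and p: "adj W u p" "adj W u' p'"
  shows "V.nrm (\<lambda>x. p x - p' x) \<le> V.nrm (\<lambda>x. u x - u' x) / \<kappa>"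
proof -
  let ?d = "\<lambda>x. p x - p' x" and ?u = "\<lambda>x. u x - u' x"
  have V: "p \<in> V" "p' \<in> V" "u \<in> V" "u' \<in> V" and WV: "W \<subseteq> V" and pW: "p \<in> W" "p' \<in> W"
    using assms by (auto simp: subsp_def adj_def)
  have H: "u \<in> HH" "u' \<in> HH" "?d \<in> HH" "?u \<in> HH" and d: "?d \<in> V" "?u \<in> V"
    using V V_H V.diff_closed[OF V(1,2)] V.diff_closed[OF V(3,4)] by auto
  have dW: "?d \<in> W" by (rule subsp_diff[OF W pW])
  have "a ?d ?d = iH ?u ?d"
    using p dW V d H z by (simp add: A.diff_left adj_def H.diff_left)
  also have "\<dots> \<le> H.nrm ?u * H.nrm ?d"
    using H.cauchy_schwarz[OF H(4,3)] by linarith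
  also have "\<dots> \<le> V.nrm ?u * V.nrm ?d"
    by (intro mult_mono H_nrm_le d V.nrm_ge_0 H.nrm_ge_0 H)
  finally show ?thesis using d by (intro coercive_bound) (simp_all add: V.nrm_ge_0)
qed

section \<open>The first-order optimality condition, for continuous and discrete problems
  alike\<close>

text \<open>Along \<open>q + t * \<eta>\<close> the cost is a quadratic polynomial in t with its
  minimum at 0, so the linear coefficient vanishes. The adjoint equation tested with the state
  increment, and the state equation tested with \<open>p\<close>, turn that coefficient into a
  boundary pairing.\<close>

lemma optimality_condition:
  assumes W: "subsp W"
    and S: "\<And>q. q \<in> QQ \<Longrightarrow> state W q (S q)"
    and p: "adj W (S q) p"
    and q: "q \<in> QQ"
    and min: "\<And>q'. q' \<in> QQ \<Longrightarrow>
      iH (\<lambda>x. S q x - z x) (\<lambda>x. S q x - z x) / 2 + M / 2 * iQ q q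
      \<le> iH (\<lambda>x. S q' x - z x) (\<lambda>x. S q' x - z x) / 2 + M / 2 * iQ q' q'"
    and \<eta>: "\<eta> \<in> QQ"
  shows "M * iQ q \<eta> = iQ \<eta> (\<gamma> p)"
proof -
  let ?s = "\<lambda>t x. q x + t * \<eta> x"
  let ?w = "\<lambda>x. S (?s 1) x - S q x" and ?r = "\<lambda>x. S q x - z x"
  have WV: "W \<subseteq> V" using W by (simp add: subsp_def)
  have s: "?s t \<in> QQ" for t by (rule Q.closed[OF q \<eta>])
  have SW: "S q' \<in> W" if "q' \<in> QQ" for q' using S[OF that] by (simp add: state_def)
  then have SH: "S q' \<in> V" "S q' \<in> HH" if "q' \<in> QQ" for q' using that WV V_H by auto
  have w: "?w \<in> W" using subsp_diff[OF W SW[OF s[of 1]] SW[OF q]] .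
  have wV: "?w \<in> V" "?w \<in> HH" using w WV V_H by auto
  have r: "?r \<in> HH" by (rule H.diff_closed[OF SH(2)[OF q] z])
  have pW: "p \<in> W" "p \<in> V" using p WV by (auto simp: adj_def)
  have st: "a (\<lambda>x. S (?s t) x - S q x) v = - t * iQ \<eta> (\<gamma> v)" if "v \<in> W" for t v
  proof -
    have "(\<lambda>x. ?s t x - q x) = (\<lambda>x. t * \<eta> x)" by simp
    moreover have "iQ (\<lambda>x. ?s t x - q x) (\<gamma> v) = t * iQ \<eta> (\<gamma> v)"
      using that WV q \<eta> s by (subst Q.diff_left) (auto simp: Q.linear \<gamma>_in)
    ultimately show ?thesis
      using state_diff[OF W S[OF s] S[OF q] s q that] by simp
  qed
  text \<open>The control-to-state map is affine only up to null functions, hence the detour through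
    the form \<open>iH\<close> of the defect \<open>e\<close>.\<close>
  have cost: "iH (\<lambda>x. S (?s t) x - z x) (\<lambda>x. S (?s t) x - z x)
      = iH ?r ?r + 2 * t * iH ?r ?w + t\<^sup>2 * iH ?w ?w" for t
  proof -
    let ?d = "\<lambda>x. S (?s t) x - S q x"
    let ?e = "\<lambda>x. ?d x - t * ?w x" and ?m = "\<lambda>x. ?r x + t * ?w x"
    have dW: "?d \<in> W" by (rule subsp_diff[OF W SW[OF s] SW[OF q]])
    have "?e = (\<lambda>x. ?d x + (- t) * ?w x)" by (simp add: fun_eq_iff)
    moreover have "(\<lambda>x. ?d x + (- t) * ?w x) \<in> W" by (rule subsp_comb[OF W dW w])
    ultimately have eW: "?e \<in> W" by (simp only:)
    have eV: "?e \<in> V" "?d \<in> V" and eH: "?e \<in> HH" using eW dW WV V_H by auto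
    \<comment> \<open>Both \<open>?d\<close> and \<open>t * ?w\<close> represent the same functional
      on W through \<open>a\<close>, so their difference has zero energy. Coercivity makes it null
      for \<open>iV\<close>, hence for \<open>iH\<close>.\<close>
    have "a ?e ?e = a ?d ?e + (- t) * a ?w ?e"
      using A.linear[OF eV(2) wV(1) eV(1), of "- t"] by simp
    also have "\<dots> = 0" using st[OF eW, of t] st[OF eW, of 1] by simp
    finally have "\<kappa> * iV ?e ?e \<le> 0" using \<kappa>(2)[OF eV(1)] by simp
    then have "iV ?e ?e \<le> 0" using \<kappa>(1) by (simp add: mult_le_0_iff)
    then have e0: "iH ?e ?e = 0" using H_le_V[OF eV(1)] H.nonneg[OF eH] by linarith
    have m: "?m \<in> HH" by (rule H.closed[OF r wV(2)])
    have "(\<lambda>x. S (?s t) x - z x) = (\<lambda>x. ?m x + 1 * ?e x)" by (simp add: algebra_simps)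
    then have "iH (\<lambda>x. S (?s t) x - z x) (\<lambda>x. S (?s t) x - z x)
        = iH ?m ?m + 2 * 1 * iH ?m ?e + 1\<^sup>2 * iH ?e ?e"
      using H.square_expand[OF m eH, of 1] by simp
    also have "\<dots> = iH ?m ?m"
      using H.nrm_0_orthogonal[OF eH m e0] e0 H.sym[OF eH m] by simp
    also have "\<dots> = iH ?r ?r + 2 * t * iH ?r ?w + t\<^sup>2 * iH ?w ?w"
      by (rule H.square_expand[OF r wV(2)])
    finally show ?thesis .
  qed
  \<comment> \<open>The cost at parameter t exceeds the cost at 0 by
    \<open>t * D + t\<^sup>2 * E\<close>; thus D is the derivative at the minimum.\<close>
  define D where "D = iH ?r ?w + M * iQ q \<eta>"
  define E where "E = (iH ?w ?w + M * iQ \<eta> \<eta>) / 2"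
  have E: "E \<ge> 0" unfolding E_def using H.nonneg[OF wV(2)] Q.nonneg[OF \<eta>] M by simp
  have ge: "0 \<le> t * D + t\<^sup>2 * E" for t
    using min[OF s[of t]] unfolding cost Q.square_expand[OF q \<eta>] D_def E_def
    by (simp add: field_simps)
  have "D = 0"
  proof (rule ccontr)
    assume "D \<noteq> 0"
    \<comment> \<open>The test value is \<open>t = - D / (E + 1)\<close>: dividing by
      \<open>E + 1\<close> instead of \<open>2 * E\<close> avoids a case split on E = 0 and still
      gives a negative value.\<close>
    define x where "x = E + 1"
    have x: "x > 0" "E = x - 1" using E by (simp_all add: x_def)
    have "0 \<le> (- D / x) * D + (- D / x)\<^sup>2 * E" by (rule ge)
    also have "\<dots> = - (D\<^sup>2 / x\<^sup>2)"
      using x(1) by (simp add: x(2) field_simps power2_eq_square)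
    also have "\<dots> < 0" using \<open>D \<noteq> 0\<close> x by simp
    finally show False by simp
  qed
  moreover have "iH ?r ?w = a p ?w" using p w by (simp add: adj_def)
  moreover have "a p ?w = - iQ \<eta> (\<gamma> p)"
    using st[OF pW(1), of 1] A.sym[OF pW(2) wV(1)] by simp
  ultimately show ?thesis unfolding D_def by simp
qed

lemma control_error:
  assumes W: "subsp W"
    and S: "\<And>q. q \<in> QQ \<Longrightarrow> state V q (S q)" and P: "\<And>q. q \<in> QQ \<Longrightarrow> adj V (S q) (P q)"
    and Sh: "\<And>q. q \<in> QQ \<Longrightarrow> state W q (Sh q)" and Ph: "\<And>q. q \<in> QQ \<Longrightarrow> adj W (Sh q) (Ph q)"
    and q: "q \<in> QQ" and qh: "qh \<in> QQ"
    and opt: "\<And>\<eta>. \<eta> \<in> QQ \<Longrightarrow> M * iQ q \<eta> = iQ \<eta> (\<gamma> (P q))"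
    and opth: "\<And>\<eta>. \<eta> \<in> QQ \<Longrightarrow> M * iQ qh \<eta> = iQ \<eta> (\<gamma> (Ph qh))"
  shows "Q.nrm (\<lambda>x. qh x - q x) \<le> C\<^sub>\<gamma> / M * V.nrm (\<lambda>x. Ph q x - P q x)"
proof -
  let ?e = "\<lambda>x. qh x - q x"
  let ?p = "\<lambda>x. Ph q x - P q x" and ?r = "\<lambda>x. Ph qh x - Ph q x"
  let ?u = "\<lambda>x. Sh qh x - Sh q x"
  have e: "?e \<in> QQ" by (rule Q.diff_closed[OF qh q])
  have WV: "W \<subseteq> V" using W by (simp add: subsp_def)
  have in_W: "Sh qh \<in> W" "Sh q \<in> W" "Ph qh \<in> W" "Ph q \<in> W" and PV: "P q \<in> V"
    using Sh[OF q] Sh[OF qh] Ph[OF q] Ph[OF qh] P[OF q] by (auto simp: state_def adj_def)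
  have in_V: "Sh qh \<in> V" "Sh q \<in> V" "Ph qh \<in> V" "Ph q \<in> V" using in_W WV by auto
  have rW: "?r \<in> W" and uW: "?u \<in> W" using in_W by (auto intro!: subsp_diff[OF W])
  have pV: "?p \<in> V" by (rule V.diff_closed[OF in_V(4) PV])
  have uH: "?u \<in> HH" "?u \<in> V" and rV: "?r \<in> V" and hH: "Sh qh \<in> HH" "Sh q \<in> HH"
    using uW rW WV V_H in_V by auto
  have "M * (Q.nrm ?e)\<^sup>2 = M * iQ qh ?e - M * iQ q ?e"
    using e qh q by (simp add: Q.nrm_sq Q.diff_left right_diff_distrib)
  also have "\<dots> = iQ ?e (\<gamma> (Ph qh)) - iQ ?e (\<gamma> (P q))"
    by (simp add: opt opth e)
  also have "\<dots> = iQ ?e (\<gamma> ?r) + iQ ?e (\<gamma> ?p)"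
    using in_V PV e by (simp add: \<gamma>_diff)
  \<comment> \<open>Both \<open>?u\<close> and \<open>?r\<close> lie in W because the intermediate
    quantities \<open>Sh q\<close> and \<open>Ph q\<close> are discrete. So the discrete state
    equation may be tested with \<open>?r\<close> and the discrete adjoint equation with
    \<open>?u\<close>; the shared number \<open>a ?u ?r\<close> produces the favourable
    sign.\<close>
  also have "iQ ?e (\<gamma> ?r) = - a ?u ?r"
    using state_diff[OF W Sh[OF qh] Sh[OF q] qh q rW] by simp
  also have "a ?u ?r = a ?r ?u" by (rule A.sym[OF uH(2) rV])
  also have "a ?r ?u = iH ?u ?u"
    using Ph[OF q] Ph[OF qh] uW in_V uH hH z by (simp add: A.diff_left adj_def H.diff_left)
  finally have "M * (Q.nrm ?e)\<^sup>2 \<le> iQ ?e (\<gamma> ?p)"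
    using H.nonneg[OF uH(1)] by linarith
  also have "\<dots> \<le> Q.nrm ?e * Q.nrm (\<gamma> ?p)"
    using Q.cauchy_schwarz[OF e \<gamma>_in[OF pV]] by linarith
  also have "\<dots> \<le> Q.nrm ?e * (C\<^sub>\<gamma> * V.nrm ?p)"
    by (intro mult_left_mono C\<^sub>\<gamma> pV Q.nrm_ge_0 e)
  finally have le: "M * (Q.nrm ?e)\<^sup>2 \<le> Q.nrm ?e * (C\<^sub>\<gamma> * V.nrm ?p)" .
  show ?thesis
  proof (cases "Q.nrm ?e = 0")
    case True
    then show ?thesis using M C\<^sub>\<gamma>(1) V.nrm_ge_0[OF pV] by simp
  next
    case False
    then have "Q.nrm ?e > 0" using Q.nrm_ge_0[OF e] by linarith
    then have "M * Q.nrm ?e \<le> C\<^sub>\<gamma> * V.nrm ?p"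
      using le by (simp add: power2_eq_square mult.left_commute[of M])
    then show ?thesis using M by (simp add: field_simps)
  qed
qed

text \<open>The constant is obtained before the trial space and the discrete solutions are
  quantified, so a single K serves all meshes. The approximants \<open>w\<close> and
  \<open>w'\<close> are independent, since state and adjoint state are approximated
  separately.\<close>

lemma quasi_optimal:
  assumes S: "\<And>q. q \<in> QQ \<Longrightarrow> state V q (S q)" and P: "\<And>q. q \<in> QQ \<Longrightarrow> adj V (S q) (P q)"
    and q: "q \<in> QQ"
    and opt: "\<And>\<eta>. \<eta> \<in> QQ \<Longrightarrow> M * iQ q \<eta> = iQ \<eta> (\<gamma> (P q))"
  obtains K where "K \<ge> 0"
    "\<And>W Sh Ph qh w w'. subsp W \<Longrightarrow> (\<And>q. q \<in> QQ \<Longrightarrow> state W q (Sh q)) \<Longrightarrow>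
      (\<And>q. q \<in> QQ \<Longrightarrow> adj W (Sh q) (Ph q)) \<Longrightarrow> qh \<in> QQ \<Longrightarrow>
      (\<And>\<eta>. \<eta> \<in> QQ \<Longrightarrow> M * iQ qh \<eta> = iQ \<eta> (\<gamma> (Ph qh))) \<Longrightarrow> w \<in> W \<Longrightarrow> w' \<in> W \<Longrightarrow>
      Q.nrm (\<lambda>x. qh x - q x) \<le> K * (V.nrm (\<lambda>x. S q x - w x) + V.nrm (\<lambda>x. P q x - w' x)) \<and>
      V.nrm (\<lambda>x. Sh qh x - S q x) \<le> K * (V.nrm (\<lambda>x. S q x - w x) + V.nrm (\<lambda>x. P q x - w' x)) \<and>
      V.nrm (\<lambda>x. Ph qh x - P q x) \<le> K * (V.nrm (\<lambda>x. S q x - w x) + V.nrm (\<lambda>x. P q x - w' x))"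
proof -
  \<comment> \<open>C is the factor in Cea's bound, D bounds the adjoint error at the fixed control,
    E the control error, and G the response of the discrete state to that control error. State and
    adjoint errors then have constants \<open>G + C\<close> and \<open>G / \<kappa> + D\<close>; K
    dominates all three.\<close>
  define C where "C = C\<^sub>a / \<kappa> + 1"
  define D where "D = C + C / \<kappa>"
  define E where "E = C\<^sub>\<gamma> / M * D"
  define G where "G = C\<^sub>\<gamma> / \<kappa> * E"
  define K where "K = E + (G + C) + (G / \<kappa> + D)"
  have C0: "C \<ge> 0" using C\<^sub>a \<kappa> by (simp add: C_def)
  have D0: "D \<ge> 0" "C \<le> D" using C0 \<kappa> by (simp_all add: D_def)
  have E0: "E \<ge> 0" using D0 C\<^sub>\<gamma> M by (simp add: E_def)
  have G0: "G \<ge> 0" "G / \<kappa> \<ge> 0" using E0 C\<^sub>\<gamma> \<kappa> by (simp_all add: G_def)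
  show thesis
  proof (rule that[of K])
    show "K \<ge> 0" using C0 D0 E0 G0 by (simp add: K_def)
    fix W Sh Ph qh w w'
    assume W: "subsp W" and Sh: "\<And>q. q \<in> QQ \<Longrightarrow> state W q (Sh q)"
      and Ph: "\<And>q. q \<in> QQ \<Longrightarrow> adj W (Sh q) (Ph q)" and qh: "qh \<in> QQ"
      and opth: "\<And>\<eta>. \<eta> \<in> QQ \<Longrightarrow> M * iQ qh \<eta> = iQ \<eta> (\<gamma> (Ph qh))"
      and w: "w \<in> W" "w' \<in> W"
    define X where "X = V.nrm (\<lambda>x. S q x - w x)"
    define Y where "Y = V.nrm (\<lambda>x. P q x - w' x)"
    have WV: "W \<subseteq> V" using W by (simp add: subsp_def)
    have hW: "Sh qh \<in> W" "Sh q \<in> W" "Ph qh \<in> W" "Ph q \<in> W"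
      using Sh[OF q] Sh[OF qh] Ph[OF q] Ph[OF qh] by (auto simp: state_def adj_def)
    have V: "Sh qh \<in> V" "Sh q \<in> V" "Ph qh \<in> V" "Ph q \<in> V" "S q \<in> V" "P q \<in> V" "w \<in> V" "w' \<in> V"
      using S[OF q] P[OF q] hW w WV by (auto simp: state_def adj_def)
    have X0: "X \<ge> 0" and Y0: "Y \<ge> 0"
      unfolding X_def Y_def using V by (auto intro!: V.nrm_ge_0 V.diff_closed)
    have 1: "V.nrm (\<lambda>x. Sh q x - S q x) \<le> C * X"
      unfolding C_def X_def by (rule cea_state[OF W S[OF q] Sh[OF q] w(1)])
    have "V.nrm (\<lambda>x. Ph q x - P q x) \<le> C * Y + V.nrm (\<lambda>x. Sh q x - S q x) / \<kappa>"
      unfolding C_def Y_def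
      by (rule cea_adjoint[OF W V(5) V(2) P[OF q] Ph[OF q] w(2)])
    also have "\<dots> \<le> C * Y + C * X / \<kappa>"
      using 1 \<kappa> by (simp add: divide_right_mono)
    also have "\<dots> \<le> D * (X + Y)"
      using C0 \<kappa>(1) X0 Y0 by (simp add: D_def algebra_simps add_divide_distrib)
    finally have 2: "V.nrm (\<lambda>x. Ph q x - P q x) \<le> D * (X + Y)" .
    have "Q.nrm (\<lambda>x. qh x - q x) \<le> C\<^sub>\<gamma> / M * V.nrm (\<lambda>x. Ph q x - P q x)"
      by (rule control_error[OF W S P Sh Ph q qh opt opth])
    also have "\<dots> \<le> C\<^sub>\<gamma> / M * (D * (X + Y))"
      using C\<^sub>\<gamma>(1) M by (intro mult_left_mono 2) simp
    finally have 3: "Q.nrm (\<lambda>x. qh x - q x) \<le> E * (X + Y)" by (simp add: E_def)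
    have "V.nrm (\<lambda>x. Sh qh x - Sh q x) \<le> C\<^sub>\<gamma> / \<kappa> * Q.nrm (\<lambda>x. qh x - q x)"
      by (rule state_stable[OF W Sh[OF qh] Sh[OF q] qh q])
    also have "\<dots> \<le> C\<^sub>\<gamma> / \<kappa> * (E * (X + Y))"
      using C\<^sub>\<gamma>(1) \<kappa>(1) by (intro mult_left_mono 3) simp
    finally have 4: "V.nrm (\<lambda>x. Sh qh x - Sh q x) \<le> G * (X + Y)" by (simp add: G_def)
    have "V.nrm (\<lambda>x. Sh qh x - S q x) \<le> G * (X + Y) + C * X"
      using V.nrm_triangle[OF V(1,2,5)] 4 1 by linarith
    also have "\<dots> \<le> (G + C) * (X + Y)" using C0 Y0 by (simp add: algebra_simps)
    finally have 5: "V.nrm (\<lambda>x. Sh qh x - S q x) \<le> (G + C) * (X + Y)" .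
    have "V.nrm (\<lambda>x. Ph qh x - Ph q x) \<le> V.nrm (\<lambda>x. Sh qh x - Sh q x) / \<kappa>"
      by (rule adjoint_stable[OF W hW(1,2) Ph[OF qh] Ph[OF q]])
    also have "\<dots> \<le> G * (X + Y) / \<kappa>" using 4 \<kappa> by (simp add: divide_right_mono)
    finally have "V.nrm (\<lambda>x. Ph qh x - P q x) \<le> G * (X + Y) / \<kappa> + D * (X + Y)"
      using V.nrm_triangle[OF V(3,4,6)] 2 by linarith
    also have "\<dots> = (G / \<kappa> + D) * (X + Y)" by (simp add: algebra_simps)
    finally have 6: "V.nrm (\<lambda>x. Ph qh x - P q x) \<le> (G / \<kappa> + D) * (X + Y)" .
    have mono: "B * (X + Y) \<le> K * (X + Y)" if "B \<le> K" for B
      using that X0 Y0 by (intro mult_right_mono) simp_all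
    have "E \<le> K" "G + C \<le> K" "G / \<kappa> + D \<le> K" using C0 D0 E0 G0 by (simp_all add: K_def)
    then show "Q.nrm (\<lambda>x. qh x - q x) \<le> K * (V.nrm (\<lambda>x. S q x - w x) + V.nrm (\<lambda>x. P q x - w' x)) \<and>
      V.nrm (\<lambda>x. Sh qh x - S q x) \<le> K * (V.nrm (\<lambda>x. S q x - w x) + V.nrm (\<lambda>x. P q x - w' x)) \<and>
      V.nrm (\<lambda>x. Ph qh x - P q x) \<le> K * (V.nrm (\<lambda>x. S q x - w x) + V.nrm (\<lambda>x. P q x - w' x))"
      unfolding X_def[symmetric] Y_def[symmetric]
      using order_trans[OF 3 mono] order_trans[OF 5 mono] order_trans[OF 6 mono] by blast
  qed
qed

end

section \<open>Smooth bump functions\<close>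

lemma frechet_derivativeI: "(f has_derivative f') (at x) \<Longrightarrow> frechet_derivative f (at x) = f'"
  using frechet_derivative_at by metis

lemma C_k_Suc_imp: "C_k (Suc k) f \<Longrightarrow> C_k k f"
proof (induction k arbitrary: f)
  case 0
  then show ?case
    by (auto simp: continuous_on_eq_continuous_at intro!: differentiable_imp_continuous_within)
next
  case (Suc k)
  then show ?case by (metis C_k.simps(2))
qed

lemma C_k_const: "C_k k (\<lambda>x. c)"
proof (induction k arbitrary: c)
  case (Suc k)
  have "frechet_derivative (\<lambda>x::'a. c) (at x) = (\<lambda>_. 0)" for x
    by (rule frechet_derivativeI) simp
  then show ?case using Suc by simp
qed simp

lemma C_k_add: "C_k k f \<Longrightarrow> C_k k g \<Longrightarrow> C_k k (\<lambda>x. f x + g x)"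
proof (induction k arbitrary: f g)
  case 0
  then show ?case by (auto intro: continuous_intros)
next
  case (Suc k)
  have d: "(f has_derivative frechet_derivative f (at x)) (at x)"
    "(g has_derivative frechet_derivative g (at x)) (at x)" for x
    using Suc.prems by (auto simp: frechet_derivative_works)
  have "frechet_derivative (\<lambda>x. f x + g x) (at x)
      = (\<lambda>h. frechet_derivative f (at x) h + frechet_derivative g (at x) h)" for x
    by (intro frechet_derivativeI has_derivative_add d)
  then show ?case using Suc by (auto intro: differentiable_add)
qed

lemma C_k_mult: "C_k k f \<Longrightarrow> C_k k g \<Longrightarrow> C_k k (\<lambda>x. f x * g x)"
proof (induction k arbitrary: f g)
  case 0
  then show ?case by (auto intro: continuous_intros)
next
  case (Suc k)
  have d: "(f has_derivative frechet_derivative f (at x)) (at x)"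
    "(g has_derivative frechet_derivative g (at x)) (at x)" for x
    using Suc.prems by (auto simp: frechet_derivative_works)
  have "frechet_derivative (\<lambda>x. f x * g x) (at x)
      = (\<lambda>h. f x * frechet_derivative g (at x) h + frechet_derivative f (at x) h * g x)" for x
    by (intro frechet_derivativeI has_derivative_mult d)
  moreover have "C_k k f" "C_k k g" using Suc.prems C_k_Suc_imp by blast+
  ultimately show ?case using Suc by (auto intro!: C_k_add differentiable_mult)
qed

text \<open>The outer function comes with all its derivatives as a sequence, and n stays arbitrary
  in the induction: differentiating \<open>D n\<close> after g produces \<open>D (Suc n)\<close>
  after g.\<close>

lemma C_k_compose:
  fixes D :: "nat \<Rightarrow> real \<Rightarrow> real"
  assumes D: "\<And>n y. (D n has_real_derivative D (Suc n) y) (at y)"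
  shows "C_k k g \<Longrightarrow> C_k k (\<lambda>x. D n (g x))"
proof (induction k arbitrary: n)
  case 0
  have "continuous_on UNIV (D n)"
    using D by (meson DERIV_continuous_on has_field_derivative_at_within)
  then show ?case using 0 continuous_on_compose2[of UNIV "D n" UNIV g] by simp
next
  case (Suc k)
  have g: "(g has_derivative frechet_derivative g (at x)) (at x)" for x
    using Suc.prems by (auto simp: frechet_derivative_works)
  have d: "((\<lambda>x. D n (g x)) has_derivative (\<lambda>h. frechet_derivative g (at x) h * D (Suc n) (g x))) (at x)" for x
    using D[of n "g x"] has_derivative_compose[OF g, of "D n" "(*) (D (Suc n) (g x))"]
    by (simp add: has_field_derivative_def mult.commute)
  have "frechet_derivative (\<lambda>x. D n (g x)) (at x)
      = (\<lambda>h. frechet_derivative g (at x) h * D (Suc n) (g x))" for x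
    by (rule frechet_derivativeI[OF d])
  moreover have "C_k k g" using Suc.prems C_k_Suc_imp by blast
  ultimately show ?case using Suc d by (auto intro!: C_k_mult simp: differentiable_def)
qed

lemma C_k_inner: "C_k k (\<lambda>x. x \<bullet> i + c)"
proof (cases k)
  case 0
  then show ?thesis by (auto intro!: continuous_intros)
next
  case (Suc m)
  have d: "((\<lambda>x. x \<bullet> i + c) has_derivative (\<lambda>h. h \<bullet> i)) (at x)" for x
    by (auto intro!: derivative_eq_intros)
  then have "frechet_derivative (\<lambda>x. x \<bullet> i + c) (at x) = (\<lambda>h. h \<bullet> i)" for x
    by (rule frechet_derivativeI)
  then show ?thesis using Suc d by (auto simp: C_k_const differentiable_def)
qed

lemma C_k_prod: "finite A \<Longrightarrow> (\<And>j. j \<in> A \<Longrightarrow> C_k k (f j)) \<Longrightarrow> C_k k (\<lambda>x. \<Prod>j\<in>A. f j x)"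
proof (induction A rule: finite_induct)
  case empty
  then show ?case by (simp add: C_k_const)
next
  case (insert a A)
  then show ?case by (simp add: C_k_mult)
qed

section \<open>The flat function exp (-1/x) and bumps on boxes\<close>

text \<open>With y = 1/x, differentiating P(y) exp(-y) with respect to x gives y^2 (P(y) - P'(y))
  exp(-y), which is the recurrence iterated here.\<close>

definition bump_poly :: "nat \<Rightarrow> real poly" where
  "bump_poly n = ((\<lambda>p. monom 1 2 * (p - pderiv p)) ^^ n) 1"

text \<open>\<open>bump_deriv n\<close> is the \<open>n\<close>-th derivative of \<open>exp (-1/x)\<close>, extended by \<open>0\<close> to \<open>x \<le> 0\<close>.\<close>

definition bump_deriv :: "nat \<Rightarrow> real \<Rightarrow> real" where
  "bump_deriv n x = (if x > 0 then poly (bump_poly n) (1 / x) * exp (- (1 / x)) else 0)"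

lemma poly_times_exp_minus_tendsto_0: "((\<lambda>y. poly p y * exp (- y)) \<longlongrightarrow> (0::real)) at_top"
proof -
  have "(\<lambda>y. poly p y * exp (- y)) = (\<lambda>y. \<Sum>i\<le>degree p. coeff p i * (y ^ i / exp y))"
    by (simp add: poly_altdef sum_distrib_right exp_minus divide_inverse mult.assoc)
  moreover have "((\<lambda>y. \<Sum>i\<le>degree p. coeff p i * (y ^ i / exp y)) \<longlongrightarrow> (\<Sum>i\<le>degree p. coeff p i * 0)) at_top"
    by (intro tendsto_sum tendsto_mult tendsto_const tendsto_power_div_exp_0)
  ultimately show ?thesis by simp
qed

text \<open>The delicate point is x = 0: from the right the difference quotient is a polynomial in
  1/h times exp(-1/h), which tends to 0, and from the left it is constantly 0.\<close>

lemma bump_deriv_has_derivative: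
  "(bump_deriv n has_real_derivative bump_deriv (Suc n) x) (at x)"
proof -
  let ?P = "bump_poly n"
  consider "x > 0" | "x < 0" | "x = 0" by linarith
  then show ?thesis
  proof cases
    case 1
    have "((\<lambda>x. poly ?P (1 / x) * exp (- (1 / x))) has_real_derivative
        poly (pderiv ?P) (1 / x) * (- 1 / x\<^sup>2) * exp (- (1 / x)) + exp (- (1 / x)) * (1 / x\<^sup>2) * poly ?P (1 / x)) (at x)"
      using 1 by (auto intro!: derivative_eq_intros simp: power2_eq_square field_simps)
    also have "poly (pderiv ?P) (1 / x) * (- 1 / x\<^sup>2) * exp (- (1 / x)) + exp (- (1 / x)) * (1 / x\<^sup>2) * poly ?P (1 / x)
        = bump_deriv (Suc n) x"
      using 1 by (simp add: bump_deriv_def bump_poly_def poly_monom field_simps power2_eq_square)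
    finally have "((\<lambda>x. poly ?P (1 / x) * exp (- (1 / x))) has_real_derivative bump_deriv (Suc n) x) (at x)" .
    then show ?thesis
      by (rule has_field_derivative_transform_within_open[of _ _ _ "{0<..}"])
         (use 1 in \<open>auto simp: bump_deriv_def\<close>)
  next
    case 2
    have "((\<lambda>x. 0) has_real_derivative bump_deriv (Suc n) x) (at x)"
      using 2 by (simp add: bump_deriv_def)
    then show ?thesis
      by (rule has_field_derivative_transform_within_open[of _ _ _ "{..<0}"])
         (use 2 in \<open>auto simp: bump_deriv_def\<close>)
  next
    case 3
    have "((\<lambda>h. bump_deriv n h / h) \<longlongrightarrow> 0) (at_right 0)"
    proof -
      \<comment> \<open>Dividing by h raises the polynomial in 1/h by one degree, hence the factor
        \<open>monom 1 1\<close>.\<close>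
      have "((\<lambda>h. poly (monom 1 1 * ?P) (inverse h) * exp (- inverse h)) \<longlongrightarrow> 0) (at_right 0)"
        by (rule filterlim_compose[OF poly_times_exp_minus_tendsto_0 filterlim_inverse_at_top_right])
      then show ?thesis
        by (rule Lim_transform_eventually)
           (auto simp: eventually_at_right_less bump_deriv_def poly_monom field_simps
             intro!: eventually_mono[OF eventually_at_right_less[of 0]])
    qed
    moreover have "((\<lambda>h. bump_deriv n h / h) \<longlongrightarrow> 0) (at_left 0)"
      by (rule Lim_transform_eventually[of "\<lambda>_. 0"])
         (auto simp: bump_deriv_def eventually_at_filter)
    ultimately have "((\<lambda>h. bump_deriv n h / h) \<longlongrightarrow> 0) (at 0)"
      by (simp add: filterlim_at_split)
    then show ?thesis unfolding 3 DERIV_def by (simp add: bump_deriv_def)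
  qed
qed

lemma bump_deriv_0: "bump_deriv 0 x = (if x > 0 then exp (- (1 / x)) else 0)"
  by (simp add: bump_deriv_def bump_poly_def)

text \<open>For a smooth G that vanishes off the box and is positive on it, the functions 1 - exp(-n
  G) tend pointwise to the indicator. The uniform bound by 1 is what dominated convergence will ask
  for.\<close>

lemma box_bump:
  fixes a b :: "'a::euclidean_space"
  obtains \<phi> :: "nat \<Rightarrow> 'a \<Rightarrow> real" where
    "\<And>n. smooth (\<phi> n)" "\<And>n x. 0 \<le> \<phi> n x \<and> \<phi> n x \<le> 1" "\<And>n x. x \<notin> box a b \<Longrightarrow> \<phi> n x = 0"
    "\<And>x. (\<lambda>n. \<phi> n x) \<longlonglongrightarrow> indicator (box a b) x"
proof -
  \<comment> \<open>Each coordinate contributes two factors, one vanishing at and below the lower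
    face, the other at and above the upper face.\<close>
  define G :: "'a \<Rightarrow> real" where
    "G x = (\<Prod>i\<in>Basis. bump_deriv 0 (x \<bullet> i + (- (a \<bullet> i))) * bump_deriv 0 (x \<bullet> (- i) + b \<bullet> i))" for x
  define \<phi> where "\<phi> n x = 1 + (-1) * exp ((- real n) * G x)" for n x
  have G: "C_k k G" for k
    unfolding G_def
    by (intro C_k_prod C_k_mult C_k_compose[of bump_deriv] C_k_inner bump_deriv_has_derivative) simp
  have Gpos: "G x > 0" if "x \<in> box a b" for x
    using that unfolding G_def by (intro prod_pos) (auto simp: bump_deriv_0 mem_box)
  have G0: "G x = 0" if out: "x \<notin> box a b" for x
  proof -
    obtain i where "i \<in> Basis" "x \<bullet> i \<le> a \<bullet> i \<or> b \<bullet> i \<le> x \<bullet> i"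
      using out by (auto simp: mem_box not_less)
    then have "\<exists>i\<in>Basis. bump_deriv 0 (x \<bullet> i + (- (a \<bullet> i))) * bump_deriv 0 (x \<bullet> (- i) + b \<bullet> i) = 0"
      by (intro bexI[of _ i]) (auto simp: bump_deriv_0)
    then show ?thesis unfolding G_def by (simp add: prod_zero_iff)
  qed
  show thesis
  proof (rule that[of \<phi>])
    show "smooth (\<phi> n)" for n
      unfolding smooth_def \<phi>_def
      by (intro allI C_k_add C_k_mult C_k_const C_k_compose[of "\<lambda>_. exp"] G DERIV_exp)
    have "G x \<ge> 0" for x using Gpos[of x] G0[of x] by linarith
    then show "0 \<le> \<phi> n x \<and> \<phi> n x \<le> 1" for n x by (simp add: \<phi>_def)
    show "x \<notin> box a b \<Longrightarrow> \<phi> n x = 0" for n x by (simp add: \<phi>_def G0)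
    show "(\<lambda>n. \<phi> n x) \<longlonglongrightarrow> indicator (box a b) x" for x
    proof (cases "x \<in> box a b")
      case True
      have "norm (exp (- G x)) < 1" using Gpos[OF True] by simp
      then have "(\<lambda>n. exp (- G x) ^ n) \<longlonglongrightarrow> 0" by (rule LIMSEQ_power_zero)
      then have "(\<lambda>n. 1 + (-1) * exp (- G x) ^ n) \<longlonglongrightarrow> 1 + (-1) * 0"
        by (intro tendsto_add tendsto_mult tendsto_const)
      then show ?thesis using True
        by (simp add: \<phi>_def exp_of_nat_mult[symmetric])
    qed (simp add: \<phi>_def G0)
  qed
qed

lemma box_bump_test_function:
  assumes "smooth \<phi>" "\<And>x. x \<notin> box a b \<Longrightarrow> \<phi> x = 0" "cbox a b \<subseteq> \<Omega>"
  shows "\<phi> \<in> test_functions \<Omega>"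
proof -
  have "closure {x. \<phi> x \<noteq> 0} \<subseteq> cbox a b"
    using assms(2) box_subset_cbox by (intro closure_minimal) auto
  then show ?thesis
    using assms unfolding test_functions_def
    by (auto simp: compact_eq_bounded_closed intro: bounded_subset[OF bounded_cbox])
qed

section \<open>The fundamental lemma of the calculus of variations\<close>

text \<open>Bumps tending to box indicators turn orthogonality into vanishing integrals over all
  closed boxes inside \<Omega>; differentiating the integral along shrinking cubes then recovers f
  almost everywhere.\<close>

lemma AE_eq_0_if_orthogonal_test_functions:
  fixes \<Omega> :: "'a::euclidean_space set"
  assumes \<Omega>: "open \<Omega>" and f: "integrable (lebesgue_on \<Omega>) f"
    and orth: "\<And>\<phi>. \<phi> \<in> test_functions \<Omega> \<Longrightarrow> (\<integral>x. f x * \<phi> x \<partial>lebesgue_on \<Omega>) = 0"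
  shows "AE x in lebesgue_on \<Omega>. f x = 0"
proof -
  \<comment> \<open>Extension by zero, so that differentiation of integrals over cubes in the whole
    space applies.\<close>
  let ?F = "\<lambda>x. indicator \<Omega> x * f x"
  have sets: "\<Omega> \<in> sets lebesgue" using \<Omega> by simp
  have F: "integrable lebesgue ?F"
    using f sets by (simp add: integrable_restrict_space)
  have box0: "integral (cbox a b) ?F = 0" if ab: "cbox a b \<subseteq> \<Omega>" for a b
  proof -
    obtain \<phi> :: "nat \<Rightarrow> 'a \<Rightarrow> real" where \<phi>: "\<And>n. smooth (\<phi> n)" "\<And>n x. 0 \<le> \<phi> n x \<and> \<phi> n x \<le> 1"
      "\<And>n x. x \<notin> box a b \<Longrightarrow> \<phi> n x = 0"
      "\<And>x. (\<lambda>n. \<phi> n x) \<longlonglongrightarrow> indicator (box a b) x"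
      using box_bump by blast
    have cont: "continuous_on UNIV (\<phi> n)" for n
      using \<phi>(1)[of n] C_k.simps(1) smooth_def by blast
    then have meas: "\<phi> n \<in> borel_measurable (lebesgue_on \<Omega>)" for n
      by (intro continuous_imp_measurable_on_sets_lebesgue sets) (rule continuous_on_subset, auto)
    have "(\<lambda>n. \<integral>x. f x * \<phi> n x \<partial>lebesgue_on \<Omega>)
        \<longlonglongrightarrow> (\<integral>x. f x * indicator (box a b) x \<partial>lebesgue_on \<Omega>)"
    proof (rule integral_dominated_convergence[where w = "\<lambda>x. \<bar>f x\<bar>"])
      have "indicator (box a b) \<in> borel_measurable (lebesgue_on \<Omega>)"
        by (intro measurable_restrict_space1 borel_measurable_indicator) simp
      then show "(\<lambda>x. f x * indicator (box a b) x) \<in> borel_measurable (lebesgue_on \<Omega>)"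
        using f by (intro borel_measurable_times) auto
      show "(\<lambda>x. f x * \<phi> n x) \<in> borel_measurable (lebesgue_on \<Omega>)" for n
        using f meas by (intro borel_measurable_times) auto
      show "integrable (lebesgue_on \<Omega>) (\<lambda>x. \<bar>f x\<bar>)" using f by simp
      show "AE x in lebesgue_on \<Omega>. (\<lambda>n. f x * \<phi> n x) \<longlonglongrightarrow> f x * indicator (box a b) x"
        using \<phi>(4) by (intro AE_I2 tendsto_mult tendsto_const) 
      show "AE x in lebesgue_on \<Omega>. norm (f x * \<phi> n x) \<le> \<bar>f x\<bar>" for n
        using \<phi>(2)[of n] by (intro AE_I2) (auto simp: abs_mult intro!: mult_left_le)
    qed
    moreover have "(\<integral>x. f x * \<phi> n x \<partial>lebesgue_on \<Omega>) = 0" for n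
      by (rule orth[OF box_bump_test_function[OF \<phi>(1,3) ab]])
    ultimately have "(\<integral>x. f x * indicator (box a b) x \<partial>lebesgue_on \<Omega>) = 0"
      by (simp add: LIMSEQ_const_iff)
    moreover have "(\<integral>x. f x * indicator (box a b) x \<partial>lebesgue_on \<Omega>)
        = (\<integral>x. ?F x \<partial>lebesgue_on (box a b))"
      using sets by (simp add: integral_restrict_space mult_ac)
    moreover have "\<dots> = integral (box a b) ?F"
      by (rule lebesgue_integral_eq_integral)
        (use integrable_mult_indicator[OF _ F, of "box a b"] in \<open>simp_all add: integrable_restrict_space\<close>)
    ultimately show ?thesis by (simp add: integral_open_interval)
  qed
  have "?F integrable_on cbox a b" for a b
    using integrable_on_lebesgue[OF F] integrable_on_subcbox by blast
  \<comment> \<open>Lebesgue differentiation along cubes with lower corner x; N is the exceptional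
    set.\<close>
  then obtain N where N: "negligible N"
    "\<And>x e. \<lbrakk>x \<notin> N; 0 < e\<rbrakk> \<Longrightarrow> \<exists>d>0. \<forall>h. 0 < h \<and> h < d \<longrightarrow>
       norm (integral (cbox x (x + h *\<^sub>R One)) ?F /\<^sub>R h ^ DIM('a) - ?F x) < e"
    by (rule integrable_ccontinuous_explicit[of ?F]) blast
  have zero: "f x = 0" if x: "x \<in> \<Omega>" "x \<notin> N" for x
  proof (rule ccontr)
    assume "f x \<noteq> 0"
    \<comment> \<open>With tolerance \<open>\<bar>f x\<bar>\<close> a cube average equal to 0 is
      already a contradiction, since it misses \<open>f x\<close> by exactly that amount.\<close>
    then obtain d where d: "d > 0" "\<And>h. 0 < h \<Longrightarrow> h < d \<Longrightarrow>
        norm (integral (cbox x (x + h *\<^sub>R One)) ?F /\<^sub>R h ^ DIM('a) - ?F x) < \<bar>f x\<bar>"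
      using N(2)[OF x(2), of "\<bar>f x\<bar>"] by auto
    obtain e where e: "e > 0" "ball x e \<subseteq> \<Omega>" using \<Omega> x open_contains_ball by blast
    \<comment> \<open>The second bound makes the sum of the side lengths of the cube smaller than e,
      which keeps the cube inside the ball.\<close>
    define h where "h = min (d / 2) (e / (2 * DIM('a)))"
    have h: "0 < h" "h < d" "h * DIM('a) < e"
      using d e by (auto simp: h_def min_def field_simps)
    have "cbox x (x + h *\<^sub>R One) \<subseteq> ball x e"
    proof
      fix y assume y: "y \<in> cbox x (x + h *\<^sub>R One)"
      have "norm (y - x) \<le> (\<Sum>i\<in>Basis. \<bar>(y - x) \<bullet> i\<bar>)" by (rule norm_le_l1)
      also have "\<dots> \<le> (\<Sum>i\<in>(Basis::'a set). h)"
        using y by (intro sum_mono) (auto simp: mem_box algebra_simps)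
      finally show "y \<in> ball x e" using h by (simp add: dist_norm norm_minus_commute mult.commute)
    qed
    then have "integral (cbox x (x + h *\<^sub>R One)) ?F = 0" using e by (intro box0) auto
    then show False using d(2)[OF h(1,2)] x by simp
  qed
  show ?thesis
    unfolding AE_restrict_space_iff[of \<Omega> lebesgue, simplified, OF sets]
    using N(1) zero by (intro AE_I'[of N]) (auto simp: negligible_iff_null_sets)
qed

section \<open>Weak gradients\<close>

lemma lebesgue_translation_measurable: "(\<lambda>x. a + x) \<in> lebesgue \<rightarrow>\<^sub>M (lebesgue :: 'a::euclidean_space measure)"
  and lebesgue_eq_distr_translation: "lebesgue = distr lebesgue lebesgue (\<lambda>x::'a. a + x)"
proof -
  \<comment> \<open>A translation is the coordinatewise affine map with all scaling factors 1, so
    its Jacobian factor is 1 as well.\<close>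
  have T: "(\<lambda>x. a + (\<Sum>j\<in>Basis. (1 * (x \<bullet> j)) *\<^sub>R j)) = (\<lambda>x. a + x)"
    by (simp add: euclidean_representation)
  show "(\<lambda>x. a + x) \<in> lebesgue \<rightarrow>\<^sub>M lebesgue"
    using lebesgue_affine_measurable[of "\<lambda>_. 1" a] unfolding T by simp
  show "lebesgue = distr lebesgue lebesgue (\<lambda>x. a + x)"
    using lebesgue_affine_euclidean[of "\<lambda>_. 1" a] unfolding T by (simp add: density_1)
qed

lemma lebesgue_integral_translation:
  fixes f :: "'a::euclidean_space \<Rightarrow> real"
  assumes "f \<in> borel_measurable lebesgue"
  shows "(\<integral>x. f (a + x) \<partial>lebesgue) = (\<integral>x. f x \<partial>lebesgue)"
    "(\<lambda>x. f (a + x)) \<in> borel_measurable lebesgue"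
  using integral_distr[OF lebesgue_translation_measurable assms]
    measurable_compose[OF lebesgue_translation_measurable assms]
  by (simp_all flip: lebesgue_eq_distr_translation)

lemma nn_integral_lebesgue_translation:
  fixes f :: "'a::euclidean_space \<Rightarrow> ennreal"
  assumes "f \<in> borel_measurable lebesgue"
  shows "(\<integral>\<^sup>+x. f (a + x) \<partial>lebesgue) = (\<integral>\<^sup>+x. f x \<partial>lebesgue)"
  using nn_integral_distr[OF lebesgue_translation_measurable, of f a] assms
  by (simp flip: lebesgue_eq_distr_translation)

lemma directional_derivative:
  fixes \<phi> :: "'a::real_normed_vector \<Rightarrow> real"
  assumes "\<phi> differentiable (at x)"
  shows "((\<lambda>t. \<phi> (x + t *\<^sub>R i)) has_real_derivative frechet_derivative \<phi> (at x) i) (at 0)"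
proof -
  let ?D = "frechet_derivative \<phi> (at x)"
  have D: "(\<phi> has_derivative ?D) (at x)" using assms by (simp add: frechet_derivative_works)
  have "((\<lambda>t. x + t *\<^sub>R i) has_derivative (\<lambda>t. t *\<^sub>R i)) (at (0::real))"
    by (auto intro!: derivative_eq_intros)
  then have "((\<lambda>t. \<phi> (x + t *\<^sub>R i)) has_derivative (\<lambda>t. ?D (t *\<^sub>R i))) (at (0::real))"
    by (rule has_derivative_compose) (simp add: D)
  moreover have "linear ?D" using D has_derivative_linear by blast
  ultimately show ?thesis by (simp add: has_field_derivative_def linear_scale mult_commute_abs)
qed

lemma derivative_quotient_LIMSEQ:
  fixes f :: "real \<Rightarrow> real"
  assumes "(f has_real_derivative D) (at 0)" "s \<longlonglongrightarrow> 0" "\<And>n. s n \<noteq> 0"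
  shows "(\<lambda>n. (f (s n) - f 0) / s n) \<longlonglongrightarrow> D"
proof -
  have "((\<lambda>h. (f (0 + h) - f 0) / h) \<longlongrightarrow> D) (at 0)" using assms(1) by (simp add: DERIV_def)
  moreover have "filterlim s (at 0) sequentially" using assms(2,3) by (simp add: filterlim_at)
  ultimately have "(\<lambda>n. (f (0 + s n) - f 0) / s n) \<longlonglongrightarrow> D" by (rule filterlim_compose)
  then show ?thesis by simp
qed

lemma smooth_differentiable: "smooth \<phi> \<Longrightarrow> \<phi> differentiable (at x)"
  unfolding smooth_def by (metis C_k.simps(2))

lemma smooth_partial: "smooth \<phi> \<Longrightarrow> i \<in> Basis \<Longrightarrow> smooth (\<lambda>x. frechet_derivative \<phi> (at x) i)"
  unfolding smooth_def by (metis C_k.simps(2))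

lemma smooth_continuous: "smooth \<phi> \<Longrightarrow> continuous_on S \<phi>"
  unfolding smooth_def by (metis C_k.simps(1) continuous_on_subset subset_UNIV)

lemma continuous_borel_measurable_lebesgue:
  fixes f :: "'a::euclidean_space \<Rightarrow> real"
  assumes "continuous_on UNIV f"
  shows "f \<in> borel_measurable lebesgue"
proof -
  have "f \<in> borel_measurable borel" using assms by (rule borel_measurable_continuous_onI)
  then show ?thesis by (intro measurable_completion) simp
qed

lemma smooth_bounded_on_cball:
  assumes "smooth \<phi>"
  obtains B where "B \<ge> 0" "\<And>x. x \<in> cball 0 R \<Longrightarrow> \<bar>\<phi> x\<bar> \<le> B"
proof -
  have "compact (\<phi> ` cball 0 R)"
    by (intro compact_continuous_image smooth_continuous assms) simp
  then obtain B where "\<forall>y\<in>\<phi> ` cball 0 R. \<bar>y\<bar> \<le> B"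
    using compact_imp_bounded bounded_iff by (metis real_norm_def)
  then have "\<bar>\<phi> x\<bar> \<le> max B 0" if "x \<in> cball 0 R" for x using that by (force simp: le_max_iff_disj)
  then show thesis using that[of "max B 0"] by simp
qed

text \<open>Partial derivatives are bounded on the compact ball, and its convexity admits the mean
  value inequality. Later \<Omega> is enclosed in such a ball, so its own shape does not
  enter.\<close>

lemma smooth_lipschitz_on_cball:
  fixes \<phi> :: "'a::euclidean_space \<Rightarrow> real"
  assumes "smooth \<phi>"
  obtains L where "L \<ge> 0" "\<And>x y. x \<in> cball 0 R \<Longrightarrow> y \<in> cball 0 R \<Longrightarrow> \<bar>\<phi> x - \<phi> y\<bar> \<le> L * norm (x - y)"
proof -
  let ?D = "\<lambda>x. frechet_derivative \<phi> (at x)"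
  have "\<exists>B. \<forall>i\<in>Basis. B i \<ge> 0 \<and> (\<forall>x\<in>cball 0 R. \<bar>?D x i\<bar> \<le> B i)"
    using smooth_bounded_on_cball[OF smooth_partial[OF assms]] by (intro bchoice) metis
  then obtain B where B: "\<And>i. i \<in> Basis \<Longrightarrow> B i \<ge> 0"
    "\<And>i x. i \<in> Basis \<Longrightarrow> x \<in> cball 0 R \<Longrightarrow> \<bar>?D x i\<bar> \<le> B i" by blast
  have D: "(\<phi> has_derivative ?D x) (at x)" for x
    using smooth_differentiable[OF assms] by (simp add: frechet_derivative_works)
  show thesis
  proof (rule that[of "\<Sum>i\<in>Basis. B i"])
    show "0 \<le> (\<Sum>i\<in>Basis. B i)" using B by (simp add: sum_nonneg)
    fix x y :: 'a assume xy: "x \<in> cball 0 R" "y \<in> cball 0 R"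
    have on: "onorm (?D w) \<le> (\<Sum>i\<in>Basis. B i)" if w: "w \<in> cball 0 R" for w
    proof (rule onorm_le)
      fix h
      have lin: "linear (?D w)" using D has_derivative_linear by blast
      have "?D w h = ?D w (\<Sum>i\<in>Basis. (h \<bullet> i) *\<^sub>R i)" by (simp add: euclidean_representation)
      also have "\<dots> = (\<Sum>i\<in>Basis. (h \<bullet> i) * ?D w i)"
        using lin by (simp add: linear_sum linear_scale)
      finally have "norm (?D w h) \<le> (\<Sum>i\<in>Basis. \<bar>(h \<bullet> i) * ?D w i\<bar>)"
        by (metis real_norm_def sum_abs)
      also have "\<dots> \<le> (\<Sum>i\<in>Basis. norm h * B i)"
        unfolding abs_mult using w by (intro sum_mono mult_mono B Basis_le_norm) auto
      finally show "norm (?D w h) \<le> (\<Sum>i\<in>Basis. B i) * norm h"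
        by (simp add: sum_distrib_left mult.commute)
    qed
    have "norm (\<phi> x - \<phi> y) \<le> (\<Sum>i\<in>Basis. B i) * norm (x - y)"
      by (rule differentiable_bound[of "cball 0 R" \<phi> ?D])
         (use on xy in \<open>auto intro: has_derivative_at_withinI D\<close>)
    then show "\<bar>\<phi> x - \<phi> y\<bar> \<le> (\<Sum>i\<in>Basis. B i) * norm (x - y)" by simp
  qed
qed

lemma lmeasurable_bounded_open: "open S \<Longrightarrow> bounded S \<Longrightarrow> S \<in> lmeasurable" for S :: "'a::euclidean_space set"
  by (simp add: lmeasurable_open)

lemma L2_bounded:
  assumes "S \<in> lmeasurable" and f: "f \<in> borel_measurable (lebesgue_on S)"
    and "\<And>x. x \<in> S \<Longrightarrow> \<bar>f x\<bar> \<le> B"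
  shows "f \<in> L2 (lebesgue_on S)"
proof -
  interpret finite_measure "lebesgue_on S" by (rule finite_measure_lebesgue_on[OF assms(1)])
  have "(f x)\<^sup>2 \<le> B\<^sup>2" if "x \<in> S" for x using assms(3)[OF that] by (simp add: abs_le_square_iff[symmetric])
  then have "integrable (lebesgue_on S) (\<lambda>x. (f x)\<^sup>2)"
    using f by (intro integrable_const_bound[where B = "B\<^sup>2"]) (auto intro!: AE_I2)
  then show ?thesis using f by (simp add: L2_def)
qed

text \<open>Translation invariance moves the difference quotient from the test function to \<open>v\<close>, after
  which both sides pass to the limit by dominated convergence.\<close>

lemma weak_gradientI_lipschitz:
  fixes \<Omega> :: "'a::euclidean_space set"
  assumes \<Omega>: "open \<Omega>" "bounded \<Omega>"
    and v: "v \<in> borel_measurable (lebesgue_on \<Omega>)" "\<And>x. x \<in> \<Omega> \<Longrightarrow> \<bar>v x\<bar> \<le> B"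
    and lip: "\<And>x y. closed_segment x y \<subseteq> \<Omega> \<Longrightarrow> \<bar>v x - v y\<bar> \<le> L * norm (x - y)"
    and G: "\<And>i. i \<in> Basis \<Longrightarrow> (\<lambda>x. G x \<bullet> i) \<in> borel_measurable (lebesgue_on \<Omega>)"
      "\<And>x i. i \<in> Basis \<Longrightarrow> x \<in> \<Omega> \<Longrightarrow> \<bar>G x \<bullet> i\<bar> \<le> L'"
    and deriv: "\<And>i. i \<in> Basis \<Longrightarrow> AE x in lebesgue_on \<Omega>.
      ((\<lambda>t. v (x + t *\<^sub>R i)) has_real_derivative G x \<bullet> i) (at 0)"
  shows "weak_gradient \<Omega> v G"
  unfolding weak_gradient_def
proof (intro ballI conjI)
  have lm: "\<Omega> \<in> lmeasurable" using \<Omega> by (rule lmeasurable_bounded_open)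
  have sets: "\<Omega> \<in> sets lebesgue" using \<Omega> by simp
  fix i :: 'a assume i: "i \<in> Basis"
  show "(\<lambda>x. G x \<bullet> i) \<in> L2 (lebesgue_on \<Omega>)" by (rule L2_bounded[OF lm G(1)[OF i] G(2)[OF i]])
  fix \<phi> assume \<phi>: "\<phi> \<in> test_functions \<Omega>"
  let ?K = "closure {x. \<phi> x \<noteq> 0}" and ?D = "\<lambda>x. frechet_derivative \<phi> (at x) i"
  have sm: "smooth \<phi>" and K: "compact ?K" "?K \<subseteq> \<Omega>" using \<phi> by (auto simp: test_functions_def)
  obtain \<epsilon> where \<epsilon>: "\<epsilon> > 0" "(\<Union>x\<in>?K. ball x \<epsilon>) \<subseteq> \<Omega>"
    using compact_subset_open_imp_ball_epsilon_subset[OF K(1) \<Omega>(1) K(2)] by blast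
  obtain R where R: "\<Omega> \<subseteq> cball 0 R" using \<Omega>(2) unfolding bounded_iff by (meson mem_cball_0 subsetI)
  obtain C where C: "C \<ge> 0" "\<And>x y. x \<in> cball 0 (R + 1) \<Longrightarrow> y \<in> cball 0 (R + 1) \<Longrightarrow>
      \<bar>\<phi> x - \<phi> y\<bar> \<le> C * norm (x - y)"
    using smooth_lipschitz_on_cball[OF sm] by blast
  obtain E where E: "E \<ge> 0" "\<And>x. x \<in> cball 0 (R + 1) \<Longrightarrow> \<bar>\<phi> x\<bar> \<le> E"
    using smooth_bounded_on_cball[OF sm] by blast
  \<comment> \<open>Steps below \<epsilon> keep translates of the support of \<phi> inside \<Omega>;
    steps below 1 keep translates of \<Omega> inside the ball of radius \<open>R + 1\<close> on
    which \<phi> is estimated. The offset 2 in \<open>n + 2\<close> makes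
    \<open>s n < \<delta>\<close> strict already for n = 0.\<close>
  define \<delta> where "\<delta> = min 1 \<epsilon>"
  define s where "s n = \<delta> / real (n + 2)" for n
  have \<delta>: "0 < \<delta>" "\<delta> \<le> 1" "\<delta> \<le> \<epsilon>" using \<epsilon>(1) by (auto simp: \<delta>_def)
  have s: "0 < s n" "s n < \<delta>" "s n \<noteq> 0" for n using \<delta> by (auto simp: s_def divide_simps)
  have s0: "s \<longlonglongrightarrow> 0"
    unfolding s_def by (rule LIMSEQ_ignore_initial_segment[OF lim_const_over_n])
  \<comment> \<open>Extension by zero lets translations act on the whole space. Its jump across the
    boundary is invisible: where \<phi> is nonzero, both x and its backward translate lie in
    \<Omega>.\<close>
  let ?V = "\<lambda>x. indicator \<Omega> x * v x"
  have V: "?V \<in> borel_measurable lebesgue"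
    using v(1) sets by (simp add: borel_measurable_restrict_space_iff)
  have \<phi>m: "\<phi> \<in> borel_measurable lebesgue"
    by (rule continuous_borel_measurable_lebesgue[OF smooth_continuous[OF sm]])
  have Dm: "?D \<in> borel_measurable lebesgue"
    by (rule continuous_borel_measurable_lebesgue[OF smooth_continuous[OF smooth_partial[OF sm i]]])
  have Gm: "(\<lambda>x. indicator \<Omega> x * (G x \<bullet> i)) \<in> borel_measurable lebesgue"
    using G(1)[OF i] sets by (simp add: borel_measurable_restrict_space_iff)
  have ind: "integrable lebesgue (\<lambda>x. c * indicator \<Omega> x)" for c :: real
    using lm by (intro integrable_mult_right integrable_real_indicator) (auto simp: fmeasurable_def)
  have near: "x \<in> \<Omega>" "closed_segment (x - s n *\<^sub>R i) x \<subseteq> \<Omega>" if "\<phi> x \<noteq> 0" for x n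
  proof -
    have xK: "x \<in> ?K" using that closure_subset by fast
    show "x \<in> \<Omega>" using xK K by blast
    have "closed_segment (x - s n *\<^sub>R i) x \<subseteq> ball x \<epsilon>"
      using s[of n] \<delta> i by (intro closed_segment_subset) (auto simp: dist_norm)
    then show "closed_segment (x - s n *\<^sub>R i) x \<subseteq> \<Omega>" using \<epsilon>(2) xK by blast
  qed
  have in_ball: "x \<in> cball 0 (R + 1)" "x + s n *\<^sub>R i \<in> cball 0 (R + 1)" if "x \<in> \<Omega>" for x n
  proof -
    have x: "norm x \<le> R" using R that by (auto simp: dist_norm)
    then show "x \<in> cball 0 (R + 1)" by simp
    have "norm (x + s n *\<^sub>R i) \<le> norm x + norm (s n *\<^sub>R i)" by (rule norm_triangle_ineq)
    also have "\<dots> \<le> R + 1" using x s[of n] \<delta> i by (intro add_mono) auto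
    finally show "x + s n *\<^sub>R i \<in> cball 0 (R + 1)" by simp
  qed
  have \<phi>s: "(\<lambda>x. \<phi> (x + s n *\<^sub>R i)) \<in> borel_measurable lebesgue" for n
    using lebesgue_integral_translation(2)[OF \<phi>m, of "s n *\<^sub>R i"] by (simp add: add.commute)
  have Vs: "(\<lambda>x. ?V (x - s n *\<^sub>R i)) \<in> borel_measurable lebesgue" for n
    using lebesgue_integral_translation(2)[OF V, of "- (s n *\<^sub>R i)"] by (simp add: add.commute)
  have B0: "x \<in> \<Omega> \<Longrightarrow> 0 \<le> B" for x using v(2)[of x] by linarith
  have int1: "integrable lebesgue (\<lambda>x. ?V x * \<phi> (x + s n *\<^sub>R i))" for n
  proof (rule Bochner_Integration.integrable_bound[OF ind[of "B * E"]])
    show "(\<lambda>x. ?V x * \<phi> (x + s n *\<^sub>R i)) \<in> borel_measurable lebesgue"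
      using V \<phi>s by (rule borel_measurable_times)
    show "AE x in lebesgue. norm (?V x * \<phi> (x + s n *\<^sub>R i)) \<le> norm (B * E * indicator \<Omega> x)"
      using in_ball v(2) E B0
      by (intro AE_I2) (auto simp: indicator_def abs_mult intro!: mult_mono)
  qed
  have int2: "integrable lebesgue (\<lambda>x. ?V x * \<phi> x)"
  proof (rule Bochner_Integration.integrable_bound[OF ind[of "B * E"]])
    show "(\<lambda>x. ?V x * \<phi> x) \<in> borel_measurable lebesgue"
      using V \<phi>m by (rule borel_measurable_times)
    show "AE x in lebesgue. norm (?V x * \<phi> x) \<le> norm (B * E * indicator \<Omega> x)"
      using in_ball(1) v(2) E B0
      by (intro AE_I2) (auto simp: indicator_def abs_mult intro!: mult_mono)
  qed
  have hm: "(\<lambda>x. ?V (x - s n *\<^sub>R i) * \<phi> x) \<in> borel_measurable lebesgue" for n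
    using Vs \<phi>m by (rule borel_measurable_times)
  have shift: "(\<integral>x. ?V x * \<phi> (x + s n *\<^sub>R i) \<partial>lebesgue) = (\<integral>x. ?V (x - s n *\<^sub>R i) * \<phi> x \<partial>lebesgue)" for n
    using lebesgue_integral_translation(1)[OF hm, of "s n *\<^sub>R i" n] by (simp add: add.commute)
  have int3: "integrable lebesgue (\<lambda>x. ?V (x - s n *\<^sub>R i) * \<phi> x)" for n
  proof (rule Bochner_Integration.integrable_bound[OF ind[of "B * E"]])
    show "AE x in lebesgue. norm (?V (x - s n *\<^sub>R i) * \<phi> x) \<le> norm (B * E * indicator \<Omega> x)"
    proof (rule AE_I2)
      fix x
      show "norm (?V (x - s n *\<^sub>R i) * \<phi> x) \<le> norm (B * E * indicator \<Omega> x)"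
      proof (cases "\<phi> x = 0")
        case False
        then have x: "x \<in> \<Omega>" "x - s n *\<^sub>R i \<in> \<Omega>" using near[OF False] by auto
        then show ?thesis using in_ball(1)[OF x(1)] v(2) E B0
          by (auto simp: abs_mult intro!: mult_mono)
      qed simp
    qed
  qed (rule hm)
  have eq: "(\<integral>x. ?V x * ((\<phi> (x + s n *\<^sub>R i) - \<phi> x) / s n) \<partial>lebesgue)
      = (\<integral>x. (?V (x - s n *\<^sub>R i) - ?V x) / s n * \<phi> x \<partial>lebesgue)" for n
  proof -
    have "(\<integral>x. ?V x * ((\<phi> (x + s n *\<^sub>R i) - \<phi> x) / s n) \<partial>lebesgue)
        = (\<integral>x. (?V x * \<phi> (x + s n *\<^sub>R i) - ?V x * \<phi> x) / s n \<partial>lebesgue)"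
      by (simp add: algebra_simps diff_divide_distrib)
    also have "\<dots> = ((\<integral>x. ?V (x - s n *\<^sub>R i) * \<phi> x \<partial>lebesgue) - (\<integral>x. ?V x * \<phi> x \<partial>lebesgue)) / s n"
      using int1 int2 shift by simp
    also have "\<dots> = (\<integral>x. (?V (x - s n *\<^sub>R i) * \<phi> x - ?V x * \<phi> x) / s n \<partial>lebesgue)"
      using int3 int2 by simp
    also have "\<dots> = (\<integral>x. (?V (x - s n *\<^sub>R i) - ?V x) / s n * \<phi> x \<partial>lebesgue)"
      by (simp add: algebra_simps diff_divide_distrib)
    finally show ?thesis .
  qed
  have lim1: "(\<lambda>n. \<integral>x. ?V x * ((\<phi> (x + s n *\<^sub>R i) - \<phi> x) / s n) \<partial>lebesgue)
      \<longlonglongrightarrow> (\<integral>x. ?V x * ?D x \<partial>lebesgue)"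
  proof (rule integral_dominated_convergence[OF _ _ ind[of "B * C"]])
    show "(\<lambda>x. ?V x * ?D x) \<in> borel_measurable lebesgue"
      using V Dm by (rule borel_measurable_times)
    show "(\<lambda>x. ?V x * ((\<phi> (x + s n *\<^sub>R i) - \<phi> x) / s n)) \<in> borel_measurable lebesgue" for n
      by (intro borel_measurable_times[OF V] borel_measurable_divide borel_measurable_diff
          borel_measurable_const \<phi>m \<phi>s)
    show "AE x in lebesgue. (\<lambda>n. ?V x * ((\<phi> (x + s n *\<^sub>R i) - \<phi> x) / s n)) \<longlonglongrightarrow> ?V x * ?D x"
      using derivative_quotient_LIMSEQ[OF directional_derivative[OF smooth_differentiable[OF sm]] s0 s(3)]
      by (intro AE_I2 tendsto_mult tendsto_const) simp
    show "AE x in lebesgue. norm (?V x * ((\<phi> (x + s n *\<^sub>R i) - \<phi> x) / s n)) \<le> B * C * indicator \<Omega> x" for n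
    proof (rule AE_I2)
      fix x
      show "norm (?V x * ((\<phi> (x + s n *\<^sub>R i) - \<phi> x) / s n)) \<le> B * C * indicator \<Omega> x"
      proof (cases "x \<in> \<Omega>")
        case True
        have "\<bar>\<phi> (x + s n *\<^sub>R i) - \<phi> x\<bar> \<le> C * s n"
          using C(2)[OF in_ball(2)[OF True] in_ball(1)[OF True], of n] s(1)[of n] i by simp
        then have "\<bar>(\<phi> (x + s n *\<^sub>R i) - \<phi> x) / s n\<bar> \<le> C"
          using s(1)[of n] by (simp add: abs_divide divide_le_eq)
        then have "norm (v x * ((\<phi> (x + s n *\<^sub>R i) - \<phi> x) / s n)) \<le> B * C"
          unfolding real_norm_def abs_mult by (intro mult_mono v(2)[OF True] B0[OF True]) auto
        then show ?thesis using True by simp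
      qed simp
    qed
  qed
  have lim2: "(\<lambda>n. \<integral>x. (?V (x - s n *\<^sub>R i) - ?V x) / s n * \<phi> x \<partial>lebesgue)
      \<longlonglongrightarrow> (\<integral>x. - (indicator \<Omega> x * (G x \<bullet> i)) * \<phi> x \<partial>lebesgue)"
  proof (rule integral_dominated_convergence[OF _ _ ind[of "L * E"]])
    show "(\<lambda>x. - (indicator \<Omega> x * (G x \<bullet> i)) * \<phi> x) \<in> borel_measurable lebesgue"
      by (rule borel_measurable_times[OF borel_measurable_uminus[OF Gm] \<phi>m])
    show "(\<lambda>x. (?V (x - s n *\<^sub>R i) - ?V x) / s n * \<phi> x) \<in> borel_measurable lebesgue" for n
      by (intro borel_measurable_times[OF _ \<phi>m] borel_measurable_divide borel_measurable_diff
          borel_measurable_const V Vs)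
    have "AE x in lebesgue. x \<in> \<Omega> \<longrightarrow> ((\<lambda>t. v (x + t *\<^sub>R i)) has_real_derivative G x \<bullet> i) (at 0)"
      using deriv[OF i] sets by (simp add: AE_restrict_space_iff)
    then show "AE x in lebesgue. (\<lambda>n. (?V (x - s n *\<^sub>R i) - ?V x) / s n * \<phi> x)
        \<longlonglongrightarrow> - (indicator \<Omega> x * (G x \<bullet> i)) * \<phi> x"
    proof (rule AE_mp, intro AE_I2 impI)
      fix x assume d: "x \<in> \<Omega> \<longrightarrow> ((\<lambda>t. v (x + t *\<^sub>R i)) has_real_derivative G x \<bullet> i) (at 0)"
      show "(\<lambda>n. (?V (x - s n *\<^sub>R i) - ?V x) / s n * \<phi> x) \<longlonglongrightarrow> - (indicator \<Omega> x * (G x \<bullet> i)) * \<phi> x"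
      proof (cases "\<phi> x = 0")
        case False
        have x: "x \<in> \<Omega>" "x - s n *\<^sub>R i \<in> \<Omega>" for n using near[OF False] by auto
        have m0: "(\<lambda>n. - s n) \<longlonglongrightarrow> 0" using tendsto_minus[OF s0] by simp
        \<comment> \<open>The translation of v goes backwards, so the derivative is approached with
          steps \<open>- s n\<close>; this yields the minus sign of integration by parts.\<close>
        have "(\<lambda>n. (v (x + (- s n) *\<^sub>R i) - v (x + 0 *\<^sub>R i)) / (- s n)) \<longlonglongrightarrow> G x \<bullet> i"
          using d x(1) s(3) by (intro derivative_quotient_LIMSEQ[OF _ m0]) auto
        then have "(\<lambda>n. - ((v (x + (- s n) *\<^sub>R i) - v (x + 0 *\<^sub>R i)) / (- s n)) * \<phi> x) \<longlonglongrightarrow> - (G x \<bullet> i) * \<phi> x"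
          by (intro tendsto_mult tendsto_minus tendsto_const)
        then show ?thesis using x by simp
      qed simp
    qed
    show "AE x in lebesgue. norm ((?V (x - s n *\<^sub>R i) - ?V x) / s n * \<phi> x) \<le> L * E * indicator \<Omega> x" for n
    proof (rule AE_I2)
      fix x
      show "norm ((?V (x - s n *\<^sub>R i) - ?V x) / s n * \<phi> x) \<le> L * E * indicator \<Omega> x"
      proof (cases "\<phi> x = 0")
        case True
        show ?thesis
        proof (cases "x \<in> \<Omega>")
          case x: True
          \<comment> \<open>A short segment inside \<Omega> shows that L is nonnegative, as the
            dominating function requires at points where \<phi> vanishes.\<close>
          obtain e where e: "e > 0" "ball x e \<subseteq> \<Omega>" using \<Omega>(1) x open_contains_ball by blast
          have "closed_segment x (x + (e / 2) *\<^sub>R i) \<subseteq> ball x e"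
            using e i by (intro closed_segment_subset) (auto simp: dist_norm)
          then have "\<bar>v x - v (x + (e / 2) *\<^sub>R i)\<bar> \<le> L * norm (x - (x + (e / 2) *\<^sub>R i))"
            using e(2) by (intro lip) (rule order_trans)
          then have "0 \<le> L * norm (x - (x + (e / 2) *\<^sub>R i))"
            by (rule order_trans[OF abs_ge_zero])
          then have "0 \<le> L * (e / 2)" using e(1) i by simp
          then have "L \<ge> 0" using e(1) by (simp add: zero_le_mult_iff)
          then show ?thesis using True E by simp
        qed (simp add: True)
      next
        case False
        have x: "x \<in> \<Omega>" "x - s n *\<^sub>R i \<in> \<Omega>" using near[OF False] by auto
        have "\<bar>v (x - s n *\<^sub>R i) - v x\<bar> \<le> L * s n"
          using lip[OF near(2)[OF False], of n] i s(1)[of n] by simp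
        then have "\<bar>(v (x - s n *\<^sub>R i) - v x) / s n\<bar> \<le> L"
          using s(1)[of n] by (simp add: abs_divide divide_le_eq)
        moreover from this have "0 \<le> L" by linarith
        moreover have "\<bar>\<phi> x\<bar> \<le> E" using E in_ball(1)[OF x(1)] by simp
        ultimately have "norm ((v (x - s n *\<^sub>R i) - v x) / s n * \<phi> x) \<le> L * E"
          unfolding real_norm_def abs_mult by (intro mult_mono) auto
        then show ?thesis using x by simp
      qed
    qed
  qed
  have "(\<integral>x. ?V x * ?D x \<partial>lebesgue) = (\<integral>x. - (indicator \<Omega> x * (G x \<bullet> i)) * \<phi> x \<partial>lebesgue)"
    using LIMSEQ_unique[OF lim1] lim2 unfolding eq by blast
  then show "(\<integral>x. v x * ?D x \<partial>lebesgue_on \<Omega>) = - (\<integral>x. (G x \<bullet> i) * \<phi> x \<partial>lebesgue_on \<Omega>)"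
    using sets by (simp add: integral_restrict_space mult.assoc)
qed

section \<open>Square integrable functions as a semi-inner product space\<close>

lemma L2_measurable: "f \<in> L2 N \<Longrightarrow> f \<in> borel_measurable N"
  by (simp add: L2_def)

lemma L2_integrable_mult:
  assumes "f \<in> L2 N" "g \<in> L2 N"
  shows "integrable N (\<lambda>x. f x * g x)"
proof (rule Bochner_Integration.integrable_bound)
  show "integrable N (\<lambda>x. (f x)\<^sup>2 + (g x)\<^sup>2)" using assms by (simp add: L2_def)
  show "(\<lambda>x. f x * g x) \<in> borel_measurable N"
    by (intro borel_measurable_times L2_measurable assms)
  have "\<bar>a * b\<bar> \<le> a\<^sup>2 + b\<^sup>2" for a b :: real
  proof -
    have "2 * \<bar>a * b\<bar> \<le> a\<^sup>2 + b\<^sup>2"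
      using sum_squares_bound[of "\<bar>a\<bar>" "\<bar>b\<bar>"] by (simp add: abs_mult)
    then show ?thesis using abs_ge_zero[of "a * b"] by linarith
  qed
  then show "AE x in N. norm (f x * g x) \<le> norm ((f x)\<^sup>2 + (g x)\<^sup>2)"
    by (intro AE_I2) (simp add: order_trans[OF _ abs_ge_self])
qed

lemma L2_closed:
  assumes "f \<in> L2 N" "g \<in> L2 N"
  shows "(\<lambda>x. f x + c * g x) \<in> L2 N"
proof -
  have "(\<lambda>x. (f x + c * g x)\<^sup>2) = (\<lambda>x. (f x)\<^sup>2 + 2 * c * (f x * g x) + c\<^sup>2 * (g x)\<^sup>2)"
    by (simp add: power2_eq_square algebra_simps)
  then have "integrable N (\<lambda>x. (f x + c * g x)\<^sup>2)"
    using assms L2_integrable_mult[OF assms] by (simp add: L2_def)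
  moreover have "(\<lambda>x. f x + c * g x) \<in> borel_measurable N"
    by (intro borel_measurable_add borel_measurable_times borel_measurable_const L2_measurable assms)
  ultimately show ?thesis by (simp add: L2_def)
qed

lemma L2_inner_linear:
  assumes "f \<in> L2 N" "g \<in> L2 N" "h \<in> L2 N"
  shows "L2_inner N (\<lambda>x. f x + c * g x) h = L2_inner N f h + c * L2_inner N g h"
proof -
  have "(\<lambda>x. (f x + c * g x) * h x) = (\<lambda>x. f x * h x + c * (g x * h x))"
    by (simp add: algebra_simps)
  then show ?thesis
    using L2_integrable_mult[OF assms(1,3)] L2_integrable_mult[OF assms(2,3)]
    by (simp add: L2_inner_def)
qed

lemma L2_inner_commute: "L2_inner N f g = L2_inner N g f"
  by (simp add: L2_inner_def mult.commute)

lemma L2_inner_nonneg: "0 \<le> L2_inner N f f"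
  by (simp add: L2_inner_def)

lemma semi_inner_L2: "semi_inner (L2 N) (L2_inner N)"
  by unfold_locales (rule L2_closed L2_inner_commute L2_inner_linear L2_inner_nonneg; assumption)+

lemma nrm_L2: "semi_inner.nrm (L2_inner N) = L2_norm N"
  by (simp add: fun_eq_iff semi_inner.nrm_def[OF semi_inner_L2] L2_norm_def)

section \<open>The space \<open>H1\<close> on a bounded open set\<close>

locale bounded_open =
  fixes \<Omega> :: "'a::euclidean_space set"
  assumes open_\<Omega>: "open \<Omega>" and bounded_\<Omega>: "bounded \<Omega>"
begin

lemma sets_\<Omega>: "\<Omega> \<in> sets lebesgue"
  using open_\<Omega> by simp

lemma lmeasurable_\<Omega>: "\<Omega> \<in> lmeasurable"
  using open_\<Omega> bounded_\<Omega> by (rule lmeasurable_bounded_open)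

abbreviation \<L> where "\<L> \<equiv> lebesgue_on \<Omega>"

sublocale fin: finite_measure \<L>
  by (rule finite_measure_lebesgue_on[OF lmeasurable_\<Omega>])

lemma \<Omega>_cball: obtains R where "R > 0" "\<Omega> \<subseteq> cball 0 R"
proof -
  obtain R where "\<forall>x\<in>\<Omega>. norm x \<le> R" using bounded_\<Omega> unfolding bounded_iff by blast
  then have "\<Omega> \<subseteq> cball 0 (max R 1)" by (auto simp: le_max_iff_disj)
  then show thesis by (rule that[rotated]) simp
qed

lemma smooth_measurable: "smooth \<phi> \<Longrightarrow> \<phi> \<in> borel_measurable \<L>"
  by (intro continuous_imp_measurable_on_sets_lebesgue smooth_continuous sets_\<Omega>)

lemma smooth_L2:
  assumes "smooth \<phi>"
  shows "\<phi> \<in> L2 \<L>"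
proof -
  obtain R where R: "\<Omega> \<subseteq> cball 0 R" using \<Omega>_cball by blast
  obtain B where "\<And>x. x \<in> cball 0 R \<Longrightarrow> \<bar>\<phi> x\<bar> \<le> B"
    using smooth_bounded_on_cball[OF assms] by metis
  then show ?thesis
    using R by (intro L2_bounded[OF lmeasurable_\<Omega> smooth_measurable[OF assms], of B]) auto
qed

lemma smooth_const: "smooth (\<lambda>_. c)"
  by (simp add: smooth_def C_k_const)

lemma L2_integrable: "f \<in> L2 \<L> \<Longrightarrow> integrable \<L> f"
  using L2_integrable_mult[of f \<L> "\<lambda>_. 1"] smooth_L2[OF smooth_const] by simp

lemma weak_gradient_L2: "weak_gradient \<Omega> v G \<Longrightarrow> i \<in> Basis \<Longrightarrow> (\<lambda>x. G x \<bullet> i) \<in> L2 \<L>"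
  by (simp add: weak_gradient_def)

lemma test_function_smooth: "\<phi> \<in> test_functions \<Omega> \<Longrightarrow> smooth \<phi>"
  by (simp add: test_functions_def)

lemma weak_gradient_linear:
  assumes "v \<in> L2 \<L>" "w \<in> L2 \<L>" "weak_gradient \<Omega> v G" "weak_gradient \<Omega> w G'"
  shows "weak_gradient \<Omega> (\<lambda>x. v x + c * w x) (\<lambda>x. G x + c *\<^sub>R G' x)"
  unfolding weak_gradient_def
proof (intro ballI conjI)
  fix i :: 'a assume i: "i \<in> Basis"
  note g = weak_gradient_L2[OF assms(3) i] weak_gradient_L2[OF assms(4) i]
  show "(\<lambda>x. (G x + c *\<^sub>R G' x) \<bullet> i) \<in> L2 \<L>"
    using L2_closed[OF g] by (simp add: inner_add_left)
  fix \<phi> assume \<phi>: "\<phi> \<in> test_functions \<Omega>"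
  have p: "\<phi> \<in> L2 \<L>" "(\<lambda>x. frechet_derivative \<phi> (at x) i) \<in> L2 \<L>"
    using smooth_L2 test_function_smooth[OF \<phi>] smooth_partial i by blast+
  have "(\<integral>x. (v x + c * w x) * frechet_derivative \<phi> (at x) i \<partial>\<L>)
      = (\<integral>x. v x * frechet_derivative \<phi> (at x) i \<partial>\<L>) + c * (\<integral>x. w x * frechet_derivative \<phi> (at x) i \<partial>\<L>)"
    using L2_inner_linear[OF assms(1,2) p(2), of c] by (simp add: L2_inner_def)
  also have "\<dots> = - (\<integral>x. (G x \<bullet> i) * \<phi> x \<partial>\<L>) + c * - (\<integral>x. (G' x \<bullet> i) * \<phi> x \<partial>\<L>)"
    using assms(3,4) i \<phi> by (simp add: weak_gradient_def)
  also have "\<dots> = - (\<integral>x. ((G x + c *\<^sub>R G' x) \<bullet> i) * \<phi> x \<partial>\<L>)"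
    using L2_inner_linear[OF g p(1), of c] by (simp add: L2_inner_def inner_add_left)
  finally show "(\<integral>x. (v x + c * w x) * frechet_derivative \<phi> (at x) i \<partial>\<L>)
      = - (\<integral>x. ((G x + c *\<^sub>R G' x) \<bullet> i) * \<phi> x \<partial>\<L>)" .
qed

text \<open>Each component of the difference annihilates all test functions, and it is integrable
  because the measure of \<Omega> is finite.\<close>

lemma weak_gradient_unique:
  assumes "weak_gradient \<Omega> v G" "weak_gradient \<Omega> v G'"
  shows "AE x in \<L>. G x = G' x"
proof -
  have "AE x in \<L>. G x \<bullet> i - G' x \<bullet> i = 0" if i: "i \<in> Basis" for i
  proof (rule AE_eq_0_if_orthogonal_test_functions[OF open_\<Omega>])
    note g = weak_gradient_L2[OF assms(1) i] weak_gradient_L2[OF assms(2) i]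
    show "integrable \<L> (\<lambda>x. G x \<bullet> i - G' x \<bullet> i)" using g L2_integrable by simp
    fix \<phi> assume \<phi>: "\<phi> \<in> test_functions \<Omega>"
    have p: "\<phi> \<in> L2 \<L>" using smooth_L2 test_function_smooth[OF \<phi>] .
    have "(\<integral>x. v x * frechet_derivative \<phi> (at x) i \<partial>\<L>) = - (\<integral>x. (G x \<bullet> i) * \<phi> x \<partial>\<L>)"
      "(\<integral>x. v x * frechet_derivative \<phi> (at x) i \<partial>\<L>) = - (\<integral>x. (G' x \<bullet> i) * \<phi> x \<partial>\<L>)"
      using assms i \<phi> by (simp_all add: weak_gradient_def)
    then show "(\<integral>x. (G x \<bullet> i - G' x \<bullet> i) * \<phi> x \<partial>\<L>) = 0"
      using L2_integrable_mult[OF g(1) p] L2_integrable_mult[OF g(2) p] by (simp add: left_diff_distrib)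
  qed
  then have "AE x in \<L>. \<forall>i\<in>Basis. G x \<bullet> i - G' x \<bullet> i = 0"
    by (intro eventually_ball_finite) auto
  then show ?thesis by eventually_elim (simp add: euclidean_eq_iff[where 'a = 'a])
qed

lemma H1_L2: "v \<in> H1 \<Omega> \<Longrightarrow> v \<in> L2 \<L>"
  by (simp add: H1_def)

lemma wgrad_weak_gradient:
  assumes "v \<in> H1 \<Omega>"
  shows "weak_gradient \<Omega> v (wgrad \<Omega> v)"
proof -
  have "\<exists>G. weak_gradient \<Omega> v G" using assms by (simp add: H1_def)
  then show ?thesis unfolding wgrad_def by (rule someI_ex)
qed

text \<open>Neutralises the choice operator: under integrals, \<open>wgrad\<close> may be replaced
  by any weak gradient at hand.\<close>

lemma wgrad_AE_eq:
  assumes "weak_gradient \<Omega> v G"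
  shows "AE x in \<L>. wgrad \<Omega> v x = G x"
proof (rule weak_gradient_unique[OF _ assms])
  have "\<exists>G. weak_gradient \<Omega> v G" using assms by blast
  then show "weak_gradient \<Omega> v (wgrad \<Omega> v)" unfolding wgrad_def by (rule someI_ex)
qed

lemma H1_closed: "v \<in> H1 \<Omega> \<Longrightarrow> w \<in> H1 \<Omega> \<Longrightarrow> (\<lambda>x. v x + c * w x) \<in> H1 \<Omega>"
  unfolding H1_def using weak_gradient_linear L2_closed by blast

lemma wgrad_linear:
  assumes "v \<in> H1 \<Omega>" "w \<in> H1 \<Omega>"
  shows "AE x in \<L>. wgrad \<Omega> (\<lambda>x. v x + c * w x) x = wgrad \<Omega> v x + c *\<^sub>R wgrad \<Omega> w x"
  using assms by (intro wgrad_AE_eq weak_gradient_linear wgrad_weak_gradient H1_L2)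

lemma wgrad_inner_integrable:
  assumes "v \<in> H1 \<Omega>" "w \<in> H1 \<Omega>"
  shows "integrable \<L> (\<lambda>x. wgrad \<Omega> v x \<bullet> wgrad \<Omega> w x)"
proof -
  have "integrable \<L> (\<lambda>x. (wgrad \<Omega> v x \<bullet> i) * (wgrad \<Omega> w x \<bullet> i))" if "i \<in> Basis" for i
    using that assms[THEN wgrad_weak_gradient] by (intro L2_integrable_mult weak_gradient_L2)
  then show ?thesis by (subst euclidean_inner) simp
qed

lemma wgrad_component_measurable:
  "v \<in> H1 \<Omega> \<Longrightarrow> i \<in> Basis \<Longrightarrow> (\<lambda>x. wgrad \<Omega> v x \<bullet> i) \<in> borel_measurable \<L>"
  by (rule L2_measurable[OF weak_gradient_L2[OF wgrad_weak_gradient]])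

lemma wgrad_measurable:
  assumes "v \<in> H1 \<Omega>"
  shows "wgrad \<Omega> v \<in> borel_measurable \<L>"
  by (subst borel_measurable_euclidean_space) (simp add: wgrad_component_measurable[OF assms])

lemma dirichlet_form_linear:
  assumes "v \<in> H1 \<Omega>" "w \<in> H1 \<Omega>" "y \<in> H1 \<Omega>"
  shows "dirichlet_form \<Omega> (\<lambda>x. v x + c * w x) y = dirichlet_form \<Omega> v y + c * dirichlet_form \<Omega> w y"
proof -
  have "dirichlet_form \<Omega> (\<lambda>x. v x + c * w x) y
      = (\<integral>x. (wgrad \<Omega> v x \<bullet> wgrad \<Omega> y x) + c * (wgrad \<Omega> w x \<bullet> wgrad \<Omega> y x) \<partial>\<L>)"
    unfolding dirichlet_form_def
  proof (rule integral_cong_AE)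
    show "(\<lambda>x. wgrad \<Omega> (\<lambda>x. v x + c * w x) x \<bullet> wgrad \<Omega> y x) \<in> borel_measurable \<L>"
      by (intro borel_measurable_integrable wgrad_inner_integrable H1_closed assms)
    show "(\<lambda>x. (wgrad \<Omega> v x \<bullet> wgrad \<Omega> y x) + c * (wgrad \<Omega> w x \<bullet> wgrad \<Omega> y x)) \<in> borel_measurable \<L>"
      using wgrad_measurable assms by (intro borel_measurable_add borel_measurable_times borel_measurable_inner) auto
    show "AE x in \<L>. wgrad \<Omega> (\<lambda>x. v x + c * w x) x \<bullet> wgrad \<Omega> y x
        = (wgrad \<Omega> v x \<bullet> wgrad \<Omega> y x) + c * (wgrad \<Omega> w x \<bullet> wgrad \<Omega> y x)"
      using wgrad_linear[OF assms(1,2), of c] by eventually_elim (simp add: inner_add_left)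
  qed
  then show ?thesis
    using wgrad_inner_integrable[OF assms(1,3)] wgrad_inner_integrable[OF assms(2,3)]
    by (simp add: dirichlet_form_def)
qed

lemma dirichlet_form_commute: "dirichlet_form \<Omega> v w = dirichlet_form \<Omega> w v"
  by (simp add: dirichlet_form_def inner_commute)

lemma dirichlet_form_nonneg: "0 \<le> dirichlet_form \<Omega> v v"
  by (simp add: dirichlet_form_def)

definition H1_inner where
  "H1_inner v w = L2_inner \<L> v w + dirichlet_form \<Omega> v w"

lemma semi_inner_H1: "semi_inner (H1 \<Omega>) H1_inner"
proof
  show "H1_inner v w = H1_inner w v" for v w
    unfolding H1_inner_def by (metis L2_inner_commute dirichlet_form_commute)
  show "0 \<le> H1_inner v v" for v
    by (simp add: H1_inner_def L2_inner_nonneg dirichlet_form_nonneg)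
  show "H1_inner (\<lambda>x. v x + c * w x) y = H1_inner v y + c * H1_inner w y"
    if "v \<in> H1 \<Omega>" "w \<in> H1 \<Omega>" "y \<in> H1 \<Omega>" for v w y c
    using that by (simp add: H1_inner_def L2_inner_linear H1_L2 dirichlet_form_linear algebra_simps)
qed (rule H1_closed)

lemma nrm_H1: "semi_inner.nrm H1_inner = H1_norm \<Omega>"
  by (simp add: fun_eq_iff semi_inner.nrm_def[OF semi_inner_H1] H1_norm_def H1_inner_def
      L2_norm_def L2_inner_nonneg)

lemma H1_norm_sq: "(H1_norm \<Omega> v)\<^sup>2 = H1_inner v v"
  by (simp add: H1_norm_def H1_inner_def L2_norm_def L2_inner_nonneg dirichlet_form_nonneg)

text \<open>Serves the second-order case of \<open>Hr\<close>: the components of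
  \<open>wgrad\<close> of a smooth function must lie in \<open>H1\<close>, but they agree with the
  smooth partial derivatives only almost everywhere.\<close>

lemma H1_AE_cong:
  assumes w: "w \<in> H1 \<Omega>" and v: "v \<in> borel_measurable \<L>" and eq: "AE x in \<L>. v x = w x"
  shows "v \<in> H1 \<Omega>"
proof -
  have "integrable \<L> (\<lambda>x. (v x)\<^sup>2) \<longleftrightarrow> integrable \<L> (\<lambda>x. (w x)\<^sup>2)"
    using v H1_L2[OF w] eq by (intro integrable_cong_AE) (auto simp: L2_def)
  then have L: "v \<in> L2 \<L>" using H1_L2[OF w] v by (simp add: L2_def)
  have "weak_gradient \<Omega> v (wgrad \<Omega> w)"
    unfolding weak_gradient_def
  proof (intro ballI conjI)
    fix i :: 'a assume i: "i \<in> Basis"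
    show "(\<lambda>x. wgrad \<Omega> w x \<bullet> i) \<in> L2 \<L>"
      by (rule weak_gradient_L2[OF wgrad_weak_gradient[OF w] i])
    fix \<phi> assume \<phi>: "\<phi> \<in> test_functions \<Omega>"
    have "(\<lambda>x. frechet_derivative \<phi> (at x) i) \<in> borel_measurable \<L>"
      by (intro smooth_measurable smooth_partial test_function_smooth \<phi> i)
    then have "(\<integral>x. v x * frechet_derivative \<phi> (at x) i \<partial>\<L>) = (\<integral>x. w x * frechet_derivative \<phi> (at x) i \<partial>\<L>)"
      using v L2_measurable[OF H1_L2[OF w]] eq
      by (intro integral_cong_AE borel_measurable_times) (auto elim: eventually_mono)
    then show "(\<integral>x. v x * frechet_derivative \<phi> (at x) i \<partial>\<L>) = - (\<integral>x. (wgrad \<Omega> w x \<bullet> i) * \<phi> x \<partial>\<L>)"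
      using wgrad_weak_gradient[OF w] \<phi> i by (simp add: weak_gradient_def)
  qed
  then show ?thesis using L by (auto simp: H1_def)
qed

section \<open>Smooth functions and finite element functions belong to \<open>H1\<close>\<close>

lemma smooth_weak_gradient:
  assumes "smooth \<phi>"
  shows "weak_gradient \<Omega> \<phi> (\<lambda>x. \<Sum>i\<in>Basis. frechet_derivative \<phi> (at x) i *\<^sub>R i)"
proof -
  let ?G = "\<lambda>x. \<Sum>i\<in>Basis. frechet_derivative \<phi> (at x) i *\<^sub>R i"
  obtain R where R: "\<Omega> \<subseteq> cball 0 R" using \<Omega>_cball by blast
  obtain B where B: "\<And>x. x \<in> cball 0 R \<Longrightarrow> \<bar>\<phi> x\<bar> \<le> B"
    using smooth_bounded_on_cball[OF assms] by metis
  obtain L where L: "\<And>x y. x \<in> cball 0 R \<Longrightarrow> y \<in> cball 0 R \<Longrightarrow> \<bar>\<phi> x - \<phi> y\<bar> \<le> L * norm (x - y)"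
    using smooth_lipschitz_on_cball[OF assms] by metis
  have "\<exists>C. \<forall>i\<in>Basis. \<forall>x\<in>cball 0 R. \<bar>frechet_derivative \<phi> (at x) i\<bar> \<le> C i"
    using smooth_bounded_on_cball[OF smooth_partial[OF assms]] by (intro bchoice) metis
  then obtain C where C: "\<And>i x. i \<in> Basis \<Longrightarrow> x \<in> cball 0 R \<Longrightarrow> \<bar>frechet_derivative \<phi> (at x) i\<bar> \<le> C i"
    by blast
  have G: "?G x \<bullet> i = frechet_derivative \<phi> (at x) i" if "i \<in> Basis" for x i
    using that by (simp add: inner_sum_left inner_Basis if_distrib sum.delta cong: if_cong)
  show ?thesis
  proof (rule weak_gradientI_lipschitz[OF open_\<Omega> bounded_\<Omega> smooth_measurable[OF assms]])
    show "\<bar>\<phi> x\<bar> \<le> B" if "x \<in> \<Omega>" for x using that R B by auto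
    show "\<bar>\<phi> x - \<phi> y\<bar> \<le> L * norm (x - y)" if "closed_segment x y \<subseteq> \<Omega>" for x y
      using that R by (intro L) auto
    show "(\<lambda>x. ?G x \<bullet> i) \<in> borel_measurable \<L>" if "i \<in> Basis" for i
      using smooth_measurable[OF smooth_partial[OF assms that]] by (simp only: G[OF that])
    show "\<bar>?G x \<bullet> i\<bar> \<le> (\<Sum>i\<in>Basis. \<bar>C i\<bar>)" if "i \<in> Basis" "x \<in> \<Omega>" for i x
    proof -
      have "\<bar>?G x \<bullet> i\<bar> \<le> \<bar>C i\<bar>"
        unfolding G[OF that(1)] using C[OF that(1)] that(2) R by (meson abs_ge_self order_trans subsetD)
      also have "\<dots> \<le> (\<Sum>i\<in>Basis. \<bar>C i\<bar>)" by (rule member_le_sum) (use that in auto)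
      finally show ?thesis .
    qed
    show "AE x in \<L>. ((\<lambda>t. \<phi> (x + t *\<^sub>R i)) has_real_derivative ?G x \<bullet> i) (at 0)" if "i \<in> Basis" for i
      unfolding G[OF that] by (intro AE_I2 directional_derivative smooth_differentiable[OF assms])
  qed
qed

lemma smooth_H1: "smooth \<phi> \<Longrightarrow> \<phi> \<in> H1 \<Omega>"
  unfolding H1_def using smooth_L2 smooth_weak_gradient by blast

lemma smooth_wgrad:
  assumes "smooth \<phi>" "i \<in> Basis"
  shows "AE x in \<L>. wgrad \<Omega> \<phi> x \<bullet> i = frechet_derivative \<phi> (at x) i"
  using wgrad_AE_eq[OF smooth_weak_gradient[OF assms(1)]]
  by eventually_elim (use assms(2) in \<open>simp add: inner_sum_left inner_Basis if_distrib sum.delta cong: if_cong\<close>)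

text \<open>A continuous, piecewise affine function is Lipschitz along segments, and differentiable off
  the negligible union of the boundaries of the elements.\<close>

lemma fe_space_subset_H1:
  assumes mesh: "fe_mesh \<Omega> \<T>" and v: "v \<in> fe_space \<Omega> \<T>"
  shows "v \<in> H1 \<Omega>"
proof -
  have tri: "finite \<T>" "\<And>T T'. T \<in> \<T> \<Longrightarrow> T' \<in> \<T> \<Longrightarrow> (T \<inter> T') face_of T" "\<Union>\<T> = closure \<Omega>"
    "\<And>T. T \<in> \<T> \<Longrightarrow> int DIM('a) simplex T"
    using mesh by (auto simp: fe_mesh_def triangulation_def)
  have conv: "convex T" "closed T" if "T \<in> \<T>" for T
    using tri(4)[OF that] convex_simplex closed_simplex by blast+
  have cont: "continuous_on (closure \<Omega>) v" using v by (simp add: fe_space_def)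
  have "compact (v ` closure \<Omega>)"
    using bounded_\<Omega> by (intro compact_continuous_image cont) (simp add: compact_closure)
  then have "bounded (v ` closure \<Omega>)" by (rule compact_imp_bounded)
  then obtain B where "\<forall>y\<in>v ` closure \<Omega>. norm y \<le> B" unfolding bounded_iff by blast
  then have B: "\<bar>v x\<bar> \<le> B" if "x \<in> closure \<Omega>" for x using that by simp
  have vm: "v \<in> borel_measurable \<L>"
    using continuous_on_subset[OF cont closure_subset] sets_\<Omega>
    by (rule continuous_imp_measurable_on_sets_lebesgue)
  have "\<forall>T\<in>\<T>. \<exists>dc. \<forall>x\<in>T. v x = fst dc \<bullet> x + snd dc"
    using v by (force simp: fe_space_def)
  then obtain dc where dc: "\<And>T x. T \<in> \<T> \<Longrightarrow> x \<in> T \<Longrightarrow> v x = fst (dc T) \<bullet> x + snd (dc T)"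
    using bchoice[of \<T>] by metis
  define d where "d T = fst (dc T)" for T
  \<comment> \<open>On each open element this is the slope of v. On the frontiers shared by elements
    it is an arbitrary value on a null set.\<close>
  define G where "G x = (\<Sum>T\<in>\<T>. indicator (interior T) x *\<^sub>R d T)" for x
  define L where "L = (\<Sum>T\<in>\<T>. norm (d T))"
  have dL: "norm (d T) \<le> L" if "T \<in> \<T>" for T
    unfolding L_def using that tri(1) by (intro member_le_sum) auto
  \<comment> \<open>The intersection of two elements is a face of each, and a face meeting the
    interior is the whole element; so distinct elements have disjoint interiors.\<close>
  have disj: "x \<notin> interior T'" if T: "T \<in> \<T>" "T' \<in> \<T>" "T' \<noteq> T" "x \<in> interior T" for T T' x
  proof
    assume x: "x \<in> interior T'"
    have xi: "x \<in> T \<inter> T'" using x that interior_subset by blast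
    have "T \<inter> T' = T"
      using face_of_disjoint_interior[OF tri(2)[OF T(1,2)]] T(4) xi by blast
    moreover have "T' \<inter> T = T'"
      using face_of_disjoint_interior[OF tri(2)[OF T(2,1)]] x xi by blast
    ultimately show False using T(3) by blast
  qed
  have Gd: "G x = d T" if T: "T \<in> \<T>" "x \<in> interior T" for T x
  proof -
    have "G x = (\<Sum>T'\<in>\<T>. if T' = T then d T else 0)"
      unfolding G_def using T disj by (intro sum.cong) (auto simp: indicator_def)
    then show ?thesis using T tri(1) by simp
  qed
  have "weak_gradient \<Omega> v G"
  proof (rule weak_gradientI_lipschitz[OF open_\<Omega> bounded_\<Omega> vm])
    show "\<bar>v x\<bar> \<le> B" if "x \<in> \<Omega>" for x using B that closure_subset by blast
    show "\<bar>v x - v y\<bar> \<le> L * norm (x - y)" if seg: "closed_segment x y \<subseteq> \<Omega>" for x y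
    proof -
      let ?l = "\<lambda>t. x + t *\<^sub>R (y - x)"
      \<comment> \<open>The parameters whose points lie in one element form a closed set on which v
        is affine. Lipschitz bounds on a finite closed cover of an interval glue together without
        loss in the constant.\<close>
      have "lipschitz_on (L * norm (x - y)) {0..1} (\<lambda>t. v (?l t))"
      proof (rule lipschitz_on_closed_Union[where I = \<T> and U = "\<lambda>T. ?l -` T"])
        show "0 \<le> L * norm (x - y)" by (simp add: L_def sum_nonneg)
        show "finite \<T>" by (rule tri)
        show "closed (?l -` T)" if "T \<in> \<T>" for T
          by (intro continuous_closed_vimage conv(2)[OF that]) (auto intro!: continuous_intros)
        show "{0..1} \<subseteq> (\<Union>T\<in>\<T>. ?l -` T)"
        proof
          fix t :: real assume t: "t \<in> {0..1}"
          have "?l t \<in> closed_segment x y"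
            unfolding closed_segment_def using t
            by (auto intro!: exI[of _ t] simp: algebra_simps)
          then have "?l t \<in> \<Union>\<T>" using seg closure_subset unfolding tri(3) by blast
          then show "t \<in> (\<Union>T\<in>\<T>. ?l -` T)" by auto
        qed
        show "lipschitz_on (L * norm (x - y)) (?l -` T) (\<lambda>t. v (?l t))" if T: "T \<in> \<T>" for T
        proof (rule lipschitz_onI)
          fix t s assume ts: "t \<in> ?l -` T" "s \<in> ?l -` T"
          have "v (?l t) - v (?l s) = (t - s) * (d T \<bullet> (y - x))"
            using dc[OF T] ts by (simp add: d_def inner_add_right algebra_simps)
          then have "dist (v (?l t)) (v (?l s)) = \<bar>t - s\<bar> * \<bar>d T \<bullet> (y - x)\<bar>"
            by (simp add: dist_real_def abs_mult)
          also have "\<dots> \<le> \<bar>t - s\<bar> * (L * norm (x - y))"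
          proof (intro mult_left_mono)
            have "\<bar>d T \<bullet> (y - x)\<bar> \<le> norm (d T) * norm (y - x)" by (rule Cauchy_Schwarz_ineq2)
            also have "\<dots> \<le> L * norm (y - x)" using dL[OF T] by (intro mult_right_mono) auto
            finally show "\<bar>d T \<bullet> (y - x)\<bar> \<le> L * norm (x - y)" by (simp add: norm_minus_commute)
          qed simp
          finally show "dist (v (?l t)) (v (?l s)) \<le> L * norm (x - y) * dist t s"
            by (simp add: dist_real_def mult.commute)
        qed (simp add: L_def sum_nonneg)
      qed
      from lipschitz_onD[OF this, of 0 1] show ?thesis by (simp add: dist_real_def)
    qed
    show "(\<lambda>x. G x \<bullet> i) \<in> borel_measurable \<L>" if "i \<in> Basis" for i
    proof -
      have "(\<lambda>x. indicator (interior T) x :: real) \<in> borel_measurable \<L>" for T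
        by (intro measurable_restrict_space1 borel_measurable_indicator) simp
      then show ?thesis unfolding G_def inner_sum_left inner_scaleR_left
        by (intro borel_measurable_sum borel_measurable_times) auto
    qed
    show "\<bar>G x \<bullet> i\<bar> \<le> L" if "i \<in> Basis" "x \<in> \<Omega>" for i x
    proof -
      have "\<bar>G x \<bullet> i\<bar> \<le> norm (G x)" using that by (simp add: Basis_le_norm)
      also have "\<dots> \<le> (\<Sum>T\<in>\<T>. norm (indicator (interior T) x *\<^sub>R d T))"
        unfolding G_def by (rule norm_sum)
      also have "\<dots> \<le> L" unfolding L_def by (intro sum_mono) (auto simp: indicator_def)
      finally show ?thesis .
    qed
    show "AE x in \<L>. ((\<lambda>t. v (x + t *\<^sub>R i)) has_real_derivative G x \<bullet> i) (at 0)" if "i \<in> Basis" for i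
    proof -
      have neg: "(\<Union>T\<in>\<T>. frontier T) \<in> null_sets lebesgue"
        unfolding negligible_iff_null_sets[symmetric] using tri(1) conv(1)
        by (intro negligible_Union) (auto intro: negligible_convex_frontier)
      have "((\<lambda>t. v (x + t *\<^sub>R i)) has_real_derivative G x \<bullet> i) (at 0)"
        if x: "x \<in> \<Omega>" "x \<notin> (\<Union>T\<in>\<T>. frontier T)" for x
      proof -
        obtain T where T: "T \<in> \<T>" "x \<in> T" using x(1) closure_subset tri(3) by blast
        then have xi: "x \<in> interior T" using x(2) closure_subset by (auto simp: frontier_def)
        have op: "open ((\<lambda>t. x + t *\<^sub>R i) -` interior T)"
          by (intro continuous_open_vimage) (auto intro!: continuous_intros)
        have "((\<lambda>t. d T \<bullet> x + t * (d T \<bullet> i) + snd (dc T)) has_real_derivative d T \<bullet> i) (at 0)"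
          by (auto intro!: derivative_eq_intros)
        then have "((\<lambda>t. v (x + t *\<^sub>R i)) has_real_derivative d T \<bullet> i) (at 0)"
        proof (rule has_field_derivative_transform_within_open[OF _ op])
          show "0 \<in> (\<lambda>t. x + t *\<^sub>R i) -` interior T" using xi by simp
          fix t assume "t \<in> (\<lambda>t. x + t *\<^sub>R i) -` interior T"
          then have "x + t *\<^sub>R i \<in> T" using interior_subset by blast
          from dc[OF T(1) this] show "d T \<bullet> x + t * (d T \<bullet> i) + snd (dc T) = v (x + t *\<^sub>R i)"
            by (simp add: d_def inner_add_right)
        qed
        then show ?thesis using Gd[OF T(1) xi] by simp
      qed
      then have "AE x in lebesgue. x \<in> \<Omega> \<longrightarrow> ((\<lambda>t. v (x + t *\<^sub>R i)) has_real_derivative G x \<bullet> i) (at 0)"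
        by (intro AE_I'[OF neg]) auto
      then show ?thesis using sets_\<Omega> by (simp add: AE_restrict_space_iff)
    qed
  qed
  moreover have "v \<in> L2 \<L>"
    using B closure_subset by (intro L2_bounded[OF lmeasurable_\<Omega> vm, of B]) blast
  ultimately show ?thesis by (auto simp: H1_def)
qed

end

section \<open>Regularity of smooth functions\<close>

text \<open>The integrand is compared with a multiple of \<open>2 powr (\<beta> * k)\<close> on the \<open>k\<close>-th dyadic
  annulus.\<close>

lemma nn_integral_norm_powr_ball_finite:
  fixes \<beta> R :: real
  assumes \<beta>: "\<beta> < DIM('a::euclidean_space)" and R: "R > 0"
  shows "(\<integral>\<^sup>+w. ennreal (norm (w::'a) powr (- \<beta>)) * indicator (ball 0 R) w \<partial>lebesgue) < \<infinity>"
proof -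
  \<comment> \<open>The first factor rescales to the unit annulus. There the radius t lies between
    1/2 and 1, and the second factor bounds \<open>t powr (- \<beta>)\<close> for either sign of
    \<beta>.\<close>
  define C where "C = R powr (- \<beta>) * 2 powr \<bar>\<beta>\<bar>"
  define V where "V = unit_ball_vol (real DIM('a))"
  let ?n = "DIM('a)"
  have C: "C \<ge> 0" by (simp add: C_def)
  have V: "V \<ge> 0" by (simp add: V_def)
  let ?f = "\<lambda>k (w::'a). ennreal (C * (2 powr \<beta>) ^ k) * indicator (ball 0 (R / 2 ^ k)) w"
  have bound: "ennreal (norm w powr (- \<beta>)) * indicator (ball 0 R) w \<le> (\<Sum>k. ?f k w)" for w :: 'a
  proof (cases "w \<noteq> 0 \<and> norm w < R")
    case True
    then have w: "norm w > 0" "norm w < R" by auto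
    have "(\<lambda>k. R * (1 / 2) ^ k) \<longlonglongrightarrow> R * 0"
      by (intro tendsto_mult tendsto_const LIMSEQ_power_zero) simp
    then have "eventually (\<lambda>k. R * (1 / 2) ^ k < norm w) sequentially"
      using order_tendstoD(2) w(1) by force
    then obtain k0 where "R * (1 / 2) ^ k0 < norm w" by (auto simp: eventually_sequentially)
    then have ex: "\<exists>k. R / 2 ^ k \<le> norm w" by (intro exI[of _ k0]) (simp add: power_one_over)
    \<comment> \<open>m is the first index whose radius is at most \<open>norm w\<close>. It is
      positive because \<open>norm w < R\<close>, and its predecessor k indexes the annulus
      containing w.\<close>
    define m where "m = (LEAST k. R / 2 ^ k \<le> norm w)"
    have m: "R / 2 ^ m \<le> norm w" unfolding m_def by (rule LeastI_ex[OF ex])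
    have "m \<noteq> 0" using m w by (intro notI) simp
    then obtain k where k: "m = Suc k" by (cases m) auto
    have lt: "norm w < R / 2 ^ k"
      using not_less_Least[of k "\<lambda>k. R / 2 ^ k \<le> norm w"] k unfolding m_def[symmetric] by simp
    define t where "t = norm w * 2 ^ k / R"
    have t: "1 / 2 \<le> t" "t < 1" using m lt R unfolding k t_def by (simp_all add: field_simps)
    have "norm w = R * t / 2 ^ k" using R by (simp add: t_def)
    then have "norm w powr (- \<beta>) = R powr (- \<beta>) * t powr (- \<beta>) / (2 ^ k) powr (- \<beta>)"
      using R t by (simp add: powr_divide powr_mult)
    also have "\<dots> = R powr (- \<beta>) * t powr (- \<beta>) * (2 powr \<beta>) ^ k"
      by (simp add: powr_minus divide_inverse powr_power powr_realpow[symmetric] powr_powr mult.commute)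
    also have "t powr (- \<beta>) \<le> 2 powr \<bar>\<beta>\<bar>"
    proof -
      have "t powr (- \<beta>) = (1 / t) powr \<beta>" using t by (simp add: powr_minus powr_divide inverse_eq_divide)
      also have "\<dots> \<le> (1 / t) powr \<bar>\<beta>\<bar>" using t by (intro powr_mono) auto
      also have "\<dots> \<le> 2 powr \<bar>\<beta>\<bar>" using t by (intro powr_mono2) (auto simp: field_simps)
      finally show ?thesis .
    qed
    finally have "norm w powr (- \<beta>) \<le> C * (2 powr \<beta>) ^ k"
      by (simp add: C_def mult_left_mono mult_right_mono)
    then have "ennreal (norm w powr (- \<beta>)) * indicator (ball 0 R) w \<le> ?f k w"
      using w lt by (simp add: ennreal_leI)
    also have "\<dots> = (\<Sum>j\<in>{k}. ?f j w)"
      by (simp only: sum.insert sum.empty finite.emptyI empty_iff not_False_eq_True add_0_right)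
    also have "\<dots> \<le> (\<Sum>k. ?f k w)" by (rule sum_le_suminf) auto
    finally show ?thesis .
  qed auto
  have "(\<integral>\<^sup>+w. ennreal (norm (w::'a) powr (- \<beta>)) * indicator (ball 0 R) w \<partial>lebesgue)
      \<le> (\<integral>\<^sup>+w. (\<Sum>k. ?f k w) \<partial>lebesgue)"
    by (intro nn_integral_mono bound)
  also have "\<dots> = (\<Sum>k. \<integral>\<^sup>+w. ?f k w \<partial>lebesgue)"
    by (intro nn_integral_suminf borel_measurable_times_ennreal borel_measurable_const borel_measurable_indicator) simp
  \<comment> \<open>The volume of the k-th ball turns the terms into a geometric series, whose ratio
    is below 1 exactly because \<beta> is smaller than the dimension.\<close>
  also have "\<dots> = (\<Sum>k. ennreal (C * V * R ^ ?n * ((2 powr (\<beta> - ?n)) ^ k)))"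
  proof (intro arg_cong[where f = suminf] ext)
    fix k
    have "(\<integral>\<^sup>+w. ?f k w \<partial>lebesgue) = ennreal (C * (2 powr \<beta>) ^ k) * emeasure lebesgue (ball (0::'a) (R / 2 ^ k))"
      by (intro nn_integral_cmult_indicator) simp
    also have "emeasure lebesgue (ball (0::'a) (R / 2 ^ k)) = ennreal (V * (R / 2 ^ k) ^ ?n)"
      using R by (simp add: emeasure_ball V_def)
    also have "ennreal (C * (2 powr \<beta>) ^ k) * \<dots> = ennreal (C * (2 powr \<beta>) ^ k * (V * (R / 2 ^ k) ^ ?n))"
      using C V R by (simp add: ennreal_mult)
    also have "C * (2 powr \<beta>) ^ k * (V * (R / 2 ^ k) ^ ?n) = C * V * R ^ ?n * ((2 powr (\<beta> - ?n)) ^ k)"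
      by (simp add: powr_diff power_divide powr_realpow power_mult[symmetric] mult.commute)
    finally show "(\<integral>\<^sup>+w. ?f k w \<partial>lebesgue) = ennreal (C * V * R ^ ?n * ((2 powr (\<beta> - ?n)) ^ k))" .
  qed
  also have "\<dots> < \<infinity>"
  proof -
    have "2 powr (\<beta> - ?n) < 2 powr 0" using \<beta> by (intro powr_less_mono) auto
    then have "(\<lambda>k. (2 powr (\<beta> - ?n)) ^ k) sums (1 / (1 - 2 powr (\<beta> - ?n)))"
      by (intro geometric_sums) simp
    then have "(\<lambda>k. C * V * R ^ ?n * (2 powr (\<beta> - ?n)) ^ k) sums (C * V * R ^ ?n * (1 / (1 - 2 powr (\<beta> - ?n))))"
      by (rule sums_mult)
    then show ?thesis using C V R by (subst suminf_ennreal_eq) auto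
  qed
  finally show ?thesis .
qed

context bounded_open
begin

text \<open>The Lipschitz bound for \<phi> reduces the quotient to a multiple of
  \<open>norm (y - x) powr (- \<beta>)\<close> with \<beta> below the dimension, which is where s <
  1 enters. By translation the inner integral is bounded uniformly in x, and the outer measure is
  finite. The function f is kept apart from \<phi> because it will be a component of
  \<open>wgrad\<close>.\<close>

lemma slobodeckij_integrable:
  assumes f: "f \<in> borel_measurable \<L>" and \<phi>: "smooth \<phi>" and eq: "AE x in \<L>. f x = \<phi> x"
    and s: "s < 1"
  shows "integrable (\<L> \<Otimes>\<^sub>M \<L>) (slobodeckij_quotient s f)"
proof (rule integrableI_bounded)
  have fst: "(\<lambda>p. fst p) \<in> borel_measurable (\<L> \<Otimes>\<^sub>M \<L>)" and snd: "(\<lambda>p. snd p) \<in> borel_measurable (\<L> \<Otimes>\<^sub>M \<L>)"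
  proof -
    have id: "(\<lambda>x. x) \<in> borel_measurable \<L>"
      by (intro measurable_restrict_space1 measurable_completion) simp
    show "(\<lambda>p. fst p) \<in> borel_measurable (\<L> \<Otimes>\<^sub>M \<L>)" "(\<lambda>p. snd p) \<in> borel_measurable (\<L> \<Otimes>\<^sub>M \<L>)"
      using measurable_compose[OF measurable_fst id] measurable_compose[OF measurable_snd id] by auto
  qed
  have f1: "(\<lambda>p. f (fst p)) \<in> borel_measurable (\<L> \<Otimes>\<^sub>M \<L>)" and f2: "(\<lambda>p. f (snd p)) \<in> borel_measurable (\<L> \<Otimes>\<^sub>M \<L>)"
    using measurable_compose[OF measurable_fst f] measurable_compose[OF measurable_snd f] by auto
  show m: "slobodeckij_quotient s f \<in> borel_measurable (\<L> \<Otimes>\<^sub>M \<L>)"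
    unfolding slobodeckij_quotient_def split_beta
    by (intro borel_measurable_divide borel_measurable_power borel_measurable_diff f1 f2
        powr_real_measurable borel_measurable_dist fst snd borel_measurable_const)
  obtain R where R: "R > 0" "\<Omega> \<subseteq> cball 0 R" by (rule \<Omega>_cball)
  obtain L where L: "L \<ge> 0" "\<And>x y. x \<in> cball 0 R \<Longrightarrow> y \<in> cball 0 R \<Longrightarrow> \<bar>\<phi> x - \<phi> y\<bar> \<le> L * norm (x - y)"
    using smooth_lipschitz_on_cball[OF \<phi>] by metis
  define \<beta> where "\<beta> = real DIM('a) + 2 * s - 2"
  \<comment> \<open>Differences of points of \<Omega> have norm at most 2 R, so the open ball of
    radius \<open>2 * R + 1\<close> contains them all.\<close>
  let ?k = "\<lambda>w::'a. ennreal (norm w powr (- \<beta>)) * indicator (ball 0 (2 * R + 1)) w"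
  let ?I = "\<integral>\<^sup>+w. ?k w \<partial>lebesgue"
  have I: "?I < \<infinity>"
    by (rule nn_integral_norm_powr_ball_finite) (use s R in \<open>simp_all add: \<beta>_def\<close>)
  have km: "?k \<in> borel_measurable lebesgue"
  proof (intro measurable_completion borel_measurable_times_ennreal borel_measurable_indicator)
    show "(\<lambda>w::'a. ennreal (norm w powr (- \<beta>))) \<in> borel_measurable lborel" by measurable
  qed simp
  have pt: "ennreal (norm (slobodeckij_quotient s f (x, y))) \<le> ennreal (L\<^sup>2) * ?k (y - x)"
    if xy: "x \<in> \<Omega>" "y \<in> \<Omega>" "f x = \<phi> x" "f y = \<phi> y" for x y
  proof (cases "x = y")
    case True
    then show ?thesis by (simp add: slobodeckij_quotient_def)
  next
    case False
    define d where "d = norm (y - x)"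
    have d: "d > 0" using False by (simp add: d_def)
    have n: "norm x \<le> R" "norm y \<le> R" using xy R by auto
    then have "d < 2 * R + 1" using norm_triangle_ineq4[of y x] unfolding d_def by linarith
    moreover have "(\<phi> x - \<phi> y)\<^sup>2 \<le> (L * d)\<^sup>2"
      using L(2)[of x y] n by (intro abs_le_square_iff[THEN iffD1]) (simp add: d_def norm_minus_commute L(1))
    then have "(\<phi> x - \<phi> y)\<^sup>2 / d powr (real DIM('a) + 2 * s) \<le> L\<^sup>2 * (d\<^sup>2 / d powr (real DIM('a) + 2 * s))"
      by (simp add: power_mult_distrib divide_right_mono)
    moreover have "d\<^sup>2 / d powr (real DIM('a) + 2 * s) = d powr (- \<beta>)"
    proof -
      have "d\<^sup>2 = d powr 2" using d by (simp add: powr_numeral)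
      then show ?thesis by (simp add: powr_diff[symmetric] \<beta>_def)
    qed
    ultimately show ?thesis
      using xy(3,4) L(1) by (simp add: slobodeckij_quotient_def dist_norm norm_minus_commute[of x y] d_def[symmetric]
        ennreal_mult[symmetric] ennreal_leI)
  qed
  have inner: "(\<integral>\<^sup>+y. ennreal (norm (slobodeckij_quotient s f (x, y))) \<partial>\<L>) \<le> ennreal (L\<^sup>2) * ?I"
    if x: "x \<in> \<Omega>" "f x = \<phi> x" for x
  proof -
    have "AE y in \<L>. ennreal (norm (slobodeckij_quotient s f (x, y))) \<le> ennreal (L\<^sup>2) * ?k (y - x)"
      using eq AE_space[of \<L>] by eventually_elim (rule pt, use x in simp_all)
    then have "(\<integral>\<^sup>+y. ennreal (norm (slobodeckij_quotient s f (x, y))) \<partial>\<L>) \<le> (\<integral>\<^sup>+y. ennreal (L\<^sup>2) * ?k (y - x) \<partial>\<L>)"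
      by (rule nn_integral_mono_AE)
    also have "\<dots> = (\<integral>\<^sup>+y. ennreal (L\<^sup>2) * ?k (y - x) * indicator \<Omega> y \<partial>lebesgue)"
      using sets_\<Omega> by (simp add: nn_integral_restrict_space)
    also have "\<dots> \<le> (\<integral>\<^sup>+y. ennreal (L\<^sup>2) * ?k (- x + y) \<partial>lebesgue)"
      by (intro nn_integral_mono) (simp add: indicator_def)
    also have "\<dots> = ennreal (L\<^sup>2) * (\<integral>\<^sup>+y. ?k (- x + y) \<partial>lebesgue)"
      by (rule nn_integral_cmult) (rule measurable_compose[OF lebesgue_translation_measurable km])
    also have "(\<integral>\<^sup>+y. ?k (- x + y) \<partial>lebesgue) = ?I"
      by (rule nn_integral_lebesgue_translation[OF km])
    finally show ?thesis .
  qed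
  have "(\<integral>\<^sup>+p. ennreal (norm (slobodeckij_quotient s f p)) \<partial>(\<L> \<Otimes>\<^sub>M \<L>))
      = (\<integral>\<^sup>+x. \<integral>\<^sup>+y. ennreal (norm (slobodeckij_quotient s f (x, y))) \<partial>\<L> \<partial>\<L>)"
    by (rule fin.nn_integral_fst[symmetric]) (use m in simp)
  also have "\<dots> \<le> (\<integral>\<^sup>+x. ennreal (L\<^sup>2) * ?I \<partial>\<L>)"
  proof (rule nn_integral_mono_AE)
    show "AE x in \<L>. (\<integral>\<^sup>+y. ennreal (norm (slobodeckij_quotient s f (x, y))) \<partial>\<L>) \<le> ennreal (L\<^sup>2) * ?I"
      using eq AE_space[of \<L>] by eventually_elim (rule inner, simp_all)
  qed
  also have "\<dots> < \<infinity>"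
  proof -
    have "emeasure \<L> \<Omega> < top" using fin.emeasure_finite[of \<Omega>] unfolding less_top .
    then show ?thesis using I by (simp add: ennreal_mult_less_top)
  qed
  finally show "(\<integral>\<^sup>+p. ennreal (norm (slobodeckij_quotient s f p)) \<partial>(\<L> \<Otimes>\<^sub>M \<L>)) < \<infinity>" .
qed

text \<open>Makes smooth approximants admissible for the interpolation estimate: below order 2 the
  kernel bound applies with exponent \<open>r - 1 < 1\<close>; otherwise the partial derivatives are
  themselves smooth.\<close>

lemma smooth_Hr:
  assumes "smooth \<phi>"
  shows "\<phi> \<in> Hr \<Omega> r"
  unfolding Hr_def
proof (intro CollectI conjI ballI)
  show H: "\<phi> \<in> H1 \<Omega>" by (rule smooth_H1[OF assms])
  fix i :: 'a assume i: "i \<in> Basis"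
  note m = wgrad_component_measurable[OF H i] and p = smooth_partial[OF assms i]
    and eq = smooth_wgrad[OF assms i]
  show "if r < 2 then integrable (\<L> \<Otimes>\<^sub>M \<L>) (slobodeckij_quotient (r - 1) (\<lambda>x. wgrad \<Omega> \<phi> x \<bullet> i))
      else (\<lambda>x. wgrad \<Omega> \<phi> x \<bullet> i) \<in> H1 \<Omega>"
    using slobodeckij_integrable[OF m p eq, of "r - 1"] H1_AE_cong[OF smooth_H1[OF p] m eq] by simp
qed

end

section \<open>Traces\<close>

lemma space_surface_measure [simp]: "space surface_measure = UNIV"
  by (simp add: surface_measure_def)

lemma sets_surface_measure [simp]: "sets surface_measure = sets borel"
  unfolding surface_measure_def by (simp add: sets_measure_of_conv) (metis sets.sigma_sets_eq space_borel)

text \<open>\<open>trace_operator\<close> speaks of the whole frontier, the control problem of its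
  two portions; restriction keeps square integrability and does not increase the norm.\<close>

lemma surface_on_subset:
  assumes S: "S \<in> sets borel" "T \<in> sets borel" "S \<subseteq> T"
  shows "f \<in> L2 (surface_on T) \<Longrightarrow> f \<in> L2 (surface_on S)"
    and "f \<in> L2 (surface_on T) \<Longrightarrow> L2_norm (surface_on S) f \<le> L2_norm (surface_on T) f"
proof -
  assume f: "f \<in> L2 (surface_on T)"
  have T: "integrable surface_measure (\<lambda>x. indicator T x *\<^sub>R (f x)\<^sup>2)"
    using f S by (simp add: L2_def surface_on_def integrable_restrict_space)
  have "integrable surface_measure (\<lambda>x. indicator S x *\<^sub>R (indicator T x *\<^sub>R (f x)\<^sup>2))"
    using S by (intro integrable_mult_indicator T) simp
  moreover have "(\<lambda>x. indicator S x *\<^sub>R (indicator T x *\<^sub>R (f x)\<^sup>2)) = (\<lambda>x. indicator S x *\<^sub>R (f x)\<^sup>2)"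
    using S(3) by (auto simp: fun_eq_iff indicator_def)
  ultimately have S': "integrable surface_measure (\<lambda>x. indicator S x *\<^sub>R (f x)\<^sup>2)" by simp
  moreover have "f \<in> borel_measurable (surface_on S)"
    using f S(3) unfolding L2_def surface_on_def by (auto intro: measurable_restrict_mono)
  ultimately show "f \<in> L2 (surface_on S)"
    using S by (simp add: L2_def surface_on_def integrable_restrict_space)
  have "L2_inner (surface_on S) f f = (\<integral>x. indicator S x *\<^sub>R (f x)\<^sup>2 \<partial>surface_measure)"
    using S unfolding L2_inner_def surface_on_def by (subst integral_restrict_space) (simp_all add: power2_eq_square)
  also have "\<dots> \<le> (\<integral>x. indicator T x *\<^sub>R (f x)\<^sup>2 \<partial>surface_measure)"
    using S(3) by (intro integral_mono S' T) (auto simp: indicator_def)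
  also have "\<dots> = L2_inner (surface_on T) f f"
    using S unfolding L2_inner_def surface_on_def by (subst integral_restrict_space) (simp_all add: power2_eq_square)
  finally show "L2_norm (surface_on S) f \<le> L2_norm (surface_on T) f"
    unfolding L2_norm_def by (rule real_sqrt_le_mono)
qed

lemma AE_surface_on_iff:
  "S \<in> sets borel \<Longrightarrow> (AE x in surface_on S. P x) \<longleftrightarrow> (AE x in surface_measure. x \<in> S \<longrightarrow> P x)"
  unfolding surface_on_def by (rule AE_restrict_space_iff) simp

lemma AE_surface_on_subset:
  assumes "S \<in> sets borel" "T \<in> sets borel" "S \<subseteq> T" "AE x in surface_on T. P x"
  shows "AE x in surface_on S. P x"
  using assms(4) unfolding AE_surface_on_iff[OF assms(1)] AE_surface_on_iff[OF assms(2)]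
  by eventually_elim (use assms(3) in blast)

locale domain_with_trace = bounded_open \<Omega> for \<Omega> :: "'a::euclidean_space set" +
  fixes tr :: "('a \<Rightarrow> real) \<Rightarrow> 'a \<Rightarrow> real"
  assumes trace: "trace_operator \<Omega> tr"
begin

lemma
  assumes S: "S \<in> sets borel" "S \<subseteq> frontier \<Omega>"
  shows trace_L2: "v \<in> H1 \<Omega> \<Longrightarrow> tr v \<in> L2 (surface_on S)"
    and trace_linear: "v \<in> H1 \<Omega> \<Longrightarrow> w \<in> H1 \<Omega> \<Longrightarrow>
      AE x in surface_on S. tr (\<lambda>x. v x + c * w x) x = tr v x + c * tr w x"
    and trace_bounded: "\<exists>C\<ge>0. \<forall>v\<in>H1 \<Omega>. L2_norm (surface_on S) (tr v) \<le> C * H1_norm \<Omega> v"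
proof -
  have F: "frontier \<Omega> \<in> sets borel" by simp
  note t = trace[unfolded trace_operator_def Let_def]
  show "tr v \<in> L2 (surface_on S)" if "v \<in> H1 \<Omega>"
    using t that by (intro surface_on_subset(1)[OF S(1) F S(2)]) blast
  show "AE x in surface_on S. tr (\<lambda>x. v x + c * w x) x = tr v x + c * tr w x"
    if "v \<in> H1 \<Omega>" "w \<in> H1 \<Omega>"
    using t that by (intro AE_surface_on_subset[OF S(1) F S(2)]) blast
  obtain C where C: "\<And>v. v \<in> H1 \<Omega> \<Longrightarrow> L2_norm (surface_on (frontier \<Omega>)) (tr v) \<le> C * H1_norm \<Omega> v"
    using t by blast
  show "\<exists>C\<ge>0. \<forall>v\<in>H1 \<Omega>. L2_norm (surface_on S) (tr v) \<le> C * H1_norm \<Omega> v"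
  \<comment> \<open>The constant supplied by \<open>trace_operator\<close> carries no sign, whereas
    the abstract problem asks for a nonnegative one.\<close>
  proof (intro exI[of _ "\<bar>C\<bar>"] conjI ballI)
    fix v assume v: "v \<in> H1 \<Omega>"
    have "L2_norm (surface_on S) (tr v) \<le> L2_norm (surface_on (frontier \<Omega>)) (tr v)"
      using t v by (intro surface_on_subset(2)[OF S(1) F S(2)]) blast
    also have "\<dots> \<le> C * H1_norm \<Omega> v" by (rule C[OF v])
    also have "\<dots> \<le> \<bar>C\<bar> * H1_norm \<Omega> v"
      by (intro mult_right_mono) (simp_all add: H1_norm_def dirichlet_form_nonneg)
    finally show "L2_norm (surface_on S) (tr v) \<le> \<bar>C\<bar> * H1_norm \<Omega> v" .
  qed simp
qed

text \<open>The approximating sequence by which the trace is extended to \<open>H1\<close> also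
  converges in the \<open>H1\<close> norm, so density comes with the trace operator.\<close>

lemma smooth_dense:
  assumes "v \<in> H1 \<Omega>" "\<epsilon> > 0"
  obtains \<phi> where "smooth \<phi>" "H1_norm \<Omega> (\<lambda>x. v x - \<phi> x) < \<epsilon>"
proof -
  interpret V: semi_inner "H1 \<Omega>" H1_inner by (rule semi_inner_H1)
  obtain \<phi> where \<phi>: "\<And>k::nat. smooth (\<phi> k)" "(\<lambda>k. H1_norm \<Omega> (\<lambda>x. \<phi> k x - v x)) \<longlonglongrightarrow> 0"
    using trace assms(1) unfolding trace_operator_def Let_def by blast
  from order_tendstoD(2)[OF \<phi>(2) assms(2)] obtain k where "H1_norm \<Omega> (\<lambda>x. \<phi> k x - v x) < \<epsilon>"
    by (auto simp: eventually_sequentially)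
  then show thesis
    using that[OF \<phi>(1)] V.nrm_diff_swap[OF smooth_H1[OF \<phi>(1)] assms(1)] by (simp add: nrm_H1)
qed

text \<open>Pairing with q absorbs the null set on which \<open>tr\<close> fails to be linear and
  gives the exact identity required by the abstract problem.\<close>

lemma trace_inner_linear:
  assumes S: "S \<in> sets borel" "S \<subseteq> frontier \<Omega>"
    and v: "v \<in> H1 \<Omega>" "w \<in> H1 \<Omega>" and q: "q \<in> L2 (surface_on S)"
  shows "L2_inner (surface_on S) q (tr (\<lambda>x. v x + c * w x))
    = L2_inner (surface_on S) q (tr v) + c * L2_inner (surface_on S) q (tr w)"
proof -
  note T = trace_L2[OF S]
  have "L2_inner (surface_on S) q (tr (\<lambda>x. v x + c * w x))
      = L2_inner (surface_on S) q (\<lambda>x. tr v x + c * tr w x)"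
    unfolding L2_inner_def
  proof (rule integral_cong_AE)
    show "(\<lambda>x. q x * tr (\<lambda>x. v x + c * w x) x) \<in> borel_measurable (surface_on S)"
      by (intro borel_measurable_times L2_measurable q T H1_closed v)
    show "(\<lambda>x. q x * (tr v x + c * tr w x)) \<in> borel_measurable (surface_on S)"
      by (intro borel_measurable_times L2_measurable q L2_closed T v)
    show "AE x in surface_on S. q x * tr (\<lambda>x. v x + c * w x) x = q x * (tr v x + c * tr w x)"
      using trace_linear[OF S v, of c] by eventually_elim simp
  qed
  then show ?thesis
    using L2_inner_linear[OF T[OF v(1)] T[OF v(2)] q, of c] by (simp add: L2_inner_commute[of _ q])
qed

lemma semi_inner_robin_form:
  assumes S: "S \<in> sets borel" "S \<subseteq> frontier \<Omega>" and \<alpha>: "\<alpha> \<ge> 0"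
  shows "semi_inner (H1 \<Omega>) (robin_form \<Omega> S tr \<alpha>)"
proof
  show "robin_form \<Omega> S tr \<alpha> v w = robin_form \<Omega> S tr \<alpha> w v" for v w
    unfolding robin_form_def by (metis L2_inner_commute dirichlet_form_commute)
  show "0 \<le> robin_form \<Omega> S tr \<alpha> v v" for v
    using \<alpha> by (simp add: robin_form_def dirichlet_form_nonneg L2_inner_nonneg)
  show "robin_form \<Omega> S tr \<alpha> (\<lambda>x. v x + c * w x) y = robin_form \<Omega> S tr \<alpha> v y + c * robin_form \<Omega> S tr \<alpha> w y"
    if "v \<in> H1 \<Omega>" "w \<in> H1 \<Omega>" "y \<in> H1 \<Omega>" for v w y c
    using trace_inner_linear[OF S that(1,2) trace_L2[OF S that(3)], of c]
    by (simp add: robin_form_def dirichlet_form_linear[OF that] L2_inner_commute[of _ _ "tr y"] algebra_simps)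
qed (rule H1_closed)

text \<open>X is any error with a quasi-optimal bound. As \<open>u\<close> and \<open>p\<close> are
  merely in \<open>H1\<close>, the interpolants inserted are those of nearby smooth functions, which
  stay fixed while h tends to 0.\<close>

lemma approximation_tendsto_0:
  fixes X :: "real \<Rightarrow> real" and r :: real
  assumes X: "\<And>h. h \<in> \<H> \<Longrightarrow> 0 \<le> X h"
    "\<And>h w w'. h \<in> \<H> \<Longrightarrow> w \<in> W h \<Longrightarrow> w' \<in> W h \<Longrightarrow>
      X h \<le> K * (H1_norm \<Omega> (\<lambda>x. u x - w x) + H1_norm \<Omega> (\<lambda>x. p x - w' x))"
    and K: "K \<ge> 0" and up: "u \<in> H1 \<Omega>" "p \<in> H1 \<Omega>" and W: "\<And>h. h \<in> \<H> \<Longrightarrow> W h \<subseteq> H1 \<Omega>"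
    and \<pi>: "\<And>h v. h \<in> \<H> \<Longrightarrow> v \<in> Hr \<Omega> r \<Longrightarrow> \<pi> h v \<in> W h"
      "\<And>h v. h \<in> \<H> \<Longrightarrow> v \<in> Hr \<Omega> r \<Longrightarrow>
        H1_norm \<Omega> (\<lambda>x. v x - \<pi> h v x) \<le> c * h powr (r - 1) * Hr_norm \<Omega> r v"
    and r: "r > 1" and \<H>: "\<H> \<subseteq> {0<..}"
  shows "(X \<longlongrightarrow> 0) (at 0 within \<H>)"
proof (rule tendstoI)
  interpret V: semi_inner "H1 \<Omega>" H1_inner by (rule semi_inner_H1)
  fix \<epsilon> :: real assume \<epsilon>: "\<epsilon> > 0"
  \<comment> \<open>One \<delta> each for the approximation of \<open>u\<close> and of
    \<open>p\<close>, and one for both interpolation errors together; \<open>K + 1\<close> instead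
    of K keeps the quotient meaningful for K = 0.\<close>
  define \<delta> where "\<delta> = \<epsilon> / (3 * (K + 1))"
  have \<delta>: "\<delta> > 0" "K * (3 * \<delta>) < \<epsilon>" using \<epsilon> K by (simp_all add: \<delta>_def field_simps)
  obtain \<phi> where \<phi>: "smooth \<phi>" "H1_norm \<Omega> (\<lambda>x. u x - \<phi> x) < \<delta>" by (rule smooth_dense[OF up(1) \<delta>(1)])
  obtain \<psi> where \<psi>: "smooth \<psi>" "H1_norm \<Omega> (\<lambda>x. p x - \<psi> x) < \<delta>" by (rule smooth_dense[OF up(2) \<delta>(1)])
  define e where "e h = c * h powr (r - 1) * Hr_norm \<Omega> r \<phi> + c * h powr (r - 1) * Hr_norm \<Omega> r \<psi>" for h
  have pos: "\<forall>\<^sub>F h in at 0 within \<H>. h \<in> \<H>" by (simp add: eventually_at_filter)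
  then have nonneg: "\<forall>\<^sub>F h in at 0 within \<H>. 0 \<le> h" by eventually_elim (use \<H> in force)
  have "((\<lambda>h. h powr (r - 1)) \<longlongrightarrow> 0) (at 0 within \<H>)"
    by (rule tendsto_zero_powrI[of _ _ _ "r - 1"]) (use r nonneg in \<open>auto intro!: tendsto_eq_intros\<close>)
  then have "(e \<longlongrightarrow> c * 0 * Hr_norm \<Omega> r \<phi> + c * 0 * Hr_norm \<Omega> r \<psi>) (at 0 within \<H>)"
    unfolding e_def by (intro tendsto_add tendsto_mult tendsto_const)
  then have "(e \<longlongrightarrow> 0) (at 0 within \<H>)" by simp
  from order_tendstoD(2)[OF this \<delta>(1)] pos
  show "\<forall>\<^sub>F h in at 0 within \<H>. dist (X h) 0 < \<epsilon>"
  proof eventually_elim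
    fix h assume e: "e h < \<delta>" and h: "h \<in> \<H>"
    have 1: "\<pi> h \<phi> \<in> W h" "\<pi> h \<psi> \<in> W h" using \<pi>(1)[OF h smooth_Hr] \<phi>(1) \<psi>(1) by auto
    then have H: "\<pi> h \<phi> \<in> H1 \<Omega>" "\<pi> h \<psi> \<in> H1 \<Omega>" "\<phi> \<in> H1 \<Omega>" "\<psi> \<in> H1 \<Omega>"
      using W[OF h] smooth_H1 \<phi>(1) \<psi>(1) by auto
    have "H1_norm \<Omega> (\<lambda>x. u x - \<pi> h \<phi> x) \<le> \<delta> + c * h powr (r - 1) * Hr_norm \<Omega> r \<phi>"
      using V.nrm_triangle[OF up(1) H(3,1)] \<phi>(2) \<pi>(2)[OF h smooth_Hr[OF \<phi>(1)]] unfolding nrm_H1 by linarith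
    moreover have "H1_norm \<Omega> (\<lambda>x. p x - \<pi> h \<psi> x) \<le> \<delta> + c * h powr (r - 1) * Hr_norm \<Omega> r \<psi>"
      using V.nrm_triangle[OF up(2) H(4,2)] \<psi>(2) \<pi>(2)[OF h smooth_Hr[OF \<psi>(1)]] unfolding nrm_H1 by linarith
    ultimately have "H1_norm \<Omega> (\<lambda>x. u x - \<pi> h \<phi> x) + H1_norm \<Omega> (\<lambda>x. p x - \<pi> h \<psi> x) \<le> 3 * \<delta>"
      using e unfolding e_def by linarith
    then have "X h \<le> K * (3 * \<delta>)"
      using X(2)[OF h 1] K by (meson mult_left_mono order_trans)
    then show "dist (X h) 0 < \<epsilon>" using X(1)[OF h] \<delta>(2) by (simp add: dist_real_def)
  qed
qed

end

section \<open>Convergence of the finite element method\<close>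

lemma fe_space_closed:
  assumes "v \<in> fe_space \<Omega> \<T>" "w \<in> fe_space \<Omega> \<T>"
  shows "(\<lambda>x. v x + c * w x) \<in> fe_space \<Omega> \<T>"
  unfolding fe_space_def
proof (intro CollectI conjI ballI)
  show "continuous_on (closure \<Omega>) (\<lambda>x. v x + c * w x)"
    using assms unfolding fe_space_def by (auto intro!: continuous_intros)
  fix T assume "T \<in> \<T>"
  then obtain d e d' e' where "\<forall>x\<in>T. v x = d \<bullet> x + e" "\<forall>x\<in>T. w x = d' \<bullet> x + e'"
    using assms unfolding fe_space_def by blast
  then have "\<forall>x\<in>T. v x + c * w x = (d + c *\<^sub>R d') \<bullet> x + (e + c * e')"
    by (simp add: inner_add_left algebra_simps)
  then show "\<exists>d e. \<forall>x\<in>T. v x + c * w x = d \<bullet> x + e" by blast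
qed

theorem theorem14:
  fixes \<Omega> \<Gamma>\<^sub>1 \<Gamma>\<^sub>2 :: "'a::euclidean_space set"
    and tr :: "('a \<Rightarrow> real) \<Rightarrow> 'a \<Rightarrow> real"
    and g z :: "'a \<Rightarrow> real"
    and b M \<kappa>\<^sub>1 c\<^sub>0 r \<sigma> :: real
    and \<H> :: "real set"
    and \<tau> :: "real \<Rightarrow> 'a set set"
    and \<pi> :: "real \<Rightarrow> ('a \<Rightarrow> real) \<Rightarrow> 'a \<Rightarrow> real"
    and u p :: "real \<Rightarrow> ('a \<Rightarrow> real) \<Rightarrow> 'a \<Rightarrow> real"
    and uh ph :: "real \<Rightarrow> real \<Rightarrow> ('a \<Rightarrow> real) \<Rightarrow> 'a \<Rightarrow> real"
    and qop :: "real \<Rightarrow> 'a \<Rightarrow> real"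
    and qhop :: "real \<Rightarrow> real \<Rightarrow> 'a \<Rightarrow> real"
  assumes domain: "polygonal_domain \<Omega>" "lipschitz_boundary \<Omega>"
    and boundary: "\<Gamma>\<^sub>1 \<in> sets borel" "\<Gamma>\<^sub>2 \<in> sets borel"
      "frontier \<Omega> = \<Gamma>\<^sub>1 \<union> \<Gamma>\<^sub>2" "\<Gamma>\<^sub>1 \<inter> \<Gamma>\<^sub>2 = {}"
      "emeasure surface_measure \<Gamma>\<^sub>1 > 0" "emeasure surface_measure \<Gamma>\<^sub>2 > 0"
    and trace: "trace_operator \<Omega> tr"
    and data: "b > 0" "M > 0" "g \<in> L2 (lebesgue_on \<Omega>)" "z \<in> L2 (lebesgue_on \<Omega>)"
    and coercive: "\<kappa>\<^sub>1 > 0"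
      "\<And>v. v \<in> H1 \<Omega> \<Longrightarrow> \<kappa>\<^sub>1 * (H1_norm \<Omega> v)\<^sup>2 \<le> robin_form \<Omega> \<Gamma>\<^sub>1 tr 1 v v"
    and state: "\<And>\<alpha> q. \<alpha> > 0 \<Longrightarrow> q \<in> L2 (surface_on \<Gamma>\<^sub>2) \<Longrightarrow>
        is_state \<Omega> \<Gamma>\<^sub>1 \<Gamma>\<^sub>2 tr b g (H1 \<Omega>) \<alpha> q (u \<alpha> q)"
    and adjoint: "\<And>\<alpha> q. \<alpha> > 0 \<Longrightarrow> q \<in> L2 (surface_on \<Gamma>\<^sub>2) \<Longrightarrow>
        is_adjoint_state \<Omega> \<Gamma>\<^sub>1 tr z (H1 \<Omega>) \<alpha> (u \<alpha> q) (p \<alpha> q)"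
    and optimal: "\<And>\<alpha>. \<alpha> > 0 \<Longrightarrow> optimal_control \<Omega> \<Gamma>\<^sub>2 M z (u \<alpha>) (qop \<alpha>)"
    and mesh_parameters: "\<H> \<subseteq> {0<..}" "0 islimpt \<H>"
    and mesh: "\<And>h. h \<in> \<H> \<Longrightarrow> fe_mesh \<Omega> (\<tau> h)" "\<And>h. h \<in> \<H> \<Longrightarrow> mesh_size (\<tau> h) = h"
      "\<And>h. h \<in> \<H> \<Longrightarrow> shape_regular \<sigma> (\<tau> h)"
    and r: "1 < r" "r \<le> 2"
    and interpolation: "\<And>h. h \<in> \<H> \<Longrightarrow> interpolation_operator \<Omega> (\<tau> h) (\<pi> h)"
      "\<And>h v. h \<in> \<H> \<Longrightarrow> v \<in> Hr \<Omega> r \<Longrightarrow> \<pi> h v \<in> fe_space \<Omega> (\<tau> h)"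
    and interpolation_error: "c\<^sub>0 > 0"
      "\<And>h v. h \<in> \<H> \<Longrightarrow> v \<in> Hr \<Omega> r \<Longrightarrow>
        L2_norm (lebesgue_on \<Omega>) (\<lambda>x. v x - \<pi> h v x) \<le> c\<^sub>0 * h powr r * Hr_norm \<Omega> r v"
      "\<And>h v. h \<in> \<H> \<Longrightarrow> v \<in> Hr \<Omega> r \<Longrightarrow>
        H1_norm \<Omega> (\<lambda>x. v x - \<pi> h v x) \<le> c\<^sub>0 * h powr (r - 1) * Hr_norm \<Omega> r v"
    and discrete_state: "\<And>h \<alpha> q. h \<in> \<H> \<Longrightarrow> \<alpha> > 0 \<Longrightarrow> q \<in> L2 (surface_on \<Gamma>\<^sub>2) \<Longrightarrow>
        is_state \<Omega> \<Gamma>\<^sub>1 \<Gamma>\<^sub>2 tr b g (fe_space \<Omega> (\<tau> h)) \<alpha> q (uh h \<alpha> q)"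
    and discrete_adjoint: "\<And>h \<alpha> q. h \<in> \<H> \<Longrightarrow> \<alpha> > 0 \<Longrightarrow> q \<in> L2 (surface_on \<Gamma>\<^sub>2) \<Longrightarrow>
        is_adjoint_state \<Omega> \<Gamma>\<^sub>1 tr z (fe_space \<Omega> (\<tau> h)) \<alpha> (uh h \<alpha> q) (ph h \<alpha> q)"
    and discrete_optimal: "\<And>h \<alpha>. h \<in> \<H> \<Longrightarrow> \<alpha> > 0 \<Longrightarrow>
        optimal_control \<Omega> \<Gamma>\<^sub>2 M z (uh h \<alpha>) (qhop h \<alpha>)"
  shows "(\<forall>\<alpha>>1. u \<alpha> (qop \<alpha>) \<in> Hr \<Omega> r \<and> p \<alpha> (qop \<alpha>) \<in> Hr \<Omega> r \<and>
        M * \<kappa>\<^sub>1\<^sup>2 / (trace_norm \<Omega> \<Gamma>\<^sub>2 tr)\<^sup>2 > 1 \<longrightarrow>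
      (\<exists>c. \<forall>h\<in>\<H>.
        L2_norm (surface_on \<Gamma>\<^sub>2) (\<lambda>x. qhop h \<alpha> x - qop \<alpha> x) \<le> c * h powr (r - 1) \<and>
        H1_norm \<Omega> (\<lambda>x. uh h \<alpha> (qhop h \<alpha>) x - u \<alpha> (qop \<alpha>) x) \<le> c * h powr (r - 1) \<and>
        H1_norm \<Omega> (\<lambda>x. ph h \<alpha> (qhop h \<alpha>) x - p \<alpha> (qop \<alpha>) x) \<le> c * h powr (r - 1))) \<and>
      (\<forall>\<alpha>>1.
        ((\<lambda>h. L2_norm (surface_on \<Gamma>\<^sub>2) (\<lambda>x. qhop h \<alpha> x - qop \<alpha> x)) \<longlongrightarrow> 0) (at 0 within \<H>) \<and>
        ((\<lambda>h. H1_norm \<Omega> (\<lambda>x. uh h \<alpha> (qhop h \<alpha>) x - u \<alpha> (qop \<alpha>) x)) \<longlongrightarrow> 0) (at 0 within \<H>) \<and>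
        ((\<lambda>h. H1_norm \<Omega> (\<lambda>x. ph h \<alpha> (qhop h \<alpha>) x - p \<alpha> (qop \<alpha>) x)) \<longlongrightarrow> 0) (at 0 within \<H>))"
proof -
  interpret domain_with_trace \<Omega> tr
    using domain(1) trace by unfold_locales (auto simp: polygonal_domain_def)
  have \<Gamma>: "\<Gamma>\<^sub>1 \<subseteq> frontier \<Omega>" "\<Gamma>\<^sub>2 \<subseteq> frontier \<Omega>" using boundary by auto
  note \<Gamma>1 = boundary(1) \<Gamma>(1) and \<Gamma>2 = boundary(2) \<Gamma>(2)
  obtain C\<^sub>1 where C\<^sub>1: "C\<^sub>1 \<ge> 0"
    "\<And>v. v \<in> H1 \<Omega> \<Longrightarrow> L2_norm (surface_on \<Gamma>\<^sub>1) (tr v) \<le> C\<^sub>1 * H1_norm \<Omega> v"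
    using trace_bounded[OF \<Gamma>1] by blast
  obtain C\<^sub>2 where C\<^sub>2: "C\<^sub>2 \<ge> 0"
    "\<And>v. v \<in> H1 \<Omega> \<Longrightarrow> L2_norm (surface_on \<Gamma>\<^sub>2) (tr v) \<le> C\<^sub>2 * H1_norm \<Omega> v"
    using trace_bounded[OF \<Gamma>2] by blast
  have W_H1: "fe_space \<Omega> (\<tau> h) \<subseteq> H1 \<Omega>" if "h \<in> \<H>" for h
    using fe_space_subset_H1[OF mesh(1)[OF that]] by blast
  let ?Q = "L2 (surface_on \<Gamma>\<^sub>2)" and ?iQ = "L2_inner (surface_on \<Gamma>\<^sub>2)"
  \<comment> \<open>Both halves of the theorem follow from this single bound; they differ only in
    the finite element functions inserted for \<open>w\<close> and \<open>w'\<close>.\<close>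
  have key: "\<exists>K\<ge>0. \<forall>h\<in>\<H>. \<forall>w\<in>fe_space \<Omega> (\<tau> h). \<forall>w'\<in>fe_space \<Omega> (\<tau> h).
      L2_norm (surface_on \<Gamma>\<^sub>2) (\<lambda>x. qhop h \<alpha> x - qop \<alpha> x)
        \<le> K * (H1_norm \<Omega> (\<lambda>x. u \<alpha> (qop \<alpha>) x - w x) + H1_norm \<Omega> (\<lambda>x. p \<alpha> (qop \<alpha>) x - w' x)) \<and>
      H1_norm \<Omega> (\<lambda>x. uh h \<alpha> (qhop h \<alpha>) x - u \<alpha> (qop \<alpha>) x)
        \<le> K * (H1_norm \<Omega> (\<lambda>x. u \<alpha> (qop \<alpha>) x - w x) + H1_norm \<Omega> (\<lambda>x. p \<alpha> (qop \<alpha>) x - w' x)) \<and>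
      H1_norm \<Omega> (\<lambda>x. ph h \<alpha> (qhop h \<alpha>) x - p \<alpha> (qop \<alpha>) x)
        \<le> K * (H1_norm \<Omega> (\<lambda>x. u \<alpha> (qop \<alpha>) x - w x) + H1_norm \<Omega> (\<lambda>x. p \<alpha> (qop \<alpha>) x - w' x))"
    if \<alpha>: "\<alpha> > 1" for \<alpha>
  proof -
    have \<alpha>0: "\<alpha> > 0" using \<alpha> by simp
    let ?a = "robin_form \<Omega> \<Gamma>\<^sub>1 tr \<alpha>"
    let ?F = "\<lambda>v. L2_inner \<L> g v + \<alpha> * (\<integral>x. b * tr v x \<partial>surface_on \<Gamma>\<^sub>1)"
    have norm_sq: "(L2_norm N f)\<^sup>2 = L2_inner N f f" for N :: "'a measure" and f
      by (simp add: L2_norm_def L2_inner_nonneg)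
    \<comment> \<open>\<open>?F\<close> collects the data common to all controls. Since \<alpha> >
      1, enlarging the boundary term keeps \<open>\<kappa>\<^sub>1\<close> a coercivity constant;
      \<open>1 + \<alpha> * C\<^sub>1\<^sup>2\<close> adds the gradient part and the trace bound on
      \<open>\<Gamma>\<^sub>1\<close>.\<close>
    interpret CP: control_problem "L2 \<L>" "H1 \<Omega>" ?Q "L2_inner \<L>" H1_inner ?a ?iQ tr ?F z M \<kappa>\<^sub>1
      "1 + \<alpha> * C\<^sub>1\<^sup>2" C\<^sub>2
    proof (intro control_problem.intro control_problem_axioms.intro semi_inner_L2 semi_inner_H1
        semi_inner_robin_form \<Gamma>1 data(2,4) coercive(1) C\<^sub>2(1), goal_cases)
      case 1 show ?case using \<alpha> by simp
    next
      case 2 show ?case using H1_L2 by blast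
    next
      case (3 v) show ?case by (simp add: H1_inner_def dirichlet_form_nonneg)
    next
      case (4 v)
      have "robin_form \<Omega> \<Gamma>\<^sub>1 tr 1 v v \<le> ?a v v"
        using \<alpha> L2_inner_nonneg[of "surface_on \<Gamma>\<^sub>1" "tr v"]
        by (simp add: robin_form_def mult_le_cancel_right1)
      then show ?case using coercive(2)[OF 4] by (simp add: H1_norm_sq)
    next
      case 5 show ?case using \<alpha> by simp
    next
      case (6 v)
      have "(L2_norm (surface_on \<Gamma>\<^sub>1) (tr v))\<^sup>2 \<le> (C\<^sub>1 * H1_norm \<Omega> v)\<^sup>2"
        by (intro power_mono C\<^sub>1(2) 6) (simp add: L2_norm_def L2_inner_nonneg)
      then have "\<alpha> * L2_inner (surface_on \<Gamma>\<^sub>1) (tr v) (tr v) \<le> \<alpha> * (C\<^sub>1\<^sup>2 * H1_inner v v)"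
        using \<alpha> by (intro mult_left_mono) (simp_all add: norm_sq power_mult_distrib H1_norm_sq)
      moreover have "dirichlet_form \<Omega> v v \<le> H1_inner v v" by (simp add: H1_inner_def L2_inner_nonneg)
      ultimately show ?case by (simp add: robin_form_def algebra_simps)
    next
      case (7 v) show ?case by (rule trace_L2[OF \<Gamma>2 7])
    next
      case (8 v w q c) show ?case by (rule trace_inner_linear[OF \<Gamma>2 8])
    next
      case (9 v) show ?case using C\<^sub>2(2)[OF 9] by (simp add: nrm_L2 nrm_H1)
    qed
    have st: "CP.state W q y" if "is_state \<Omega> \<Gamma>\<^sub>1 \<Gamma>\<^sub>2 tr b g W \<alpha> q y" for W q y
      using that unfolding CP.state_def is_state_def by (simp add: algebra_simps)
    have ad: "CP.adj W y s" if "is_adjoint_state \<Omega> \<Gamma>\<^sub>1 tr z W \<alpha> y s" for W y s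
      using that unfolding CP.adj_def is_adjoint_state_def by simp
    have W: "CP.subsp (fe_space \<Omega> (\<tau> h))" if "h \<in> \<H>" for h
      using W_H1[OF that] fe_space_closed by (auto simp: CP.subsp_def)
    \<comment> \<open>The trial space is left open, so the same fact gives the optimality condition
      of the continuous problem and of every discrete one.\<close>
    have opt: "q \<in> ?Q" "\<And>\<eta>. \<eta> \<in> ?Q \<Longrightarrow> M * ?iQ q \<eta> = ?iQ \<eta> (tr (P q))"
      if oc: "optimal_control \<Omega> \<Gamma>\<^sub>2 M z S q" and W: "CP.subsp W"
        and S: "\<And>q. q \<in> ?Q \<Longrightarrow> CP.state W q (S q)" and P: "\<And>q. q \<in> ?Q \<Longrightarrow> CP.adj W (S q) (P q)"
      for S P q W
    proof -
      show q: "q \<in> ?Q" using oc by (simp add: optimal_control_def is_arg_min_def)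
      show "M * ?iQ q \<eta> = ?iQ \<eta> (tr (P q))" if "\<eta> \<in> ?Q" for \<eta>
      proof (rule CP.optimality_condition[OF W S P[OF q] q _ that])
        fix q' assume "q' \<in> ?Q"
        then have "\<not> cost \<Omega> \<Gamma>\<^sub>2 M z S q' < cost \<Omega> \<Gamma>\<^sub>2 M z S q"
          using oc by (auto simp: optimal_control_def is_arg_min_def)
        then show "L2_inner \<L> (\<lambda>x. S q x - z x) (\<lambda>x. S q x - z x) / 2 + M / 2 * ?iQ q q
            \<le> L2_inner \<L> (\<lambda>x. S q' x - z x) (\<lambda>x. S q' x - z x) / 2 + M / 2 * ?iQ q' q'"
          by (simp add: cost_def norm_sq not_less)
      qed
    qed
    have S: "CP.state (H1 \<Omega>) q (u \<alpha> q)" and P: "CP.adj (H1 \<Omega>) (u \<alpha> q) (p \<alpha> q)" if "q \<in> ?Q" for q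
      using st[OF state[OF \<alpha>0 that]] ad[OF adjoint[OF \<alpha>0 that]] by auto
    note q = opt[OF optimal[OF \<alpha>0] CP.subsp_V S P]
    show ?thesis
    proof (rule CP.quasi_optimal[OF S P q, unfolded nrm_L2 nrm_H1])
      fix K assume K: "K \<ge> 0"
        "\<And>W Sh Ph qh w w'. CP.subsp W \<Longrightarrow> (\<And>q. q \<in> ?Q \<Longrightarrow> CP.state W q (Sh q)) \<Longrightarrow>
          (\<And>q. q \<in> ?Q \<Longrightarrow> CP.adj W (Sh q) (Ph q)) \<Longrightarrow> qh \<in> ?Q \<Longrightarrow>
          (\<And>\<eta>. \<eta> \<in> ?Q \<Longrightarrow> M * ?iQ qh \<eta> = ?iQ \<eta> (tr (Ph qh))) \<Longrightarrow> w \<in> W \<Longrightarrow> w' \<in> W \<Longrightarrow>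
          L2_norm (surface_on \<Gamma>\<^sub>2) (\<lambda>x. qh x - qop \<alpha> x)
            \<le> K * (H1_norm \<Omega> (\<lambda>x. u \<alpha> (qop \<alpha>) x - w x) + H1_norm \<Omega> (\<lambda>x. p \<alpha> (qop \<alpha>) x - w' x)) \<and>
          H1_norm \<Omega> (\<lambda>x. Sh qh x - u \<alpha> (qop \<alpha>) x)
            \<le> K * (H1_norm \<Omega> (\<lambda>x. u \<alpha> (qop \<alpha>) x - w x) + H1_norm \<Omega> (\<lambda>x. p \<alpha> (qop \<alpha>) x - w' x)) \<and>
          H1_norm \<Omega> (\<lambda>x. Ph qh x - p \<alpha> (qop \<alpha>) x)
            \<le> K * (H1_norm \<Omega> (\<lambda>x. u \<alpha> (qop \<alpha>) x - w x) + H1_norm \<Omega> (\<lambda>x. p \<alpha> (qop \<alpha>) x - w' x))"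
      show ?thesis
      proof (intro exI[of _ K] conjI[OF K(1)] ballI)
        fix h w w' assume h: "h \<in> \<H>" and w: "w \<in> fe_space \<Omega> (\<tau> h)" "w' \<in> fe_space \<Omega> (\<tau> h)"
        have Sh: "CP.state (fe_space \<Omega> (\<tau> h)) q (uh h \<alpha> q)"
          and Ph: "CP.adj (fe_space \<Omega> (\<tau> h)) (uh h \<alpha> q) (ph h \<alpha> q)" if "q \<in> ?Q" for q
          using st[OF discrete_state[OF h \<alpha>0 that]] ad[OF discrete_adjoint[OF h \<alpha>0 that]] by auto
        note qh = opt[OF discrete_optimal[OF h \<alpha>0] W[OF h] Sh Ph]
        show "L2_norm (surface_on \<Gamma>\<^sub>2) (\<lambda>x. qhop h \<alpha> x - qop \<alpha> x)
            \<le> K * (H1_norm \<Omega> (\<lambda>x. u \<alpha> (qop \<alpha>) x - w x) + H1_norm \<Omega> (\<lambda>x. p \<alpha> (qop \<alpha>) x - w' x)) \<and>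
          H1_norm \<Omega> (\<lambda>x. uh h \<alpha> (qhop h \<alpha>) x - u \<alpha> (qop \<alpha>) x)
            \<le> K * (H1_norm \<Omega> (\<lambda>x. u \<alpha> (qop \<alpha>) x - w x) + H1_norm \<Omega> (\<lambda>x. p \<alpha> (qop \<alpha>) x - w' x)) \<and>
          H1_norm \<Omega> (\<lambda>x. ph h \<alpha> (qhop h \<alpha>) x - p \<alpha> (qop \<alpha>) x)
            \<le> K * (H1_norm \<Omega> (\<lambda>x. u \<alpha> (qop \<alpha>) x - w x) + H1_norm \<Omega> (\<lambda>x. p \<alpha> (qop \<alpha>) x - w' x))"
          by (rule K(2)[OF W[OF h] Sh Ph qh w])
      qed
    qed
  qed
  show ?thesis
  proof (intro conjI allI impI, goal_cases)
    case (1 \<alpha>)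
    then have \<alpha>: "\<alpha> > 1" and reg: "u \<alpha> (qop \<alpha>) \<in> Hr \<Omega> r" "p \<alpha> (qop \<alpha>) \<in> Hr \<Omega> r" by auto
    obtain K where K: "K \<ge> 0" "\<And>h w w'. h \<in> \<H> \<Longrightarrow> w \<in> fe_space \<Omega> (\<tau> h) \<Longrightarrow> w' \<in> fe_space \<Omega> (\<tau> h) \<Longrightarrow>
      L2_norm (surface_on \<Gamma>\<^sub>2) (\<lambda>x. qhop h \<alpha> x - qop \<alpha> x)
        \<le> K * (H1_norm \<Omega> (\<lambda>x. u \<alpha> (qop \<alpha>) x - w x) + H1_norm \<Omega> (\<lambda>x. p \<alpha> (qop \<alpha>) x - w' x)) \<and>
      H1_norm \<Omega> (\<lambda>x. uh h \<alpha> (qhop h \<alpha>) x - u \<alpha> (qop \<alpha>) x)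
        \<le> K * (H1_norm \<Omega> (\<lambda>x. u \<alpha> (qop \<alpha>) x - w x) + H1_norm \<Omega> (\<lambda>x. p \<alpha> (qop \<alpha>) x - w' x)) \<and>
      H1_norm \<Omega> (\<lambda>x. ph h \<alpha> (qhop h \<alpha>) x - p \<alpha> (qop \<alpha>) x)
        \<le> K * (H1_norm \<Omega> (\<lambda>x. u \<alpha> (qop \<alpha>) x - w x) + H1_norm \<Omega> (\<lambda>x. p \<alpha> (qop \<alpha>) x - w' x))"
      using key[OF \<alpha>] by blast
    \<comment> \<open>This depends on \<alpha> and on the regularity norms of the two optimal
      states, but not on h: K was fixed before h, and \<open>c\<^sub>0\<close> is uniform over the
      meshes.\<close>
    define c where "c = K * (c\<^sub>0 * Hr_norm \<Omega> r (u \<alpha> (qop \<alpha>)) + c\<^sub>0 * Hr_norm \<Omega> r (p \<alpha> (qop \<alpha>)))"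
    show ?case
    proof (intro exI[of _ c] ballI)
      fix h assume h: "h \<in> \<H>"
      have "K * (H1_norm \<Omega> (\<lambda>x. u \<alpha> (qop \<alpha>) x - \<pi> h (u \<alpha> (qop \<alpha>)) x)
          + H1_norm \<Omega> (\<lambda>x. p \<alpha> (qop \<alpha>) x - \<pi> h (p \<alpha> (qop \<alpha>)) x))
        \<le> K * (c\<^sub>0 * h powr (r - 1) * Hr_norm \<Omega> r (u \<alpha> (qop \<alpha>)) + c\<^sub>0 * h powr (r - 1) * Hr_norm \<Omega> r (p \<alpha> (qop \<alpha>)))"
        by (intro mult_left_mono add_mono interpolation_error(3) h reg K(1))
      also have "\<dots> = c * h powr (r - 1)" by (simp add: c_def algebra_simps)
      finally show "L2_norm (surface_on \<Gamma>\<^sub>2) (\<lambda>x. qhop h \<alpha> x - qop \<alpha> x) \<le> c * h powr (r - 1) \<and>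
        H1_norm \<Omega> (\<lambda>x. uh h \<alpha> (qhop h \<alpha>) x - u \<alpha> (qop \<alpha>) x) \<le> c * h powr (r - 1) \<and>
        H1_norm \<Omega> (\<lambda>x. ph h \<alpha> (qhop h \<alpha>) x - p \<alpha> (qop \<alpha>) x) \<le> c * h powr (r - 1)"
        using K(2)[OF h interpolation(2)[OF h reg(1)] interpolation(2)[OF h reg(2)]] by linarith
    qed
  next
    \<comment> \<open>Shared by the three limits; X is in turn the error of the control, of the
      state and of the adjoint state.\<close>
    have lim: "(X \<longlongrightarrow> 0) (at 0 within \<H>)"
      if \<alpha>: "\<alpha> > 1" and K: "K \<ge> 0" and X: "\<And>h. h \<in> \<H> \<Longrightarrow> 0 \<le> X h"
        "\<And>h w w'. h \<in> \<H> \<Longrightarrow> w \<in> fe_space \<Omega> (\<tau> h) \<Longrightarrow> w' \<in> fe_space \<Omega> (\<tau> h) \<Longrightarrow>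
          X h \<le> K * (H1_norm \<Omega> (\<lambda>x. u \<alpha> (qop \<alpha>) x - w x) + H1_norm \<Omega> (\<lambda>x. p \<alpha> (qop \<alpha>) x - w' x))"
      for X \<alpha> K
    proof (rule approximation_tendsto_0[OF X K _ _ W_H1 interpolation(2) interpolation_error(3) r(1) mesh_parameters(1)])
      have "qop \<alpha> \<in> ?Q" using optimal[of \<alpha>] \<alpha> by (simp add: optimal_control_def is_arg_min_def)
      then show "u \<alpha> (qop \<alpha>) \<in> H1 \<Omega>" "p \<alpha> (qop \<alpha>) \<in> H1 \<Omega>"
        using state[of \<alpha> "qop \<alpha>"] adjoint[of \<alpha> "qop \<alpha>"] \<alpha> by (simp_all add: is_state_def is_adjoint_state_def)
    qed
    have nonneg: "0 \<le> L2_norm N f" "0 \<le> H1_norm \<Omega> f" for N :: "'a measure" and f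
      by (simp_all add: L2_norm_def L2_inner_nonneg H1_norm_def dirichlet_form_nonneg)
    {
      case (2 \<alpha>)
      then obtain K where "K \<ge> 0" and K: "\<And>h w w'. h \<in> \<H> \<Longrightarrow> w \<in> fe_space \<Omega> (\<tau> h) \<Longrightarrow> w' \<in> fe_space \<Omega> (\<tau> h) \<Longrightarrow>
          L2_norm (surface_on \<Gamma>\<^sub>2) (\<lambda>x. qhop h \<alpha> x - qop \<alpha> x)
          \<le> K * (H1_norm \<Omega> (\<lambda>x. u \<alpha> (qop \<alpha>) x - w x) + H1_norm \<Omega> (\<lambda>x. p \<alpha> (qop \<alpha>) x - w' x))"
        using key[of \<alpha>] by blast
      then show ?case by (intro lim[OF 2 _ nonneg(1)])
    next
      case (3 \<alpha>)
      then obtain K where "K \<ge> 0" and K: "\<And>h w w'. h \<in> \<H> \<Longrightarrow> w \<in> fe_space \<Omega> (\<tau> h) \<Longrightarrow> w' \<in> fe_space \<Omega> (\<tau> h) \<Longrightarrow>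
          H1_norm \<Omega> (\<lambda>x. uh h \<alpha> (qhop h \<alpha>) x - u \<alpha> (qop \<alpha>) x)
          \<le> K * (H1_norm \<Omega> (\<lambda>x. u \<alpha> (qop \<alpha>) x - w x) + H1_norm \<Omega> (\<lambda>x. p \<alpha> (qop \<alpha>) x - w' x))"
        using key[of \<alpha>] by blast
      then show ?case by (intro lim[OF 3 _ nonneg(2)])
    next
      case (4 \<alpha>)
      then obtain K where "K \<ge> 0" and K: "\<And>h w w'. h \<in> \<H> \<Longrightarrow> w \<in> fe_space \<Omega> (\<tau> h) \<Longrightarrow> w' \<in> fe_space \<Omega> (\<tau> h) \<Longrightarrow>
          H1_norm \<Omega> (\<lambda>x. ph h \<alpha> (qhop h \<alpha>) x - p \<alpha> (qop \<alpha>) x)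
          \<le> K * (H1_norm \<Omega> (\<lambda>x. u \<alpha> (qop \<alpha>) x - w x) + H1_norm \<Omega> (\<lambda>x. p \<alpha> (qop \<alpha>) x - w' x))"
        using key[of \<alpha>] by blast
      then show ?case by (intro lim[OF 4 _ nonneg(2)])
    }
  qed
qed

end
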